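(* Let $G$ be an abelian group. For every integer $n\ge 0$ there exist a covariant functor $$\check{\mathrm H}_{n}^{\infty}(-,-;G):\mathcal{N}^{2}_{p}\to \mathcal{A}b$$ and a contravariant functor $$\hat{\mathrm H}^{n}_{\infty}(-,-;G):\mathcal{N}^{2}_{p}\to \mathcal{A}b$$ given on objects $(X,A)$ of $\mathcal{N}^2_p$ by $\check{\mathrm H}_{n}^{\infty}(-,-;G)(X,A)=\check H_n^\infty(X,A;G)$ and $\hat{\mathrm H}^{n}_{\infty}(-,-;G)(X,A)=\hat H^n_\infty(X,A;G)$, and on morphisms $f:(X,A)\to(Y,B)$ of $\mathcal{N}^2_p$ by $\check{\mathrm H}_{n}^{\infty}(-,-;G)(f)=f_*^\infty$ and $\hat{\mathrm H}^{n}_{\infty}(-,-;G)(f)=f^*_\infty$.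
   Context: Conventions. Normal spaces are $T_1$ (hence Hausdorff). $\mathcal{N}^2_p$ is the category whose objects are closed pairs $(X,A)$, i.e. $X$ a normal space and $A\subseteq X$ closed, and whose morphisms $f:(X,A)\to(Y,B)$ are proper maps $f:X\to Y$ (continuous, preimages of compact sets are compact) with $f(A)\subseteq B$. $\mathcal{A}b$ is the category of abelian groups. An indexed family $\alpha=\{\alpha_v\}_{v\in(V_\alpha,V_\alpha^A)}$ of subsets of $X$ is a function $v\mapsto\alpha_v$ on an index set $V_\alpha$ together with a distinguished subset $V_\alpha^A\subseteq V_\alpha$; it is finite if $V_\alpha$ is finite. Border covers. A border cover of a closed pair $(X,A)$ is a finite indexed family $\alpha=\{\alpha_v\}_{v\in(V_\alpha,V_\alpha^A)}$ of open subsets of $X$ for which there is a compact $K_\alpha\subseteq X$ with $X\setminus K_\alpha=\bigcup_{v\in V_\alpha}\alpha_v$ and $A\setminus K_\alpha\subseteq\bigcup_{v\in V_\alpha^A}\alpha_v$. The set of border covers is $\mathrm{cov}_\infty(X,A)$, directed by $\alpha\le\beta$ iff there is a refinement projection $p:V_\beta\to V_\alpha$ with $p(V_\beta^A)\subseteq V_\alpha^A$ and $\beta_v\subseteq\alpha_{p(v)}$ for all $v\in V_\beta$. Border groups. For $\alpha\in\mathrm{cov}_\infty(X,A)$ let $X_\alpha$ be the nerve: its simplexes are the nonempty finite $s\subseteq V_\alpha$ with $\mathrm{Car}_\alpha(s)=\bigcap_{v\in s}\alpha_v\neq\emptyset$; $A_\alpha$ is the subcomplex of simplexes $s\subseteq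 V_\alpha^A$ with $\mathrm{Car}_\alpha(s)\cap A\neq\emptyset$. Refinement projections induce simplicial maps $(X_\beta,A_\beta)\to(X_\alpha,A_\alpha)$, any two contiguous, hence well-defined homomorphisms in simplicial (co)homology. Put $\check H_n^\infty(X,A;G)=\varprojlim_{\alpha}H_n(X_\alpha,A_\alpha;G)$ and $\hat H^n_\infty(X,A;G)=\varinjlim_{\alpha}H^n(X_\alpha,A_\alpha;G)$ over $\mathrm{cov}_\infty(X,A)$. Induced homomorphisms. Let $f:(X,A)\to(Y,B)$ be a morphism of $\mathcal{N}^2_p$. For $\alpha\in\mathrm{cov}_\infty(Y,B)$ the family $f^{-1}(\alpha)=\{f^{-1}(\alpha_v)\}_{v\in(V_\alpha,V_\alpha^B)}$ is a border cover of $(X,A)$, and its nerve pair $(X_{f^{-1}(\alpha)},A_{f^{-1}(\alpha)})$ is a subcomplex pair of $(Y_\alpha,B_\alpha)$; let $f_\alpha$ be the simplicial inclusion. The homomorphisms $f_{\alpha*}$ and $f_\alpha^*$ together with $\alpha\mapsto f^{-1}(\alpha)$ are maps of inverse, respectively direct, systems; their limits are $f_*^\infty:\check H_n^\infty(X,A;G)\to\check H_n^\infty(Y,B;G)$ and $f^*_\infty:\hat H^n_\infty(Y,B;G)\to\hat H^n_\infty(X,A;G)$. *)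

theory Defs
  imports "HOL-Analysis.Abstract_Topological_Spaces" "HOL-Algebra.Free_Abelian_Groups"
begin

section \<open>The category of closed pairs of normal spaces and proper maps\<close>

definition N2p_obj :: "('a topology \<times> 'a set) set" where
  "N2p_obj = {(X, A). normal_space X \<and> t1_space X \<and> closedin X A}"

text \<open>The library constant \<open>proper_map\<close> means ``closed with compact fibres'', which is a different
  notion; here a proper map is a continuous map for which preimages of compact sets are compact.\<close>

definition proper_continuous_map :: "'a topology \<Rightarrow> 'b topology \<Rightarrow> ('a \<Rightarrow> 'b) \<Rightarrow> bool" where
  "proper_continuous_map X Y f \<longleftrightarrow>
     continuous_map X Y f \<and>
     (\<forall>K. compactin Y K \<longrightarrow> compactin X {x \<in> topspace X. f x \<in> K})"

text \<open>Morphisms are extensional functions, so that they are equal as soon as they agree on the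
  underlying space of their source.\<close>

definition N2p_hom :: "'a topology \<times> 'a set \<Rightarrow> 'b topology \<times> 'b set \<Rightarrow> ('a \<Rightarrow> 'b) set" where
  "N2p_hom P Q = {f \<in> extensional (topspace (fst P)).
     proper_continuous_map (fst P) (fst Q) f \<and> f ` snd P \<subseteq> snd Q}"

definition N2p_id :: "'a topology \<times> 'a set \<Rightarrow> 'a \<Rightarrow> 'a" where
  "N2p_id P = (\<lambda>x\<in>topspace (fst P). x)"

definition N2p_comp :: "'a topology \<times> 'a set \<Rightarrow> ('b \<Rightarrow> 'c) \<Rightarrow> ('a \<Rightarrow> 'b) \<Rightarrow> 'a \<Rightarrow> 'c" where
  "N2p_comp P g f = compose (topspace (fst P)) g f"

lemma N2p_id_in_hom:
  assumes "P \<in> N2p_obj"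
  shows "N2p_id P \<in> N2p_hom P P"
proof -
  obtain X A where P: "P = (X, A)" by fastforce
  have A: "A \<subseteq> topspace X"
    using assms by (auto simp: P N2p_obj_def dest: closedin_subset)
  have "continuous_map X X (\<lambda>x\<in>topspace X. x)"
    by (rule continuous_map_eq [OF continuous_map_id]) simp
  moreover have "{x \<in> topspace X. (\<lambda>x\<in>topspace X. x) x \<in> K} = K" if "compactin X K" for K
    using compactin_subset_topspace [OF that] by auto
  ultimately show ?thesis
    using A by (auto simp: P N2p_hom_def N2p_id_def proper_continuous_map_def)
qed

lemma N2p_comp_in_hom:
  assumes f: "f \<in> N2p_hom P Q" and g: "g \<in> N2p_hom Q R" and P: "P \<in> N2p_obj"
  shows "N2p_comp P g f \<in> N2p_hom P R"
proof -
  obtain X A where XA: "P = (X, A)" by fastforce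
  obtain Y B where YB: "Q = (Y, B)" by fastforce
  obtain Z C where ZC: "R = (Z, C)" by fastforce
  have A: "A \<subseteq> topspace X"
    using P by (auto simp: XA N2p_obj_def dest: closedin_subset)
  have cf: "continuous_map X Y f" and cg: "continuous_map Y Z g"
    and pf: "\<And>K. compactin Y K \<Longrightarrow> compactin X {x \<in> topspace X. f x \<in> K}"
    and pg: "\<And>K. compactin Z K \<Longrightarrow> compactin Y {y \<in> topspace Y. g y \<in> K}"
    and fA: "f ` A \<subseteq> B" and gB: "g ` B \<subseteq> C"
    using f g by (auto simp: XA YB ZC N2p_hom_def proper_continuous_map_def)
  have "continuous_map X Z (compose (topspace X) g f)"
    by (rule continuous_map_eq [OF continuous_map_compose [OF cf cg]]) (simp add: compose_eq)
  moreover have "compactin X {x \<in> topspace X. compose (topspace X) g f x \<in> K}"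
    if "compactin Z K" for K
  proof -
    have "{x \<in> topspace X. compose (topspace X) g f x \<in> K}
        = {x \<in> topspace X. f x \<in> {y \<in> topspace Y. g y \<in> K}}"
      using continuous_map_image_subset_topspace [OF cf] by (auto simp: compose_eq)
    then show ?thesis using pf [OF pg [OF that]] by simp
  qed
  moreover have "compose (topspace X) g f ` A \<subseteq> C"
    using A fA gB by (auto simp: compose_def subset_iff image_subset_iff)
  ultimately show ?thesis
    by (simp add: XA ZC N2p_hom_def N2p_comp_def proper_continuous_map_def)
qed


section \<open>Simplicial homology and cohomology of a pair of complexes\<close>

text \<open>A simplicial complex is given by its set of simplexes, each of them a nonempty finite set of
  vertices. An \<open>n\<close>-simplex is oriented by an ordering of its vertices.\<close>

definition ordered_simplexes :: "'v set set \<Rightarrow> nat \<Rightarrow> 'v list set" where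
  "ordered_simplexes K n = {vs. length vs = Suc n \<and> distinct vs \<and> set vs \<in> K}"

text \<open>Oriented simplicial chains with coefficients in the abelian group \<open>G\<close> (written
  multiplicatively): finitely supported functions on the ordered \<open>n\<close>-simplexes that are inverted
  by every transposition of two vertices. The oriented simplex \<open>[v\<^sub>0, \<dots>, v\<^sub>n]\<close> with coefficient \<open>g\<close>
  corresponds to the function that is \<open>g\<close> on even and the inverse of \<open>g\<close> on odd rearrangements of
  \<open>(v\<^sub>0, \<dots>, v\<^sub>n)\<close>. Chains are extended by the unit element to all lists, so the chains of a
  subcomplex form a subset of the chains of the complex.\<close>

definition simplicial_chain_group ::
  "('g, 'm) monoid_scheme \<Rightarrow> 'v set set \<Rightarrow> nat \<Rightarrow> ('v list \<Rightarrow> 'g) monoid" where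
  "simplicial_chain_group G K n =
    \<lparr>carrier = {c. (\<forall>vs. c vs \<in> carrier G) \<and>
                   (\<forall>vs. vs \<notin> ordered_simplexes K n \<longrightarrow> c vs = \<one>\<^bsub>G\<^esub>) \<and>
                   finite {vs. c vs \<noteq> \<one>\<^bsub>G\<^esub>} \<and>
                   (\<forall>vs i j. i < j \<and> j < length vs \<longrightarrow>
                      c (vs[i := vs ! j, j := vs ! i]) = inv\<^bsub>G\<^esub> (c vs))},
     monoid.mult = (\<lambda>c d vs. c vs \<otimes>\<^bsub>G\<^esub> d vs),
     one = (\<lambda>vs. \<one>\<^bsub>G\<^esub>)\<rparr>"

text \<open>In terms of coefficients, \<open>\<partial>[v\<^sub>0, \<dots>, v\<^sub>n] = \<Sum>\<^sub>i (-1)\<^sup>i [v\<^sub>0, \<dots>, v\<^sub>n without v\<^sub>i]\<close> reads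
  \<open>(\<partial>c)(w\<^sub>1, \<dots>, w\<^sub>n) = \<Sum>\<^sub>v c(v, w\<^sub>1, \<dots>, w\<^sub>n)\<close>, since removing the vertex in position \<open>i\<close> amounts to
  moving it to the front, with sign \<open>(-1)\<^sup>i\<close>, and dropping it there. \<open>gfinprod\<close> is the product of
  the finitely many terms different from the unit. As in the library's singular homology, the
  boundary is trivial for \<open>n = 0\<close>, and the truncated \<open>0 - 1 = 0\<close> then is a harmless target degree.\<close>

definition simplicial_boundary ::
  "('g, 'm) monoid_scheme \<Rightarrow> nat \<Rightarrow> ('v list \<Rightarrow> 'g) \<Rightarrow> 'v list \<Rightarrow> 'g" where
  "simplicial_boundary G n c =
     (\<lambda>ws. if n = 0 then \<one>\<^bsub>G\<^esub> else gfinprod G (\<lambda>v. c (v # ws)) UNIV)"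

text \<open>The chain map of a vertex map \<open>p\<close>: \<open>[v\<^sub>0, \<dots>, v\<^sub>n]\<close> goes to \<open>[p v\<^sub>0, \<dots>, p v\<^sub>n]\<close>, which is zero
  if two of the \<open>p v\<^sub>i\<close> coincide.\<close>

definition simplicial_chain_map ::
  "('g, 'm) monoid_scheme \<Rightarrow> ('v \<Rightarrow> 'w) \<Rightarrow> ('v list \<Rightarrow> 'g) \<Rightarrow> 'w list \<Rightarrow> 'g" where
  "simplicial_chain_map G p c =
     (\<lambda>ws. if distinct ws then gfinprod G c {vs. map p vs = ws} else \<one>\<^bsub>G\<^esub>)"

text \<open>The relative homology group is relative cycles modulo relative boundaries.\<close>

definition simplicial_relcycles ::
  "('g, 'm) monoid_scheme \<Rightarrow> nat \<Rightarrow> 'v set set \<Rightarrow> 'v set set \<Rightarrow> ('v list \<Rightarrow> 'g) set" where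
  "simplicial_relcycles G n K L =
     {c \<in> carrier (simplicial_chain_group G K n).
        simplicial_boundary G n c \<in> carrier (simplicial_chain_group G L (n - 1))}"

definition simplicial_relboundaries ::
  "('g, 'm) monoid_scheme \<Rightarrow> nat \<Rightarrow> 'v set set \<Rightarrow> 'v set set \<Rightarrow> ('v list \<Rightarrow> 'g) set" where
  "simplicial_relboundaries G n K L =
     {simplicial_boundary G (Suc n) d \<otimes>\<^bsub>simplicial_chain_group G K n\<^esub> e | d e.
        d \<in> carrier (simplicial_chain_group G K (Suc n)) \<and>
        e \<in> carrier (simplicial_chain_group G L n)}"

definition simplicial_homology ::
  "('g, 'm) monoid_scheme \<Rightarrow> nat \<Rightarrow> 'v set set \<times> 'v set set \<Rightarrow> ('v list \<Rightarrow> 'g) set monoid" where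
  "simplicial_homology G n KL = (case KL of (K, L) \<Rightarrow>
     (simplicial_chain_group G K n)\<lparr>carrier := simplicial_relcycles G n K L\<rparr>
       Mod simplicial_relboundaries G n K L)"

text \<open>The map induced between quotient groups by a map \<open>h\<close> of representatives; \<open>N\<close> is the subgroup
  divided out in the target.\<close>

definition coset_map ::
  "('d, 'n) monoid_scheme \<Rightarrow> 'd set \<Rightarrow> ('c \<Rightarrow> 'd) \<Rightarrow> 'c set \<Rightarrow> 'd set" where
  "coset_map D N h S = (\<Union>z\<in>S. N #>\<^bsub>D\<^esub> h z)"

definition simplicial_homology_map ::
  "('g, 'm) monoid_scheme \<Rightarrow> nat \<Rightarrow> 'v set set \<times> 'v set set \<Rightarrow> 'w set set \<times> 'w set set \<Rightarrow>
    ('v \<Rightarrow> 'w) \<Rightarrow> ('v list \<Rightarrow> 'g) set \<Rightarrow> ('w list \<Rightarrow> 'g) set" where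
  "simplicial_homology_map G n KL KL' p =
     (\<lambda>S\<in>carrier (simplicial_homology G n KL).
        coset_map (simplicial_chain_group G (fst KL') n)
          (simplicial_relboundaries G n (fst KL') (snd KL'))
          (simplicial_chain_map G p) S)"

text \<open>Cochains: homomorphisms to \<open>G\<close> from the integral chains of \<open>K\<close> that vanish on those of \<open>L\<close>.\<close>

definition simplicial_cochain_group ::
  "('g, 'm) monoid_scheme \<Rightarrow> nat \<Rightarrow> 'v set set \<Rightarrow> 'v set set \<Rightarrow>
    (('v list \<Rightarrow> int) \<Rightarrow> 'g) monoid" where
  "simplicial_cochain_group G n K L =
    (let C = simplicial_chain_group integer_group K n in
     \<lparr>carrier = {\<phi> \<in> hom C G \<inter> extensional (carrier C).
                   \<forall>c\<in>carrier (simplicial_chain_group integer_group L n). \<phi> c = \<one>\<^bsub>G\<^esub>},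
      monoid.mult = (\<lambda>\<phi> \<psi>. \<lambda>c\<in>carrier C. \<phi> c \<otimes>\<^bsub>G\<^esub> \<psi> c),
      one = (\<lambda>c\<in>carrier C. \<one>\<^bsub>G\<^esub>)\<rparr>)"

text \<open>The coboundary \<open>\<phi> \<mapsto> \<phi> \<circ> \<partial>\<close> into degree \<open>n\<close>, trivial for \<open>n = 0\<close> because \<open>\<partial>\<close> is.\<close>

definition simplicial_coboundary ::
  "nat \<Rightarrow> 'v set set \<Rightarrow> (('v list \<Rightarrow> int) \<Rightarrow> 'g) \<Rightarrow> ('v list \<Rightarrow> int) \<Rightarrow> 'g" where
  "simplicial_coboundary n K \<phi> =
     (\<lambda>c\<in>carrier (simplicial_chain_group integer_group K n).
        \<phi> (simplicial_boundary integer_group n c))"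

definition simplicial_cocycles ::
  "('g, 'm) monoid_scheme \<Rightarrow> nat \<Rightarrow> 'v set set \<Rightarrow> 'v set set \<Rightarrow>
    (('v list \<Rightarrow> int) \<Rightarrow> 'g) set" where
  "simplicial_cocycles G n K L =
     {\<phi> \<in> carrier (simplicial_cochain_group G n K L).
        simplicial_coboundary (Suc n) K \<phi> = \<one>\<^bsub>simplicial_cochain_group G (Suc n) K L\<^esub>}"

definition simplicial_coboundaries ::
  "('g, 'm) monoid_scheme \<Rightarrow> nat \<Rightarrow> 'v set set \<Rightarrow> 'v set set \<Rightarrow>
    (('v list \<Rightarrow> int) \<Rightarrow> 'g) set" where
  "simplicial_coboundaries G n K L =
     simplicial_coboundary n K ` carrier (simplicial_cochain_group G (n - 1) K L)"

definition simplicial_cohomology ::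
  "('g, 'm) monoid_scheme \<Rightarrow> nat \<Rightarrow> 'v set set \<times> 'v set set \<Rightarrow>
    (('v list \<Rightarrow> int) \<Rightarrow> 'g) set monoid" where
  "simplicial_cohomology G n KL = (case KL of (K, L) \<Rightarrow>
     (simplicial_cochain_group G n K L)\<lparr>carrier := simplicial_cocycles G n K L\<rparr>
       Mod simplicial_coboundaries G n K L)"

definition simplicial_cochain_map ::
  "nat \<Rightarrow> 'v set set \<Rightarrow> ('v \<Rightarrow> 'w) \<Rightarrow> (('w list \<Rightarrow> int) \<Rightarrow> 'g) \<Rightarrow> ('v list \<Rightarrow> int) \<Rightarrow> 'g" where
  "simplicial_cochain_map n K p \<phi> =
     (\<lambda>c\<in>carrier (simplicial_chain_group integer_group K n).
        \<phi> (simplicial_chain_map integer_group p c))"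

text \<open>The homomorphism \<open>H\<^sup>n(K', L') \<rightarrow> H\<^sup>n(K, L)\<close> of \<open>p : (K, L) \<rightarrow> (K', L')\<close>.\<close>

definition simplicial_cohomology_map ::
  "('g, 'm) monoid_scheme \<Rightarrow> nat \<Rightarrow> 'v set set \<times> 'v set set \<Rightarrow> 'w set set \<times> 'w set set \<Rightarrow>
    ('v \<Rightarrow> 'w) \<Rightarrow> (('w list \<Rightarrow> int) \<Rightarrow> 'g) set \<Rightarrow> (('v list \<Rightarrow> int) \<Rightarrow> 'g) set" where
  "simplicial_cohomology_map G n KL KL' p =
     (\<lambda>S\<in>carrier (simplicial_cohomology G n KL').
        coset_map (simplicial_cochain_group G n (fst KL) (snd KL))
          (simplicial_coboundaries G n (fst KL) (snd KL))
          (simplicial_cochain_map n (fst KL) p) S)"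


section \<open>Limits of inverse and direct systems of groups\<close>

text \<open>For an inverse system, \<open>\<pi> i j\<close> is the bonding map \<open>D j \<rightarrow> D i\<close> for \<open>i \<le> j\<close>.\<close>

definition inverse_limit ::
  "'i set \<Rightarrow> ('i \<Rightarrow> 'i \<Rightarrow> bool) \<Rightarrow> ('i \<Rightarrow> ('h, 'm) monoid_scheme) \<Rightarrow>
    ('i \<Rightarrow> 'i \<Rightarrow> 'h \<Rightarrow> 'h) \<Rightarrow> ('i \<Rightarrow> 'h) monoid" where
  "inverse_limit I r D \<pi> =
     (product_group I D)\<lparr>carrier := {x \<in> carrier (product_group I D).
        \<forall>i\<in>I. \<forall>j\<in>I. r i j \<longrightarrow> \<pi> i j (x j) = x i}\<rparr>"

text \<open>For a direct system, \<open>\<phi> i j\<close> is the bonding map \<open>D i \<rightarrow> D j\<close> for \<open>i \<le> j\<close>. The elements of the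
  limit are the classes of pairs \<open>(i, x)\<close> with \<open>x \<in> D i\<close>, two of them being identified if they
  become equal at some later index.\<close>

definition direct_limit_rel ::
  "'i set \<Rightarrow> ('i \<Rightarrow> 'i \<Rightarrow> bool) \<Rightarrow> ('i \<Rightarrow> ('h, 'm) monoid_scheme) \<Rightarrow>
    ('i \<Rightarrow> 'i \<Rightarrow> 'h \<Rightarrow> 'h) \<Rightarrow> (('i \<times> 'h) \<times> ('i \<times> 'h)) set" where
  "direct_limit_rel I r D \<phi> =
     {((i, x), (j, y)). i \<in> I \<and> x \<in> carrier (D i) \<and> j \<in> I \<and> y \<in> carrier (D j) \<and>
        (\<exists>k\<in>I. r i k \<and> r j k \<and> \<phi> i k x = \<phi> j k y)}"

definition direct_limit ::
  "'i set \<Rightarrow> ('i \<Rightarrow> 'i \<Rightarrow> bool) \<Rightarrow> ('i \<Rightarrow> ('h, 'm) monoid_scheme) \<Rightarrow>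
    ('i \<Rightarrow> 'i \<Rightarrow> 'h \<Rightarrow> 'h) \<Rightarrow> ('i \<times> 'h) set monoid" where
  "direct_limit I r D \<phi> =
    (let R = direct_limit_rel I r D \<phi> in
     \<lparr>carrier = (SIGMA i:I. carrier (D i)) // R,
      monoid.mult = (\<lambda>S T. \<Union>{R `` {(k, \<phi> i k x \<otimes>\<^bsub>D k\<^esub> \<phi> j k y)} | i x j y k.
          (i, x) \<in> S \<and> (j, y) \<in> T \<and> k \<in> I \<and> r i k \<and> r j k}),
      one = (\<Union>i\<in>I. R `` {(i, \<one>\<^bsub>D i\<^esub>)})\<rparr>)"


section \<open>Border covers\<close>

text \<open>A family \<open>{\<alpha>\<^sub>v}\<close> indexed by a pair \<open>(V, V\<^sup>A)\<close>.\<close>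

record ('v, 'a) indexed_family =
  idx :: "'v set"
  subidx :: "'v set"
  member :: "'v \<Rightarrow> 'a set"

text \<open>Finite families with arbitrary index sets form a proper class. To have a set of border covers,
  the index sets are taken to be finite sets of natural numbers; every finite family is
  a reindexing of such a family. Families are extensional on their index set.\<close>

definition border_covers :: "'a topology \<times> 'a set \<Rightarrow> (nat, 'a) indexed_family set" where
  "border_covers P = (case P of (X, A) \<Rightarrow>
     {\<alpha>. finite (idx \<alpha>) \<and> subidx \<alpha> \<subseteq> idx \<alpha> \<and> member \<alpha> \<in> extensional (idx \<alpha>) \<and>
        (\<forall>v\<in>idx \<alpha>. openin X (member \<alpha> v)) \<and>
        (\<exists>K. compactin X K \<and> topspace X - K = (\<Union>v\<in>idx \<alpha>. member \<alpha> v) \<and>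
             A - K \<subseteq> (\<Union>v\<in>subidx \<alpha>. member \<alpha> v))})"

definition refinement_projection ::
  "('v, 'a) indexed_family \<Rightarrow> ('w, 'a) indexed_family \<Rightarrow> ('w \<Rightarrow> 'v) \<Rightarrow> bool" where
  "refinement_projection \<alpha> \<beta> p \<longleftrightarrow>
     p ` idx \<beta> \<subseteq> idx \<alpha> \<and> p ` subidx \<beta> \<subseteq> subidx \<alpha> \<and>
     (\<forall>v\<in>idx \<beta>. member \<beta> v \<subseteq> member \<alpha> (p v))"

definition refines :: "('v, 'a) indexed_family \<Rightarrow> ('w, 'a) indexed_family \<Rightarrow> bool" where
  "refines \<alpha> \<beta> \<longleftrightarrow> (\<exists>p. refinement_projection \<alpha> \<beta> p)"

definition Car :: "('v, 'a) indexed_family \<Rightarrow> 'v set \<Rightarrow> 'a set" where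
  "Car \<alpha> s = (\<Inter>v\<in>s. member \<alpha> v)"

definition nerve_pair ::
  "'a topology \<times> 'a set \<Rightarrow> ('v, 'a) indexed_family \<Rightarrow> 'v set set \<times> 'v set set" where
  "nerve_pair P \<alpha> =
     ({s. finite s \<and> s \<noteq> {} \<and> s \<subseteq> idx \<alpha> \<and> Car \<alpha> s \<noteq> {}},
      {s. finite s \<and> s \<noteq> {} \<and> s \<subseteq> subidx \<alpha> \<and> Car \<alpha> s \<inter> snd P \<noteq> {}})"

text \<open>The bonding maps for \<open>\<alpha> \<le> \<beta>\<close> are induced by a refinement projection; any two of these are
  contiguous, so the choice does not matter.\<close>

definition border_homology_bond ::
  "nat \<Rightarrow> ('g, 'm) monoid_scheme \<Rightarrow> 'a topology \<times> 'a set \<Rightarrow>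
    (nat, 'a) indexed_family \<Rightarrow> (nat, 'a) indexed_family \<Rightarrow>
    (nat list \<Rightarrow> 'g) set \<Rightarrow> (nat list \<Rightarrow> 'g) set" where
  "border_homology_bond n G P \<alpha> \<beta> =
     simplicial_homology_map G n (nerve_pair P \<beta>) (nerve_pair P \<alpha>)
       (SOME p. refinement_projection \<alpha> \<beta> p)"

definition border_cohomology_bond ::
  "nat \<Rightarrow> ('g, 'm) monoid_scheme \<Rightarrow> 'a topology \<times> 'a set \<Rightarrow>
    (nat, 'a) indexed_family \<Rightarrow> (nat, 'a) indexed_family \<Rightarrow>
    ((nat list \<Rightarrow> int) \<Rightarrow> 'g) set \<Rightarrow> ((nat list \<Rightarrow> int) \<Rightarrow> 'g) set" where
  "border_cohomology_bond n G P \<alpha> \<beta> =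
     simplicial_cohomology_map G n (nerve_pair P \<beta>) (nerve_pair P \<alpha>)
       (SOME p. refinement_projection \<alpha> \<beta> p)"


section \<open>Border homology and cohomology groups and their induced homomorphisms\<close>

definition border_homology ::
  "nat \<Rightarrow> ('g, 'm) monoid_scheme \<Rightarrow> 'a topology \<times> 'a set \<Rightarrow>
    ((nat, 'a) indexed_family \<Rightarrow> (nat list \<Rightarrow> 'g) set) monoid" where
  "border_homology n G P =
     inverse_limit (border_covers P) refines
       (\<lambda>\<alpha>. simplicial_homology G n (nerve_pair P \<alpha>)) (border_homology_bond n G P)"

definition border_cohomology ::
  "nat \<Rightarrow> ('g, 'm) monoid_scheme \<Rightarrow> 'a topology \<times> 'a set \<Rightarrow>
    ((nat, 'a) indexed_family \<times> ((nat list \<Rightarrow> int) \<Rightarrow> 'g) set) set monoid" where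
  "border_cohomology n G P =
     direct_limit (border_covers P) refines
       (\<lambda>\<alpha>. simplicial_cohomology G n (nerve_pair P \<alpha>)) (border_cohomology_bond n G P)"

definition preimage_family ::
  "'a topology \<times> 'a set \<Rightarrow> ('a \<Rightarrow> 'b) \<Rightarrow> ('v, 'b) indexed_family \<Rightarrow> ('v, 'a) indexed_family" where
  "preimage_family P f \<alpha> =
     \<lparr>idx = idx \<alpha>, subidx = subidx \<alpha>,
      member = (\<lambda>v\<in>idx \<alpha>. {x \<in> topspace (fst P). f x \<in> member \<alpha> v})\<rparr>"

text \<open>The simplicial inclusion of the nerve of \<open>f\<^sup>-\<^sup>1(\<alpha>)\<close> into that of \<open>\<alpha>\<close> is the identity on
  vertices.\<close>

definition border_homology_map ::
  "nat \<Rightarrow> ('g, 'm) monoid_scheme \<Rightarrow> 'a topology \<times> 'a set \<Rightarrow> 'b topology \<times> 'b set \<Rightarrow> ('a \<Rightarrow> 'b) \<Rightarrow>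
    ((nat, 'a) indexed_family \<Rightarrow> (nat list \<Rightarrow> 'g) set) \<Rightarrow>
    (nat, 'b) indexed_family \<Rightarrow> (nat list \<Rightarrow> 'g) set" where
  "border_homology_map n G P Q f =
     (\<lambda>x\<in>carrier (border_homology n G P). \<lambda>\<alpha>\<in>border_covers Q.
        simplicial_homology_map G n (nerve_pair P (preimage_family P f \<alpha>)) (nerve_pair Q \<alpha>)
          (\<lambda>v. v) (x (preimage_family P f \<alpha>)))"

text \<open>On classes, the limit of the maps \<open>f\<^sub>\<alpha>\<^sup>*\<close> sends \<open>[(\<alpha>, u)]\<close> to \<open>[(f\<^sup>-\<^sup>1(\<alpha>), f\<^sub>\<alpha>\<^sup>* u)]\<close>.\<close>

definition border_cohomology_map ::
  "nat \<Rightarrow> ('g, 'm) monoid_scheme \<Rightarrow> 'a topology \<times> 'a set \<Rightarrow> 'b topology \<times> 'b set \<Rightarrow> ('a \<Rightarrow> 'b) \<Rightarrow>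
    ((nat, 'b) indexed_family \<times> ((nat list \<Rightarrow> int) \<Rightarrow> 'g) set) set \<Rightarrow>
    ((nat, 'a) indexed_family \<times> ((nat list \<Rightarrow> int) \<Rightarrow> 'g) set) set" where
  "border_cohomology_map n G P Q f =
     (\<lambda>S\<in>carrier (border_cohomology n G Q). \<Union>(\<alpha>, u)\<in>S.
        direct_limit_rel (border_covers P) refines
          (\<lambda>\<alpha>. simplicial_cohomology G n (nerve_pair P \<alpha>)) (border_cohomology_bond n G P) ``
          {(preimage_family P f \<alpha>,
            simplicial_cohomology_map G n
              (nerve_pair P (preimage_family P f \<alpha>)) (nerve_pair Q \<alpha>) (\<lambda>v. v) u)})"

lemma preimage_family_border_cover:
  assumes f: "f \<in> N2p_hom P Q" and \<alpha>: "\<alpha> \<in> border_covers Q" and P: "P \<in> N2p_obj"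
  shows "preimage_family P f \<alpha> \<in> border_covers P"
proof -
  obtain X A where XA: "P = (X, A)" by fastforce
  obtain Y B where YB: "Q = (Y, B)" by fastforce
  have A: "A \<subseteq> topspace X"
    using P by (auto simp: XA N2p_obj_def dest: closedin_subset)
  have cf: "continuous_map X Y f"
    and pf: "\<And>K. compactin Y K \<Longrightarrow> compactin X {x \<in> topspace X. f x \<in> K}"
    and fA: "f ` A \<subseteq> B"
    using f by (auto simp: XA YB N2p_hom_def proper_continuous_map_def)
  obtain K where K: "compactin Y K" "topspace Y - K = (\<Union>v\<in>idx \<alpha>. member \<alpha> v)"
      "B - K \<subseteq> (\<Union>v\<in>subidx \<alpha>. member \<alpha> v)"
    and fin: "finite (idx \<alpha>)" and sub: "subidx \<alpha> \<subseteq> idx \<alpha>"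
    and op: "\<And>v. v \<in> idx \<alpha> \<Longrightarrow> openin Y (member \<alpha> v)"
    using \<alpha> by (auto simp: border_covers_def YB)
  let ?K = "{x \<in> topspace X. f x \<in> K}"
  have fX: "f x \<in> topspace Y" if "x \<in> topspace X" for x
    using continuous_map_image_subset_topspace [OF cf] that by auto
  have 1: "topspace X - ?K = (\<Union>v\<in>idx \<alpha>. {x \<in> topspace X. f x \<in> member \<alpha> v})"
    using K(2) fX by blast
  have 2: "A - ?K \<subseteq> (\<Union>v\<in>subidx \<alpha>. {x \<in> topspace X. f x \<in> member \<alpha> v})"
    using K(3) fA A by blast
  have 3: "openin X {x \<in> topspace X. f x \<in> member \<alpha> v}" if "v \<in> idx \<alpha>" for v
    by (rule openin_continuous_map_preimage [OF cf op [OF that]])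
  have 4: "(\<Union>v\<in>subidx \<alpha>. {x \<in> topspace X. f x \<in> member \<alpha> v})
         = (\<Union>v\<in>subidx \<alpha>. (\<lambda>v\<in>idx \<alpha>. {x \<in> topspace X. f x \<in> member \<alpha> v}) v)"
    using sub by (intro SUP_cong) auto
  have 5: "(\<Union>v\<in>idx \<alpha>. {x \<in> topspace X. f x \<in> member \<alpha> v})
         = (\<Union>v\<in>idx \<alpha>. (\<lambda>v\<in>idx \<alpha>. {x \<in> topspace X. f x \<in> member \<alpha> v}) v)"
    by (intro SUP_cong) auto
  show ?thesis
    unfolding border_covers_def preimage_family_def XA
    using fin sub 3 pf [OF K(1)] 1 [unfolded 5] 2 [unfolded 4] by auto
qed

end

theory Submission
  imports Defs
begin

text \<open>Simplicial chains are treated as alternating functions on lists of vertices. On these, the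
  chain map of a vertex map is the plain sum over the fibres, without regard to degenerate images:
  interchanging two preimages of a repeated vertex cancels the contributions to a degenerate
  simplex. This makes chain maps strictly functorial and makes them commute with boundaries by a
  double counting.

  Two refinement projections are contiguous. They can be turned into each other by changing
  the value at one vertex at a time, and for a change at a single vertex \<open>a\<close>, from \<open>x\<close> to \<open>y\<close>, there
  is the chain homotopy \<open>[a, v\<^sub>1, \<dots>, v\<^sub>n] \<mapsto> [x, y, p v\<^sub>1, \<dots>, p v\<^sub>n]\<close>, which needs no ordering of the
  vertices. Hence the bonding maps do not depend on the refinement projections, the bonding maps
  are functorial, and the inclusions \<open>f\<^sub>\<alpha>\<close> form maps of systems; functoriality of the limits
  follows from \<open>(g \<circ> f)\<^sup>-\<^sup>1(\<alpha>) = f\<^sup>-\<^sup>1(g\<^sup>-\<^sup>1(\<alpha>))\<close>.\<close>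


section \<open>Products of finitely supported families\<close>

text \<open>Chain maps put the unit on degenerate lists, whereas counting the faces of an image in
  two ways meets such lists; so the sum over a fibre must vanish there by itself. Alternation alone
  does not give that: on a list with a repeated vertex it says only c = -c, which is no information
  in the presence of 2-torsion. Vanishing on such lists is therefore carried as a separate property
  through every construction.

  The bonding maps come from Hilbert choice, and the choices for \<alpha> \<le> \<beta> and \<beta>
  \<le> \<gamma> need not compose to the choice for \<alpha> \<le> \<gamma>; homotopy invariance
  repairs this.

  The homotopy is a computation in the exterior algebra on the vertices. With x for left
  multiplication by a vertex, d for the boundary and i for evaluation with a fixed vertex in front,
  it rests on d x m = m - x d m and d i = - i d. Contiguity keeps the result inside the target
  complex, and finiteness of border covers bounds the number of single-vertex changes. Coefficients
  are arbitrary, so cohomology takes its homotopy from the integral chains.\<close>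

context comm_group
begin

lemma gfinprod_eq_finprod_superset:
  assumes "finite B" "{x \<in> A. f x \<noteq> \<one>} \<subseteq> B" "B \<subseteq> A" "f \<in> A \<rightarrow> carrier G"
  shows "gfinprod G f A = finprod G f B"
proof -
  have "gfinprod G f A = gfinprod G f B"
    by (rule gfinprod_mono_neutral_cong_right) (use assms in auto)
  also have "\<dots> = finprod G f B"
    by (rule gfinprod_eq_finprod) (use assms in auto)
  finally show ?thesis .
qed

text \<open>Fubini for finitely supported families: two maps \<open>h\<close> on the same
  \<open>A\<close> give two iterated products of the same value, which is how
  \<open>face_sum_list_push\<close> exchanges summations. \<open>A\<close> and \<open>B\<close> may
  be infinite, so the proof works on the support and its image under \<open>h\<close>.\<close>

lemma gfinprod_fibers:
  assumes fin: "finite {x \<in> A. f x \<noteq> \<one>}" and f: "f \<in> A \<rightarrow> carrier G" and h: "h ` A \<subseteq> B"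
  shows "gfinprod G (\<lambda>y. gfinprod G f {x \<in> A. h x = y}) B = gfinprod G f A"
proof -
  let ?S = "{x \<in> A. f x \<noteq> \<one>}"
  have fib: "gfinprod G f {x \<in> A. h x = y} = finprod G f {x \<in> ?S. h x = y}" for y
    by (rule gfinprod_eq_finprod_superset) (use fin f in \<open>auto intro: rev_finite_subset [OF fin]\<close>)
  have "gfinprod G (\<lambda>y. gfinprod G f {x \<in> A. h x = y}) B
      = gfinprod G (\<lambda>y. finprod G f {x \<in> ?S. h x = y}) B"
    by (simp add: fib)
  also have "\<dots> = finprod G (\<lambda>y. finprod G f {x \<in> ?S. h x = y}) (h ` ?S)"
  proof (rule gfinprod_eq_finprod_superset)
    have "finprod G f {x \<in> ?S. h x = y} = \<one>" if "y \<notin> h ` ?S" for y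
      by (rule finprod_one_eqI) (use that in auto)
    then show "{y \<in> B. finprod G f {x \<in> ?S. h x = y} \<noteq> \<one>} \<subseteq> h ` ?S"
      by blast
  qed (use fin f h in \<open>auto intro!: finprod_closed\<close>)
  also have "\<dots> = finprod G f (\<Union>y\<in>h ` ?S. {x \<in> ?S. h x = y})"
    by (rule finprod_UN_disjoint [symmetric])
      (use fin f in \<open>auto simp: pairwise_def disjnt_def intro: rev_finite_subset [OF fin]\<close>)
  also have "(\<Union>y\<in>h ` ?S. {x \<in> ?S. h x = y}) = ?S"
    by auto
  also have "finprod G f ?S = gfinprod G f A"
    using fin by (simp add: gfinprod_def)
  finally show ?thesis .
qed

lemma gfinprod_reindex:
  assumes inj: "inj_on h A" and f: "f \<in> h ` A \<rightarrow> carrier G"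
  shows "gfinprod G f (h ` A) = gfinprod G (\<lambda>x. f (h x)) A"
proof -
  let ?S = "{x \<in> A. f (h x) \<noteq> \<one>}"
  have im: "{y \<in> h ` A. f y \<noteq> \<one>} = h ` ?S" by auto
  have inj': "inj_on h ?S" using inj by (rule inj_on_subset) auto
  show ?thesis
  proof (cases "finite ?S")
    case True
    then show ?thesis
      unfolding gfinprod_def im using inj' f
      by (subst finprod_reindex) auto
  next
    case False
    then show ?thesis
      unfolding gfinprod_def im using inj' by (simp add: finite_image_iff)
  qed
qed

lemma gfinprod_trivial:
  assumes "\<And>x. x \<in> A \<Longrightarrow> f x = \<one>"
  shows "gfinprod G f A = \<one>"
proof -
  have "{x \<in> A. f x \<noteq> \<one>} = {}" using assms by auto
  then show ?thesis unfolding gfinprod_def by (metis finprod_empty)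
qed

lemma gfinprod_nontrivial_obtain:
  assumes "gfinprod G f A \<noteq> \<one>"
  obtains x where "x \<in> A" "f x \<noteq> \<one>"
  using assms gfinprod_trivial by metis

lemma gfinprod_inv:
  assumes "f \<in> A \<rightarrow> carrier G"
  shows "gfinprod G (\<lambda>x. inv (f x)) A = inv (gfinprod G f A)"
proof (cases "finite {x \<in> A. f x \<noteq> \<one>}")
  case True
  have supp: "{x \<in> A. inv (f x) \<noteq> \<one>} = {x \<in> A. f x \<noteq> \<one>}"
    using assms by (auto simp: inv_eq_1_iff Pi_iff)
  have "gfinprod G (\<lambda>x. inv (f x)) A \<otimes> gfinprod G f A = gfinprod G (\<lambda>x. inv (f x) \<otimes> f x) A"
    by (rule gfinprod_distrib [symmetric]) (use True supp assms in auto)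
  also have "\<dots> = \<one>"
    by (rule gfinprod_trivial) (use assms in \<open>auto simp: Pi_iff\<close>)
  finally show ?thesis
    by (intro inv_equality [symmetric] gfinprod_closed) (use assms in auto)
next
  case False
  \<comment> \<open>An infinite support makes \<open>gfinprod\<close> the default
    \<open>\<one>\<close> on both sides.\<close>
  moreover have "{x \<in> A. inv (f x) \<noteq> \<one>} = {x \<in> A. f x \<noteq> \<one>}"
    using assms by (auto simp: inv_eq_1_iff Pi_iff)
  ultimately show ?thesis
    by (simp add: gfinprod_def)
qed

text \<open>The terms cancel in pairs {x, \<sigma> x}. At a fixed point the sign reversal says only
  that \<open>f x\<close> is its own inverse, which 2-torsion allows; hence the separate demand
  \<open>f x = \<one>\<close> there.\<close>

lemma finprod_involution:
  assumes "finite S" and "f \<in> S \<rightarrow> carrier G"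
    and "\<And>x. x \<in> S \<Longrightarrow> \<sigma> x \<in> S \<and> \<sigma> (\<sigma> x) = x \<and> f (\<sigma> x) = inv (f x) \<and> (\<sigma> x = x \<longrightarrow> f x = \<one>)"
  shows "finprod G f S = \<one>"
  using assms
proof (induction S rule: finite_psubset_induct)
  case (psubset S)
  show ?case
  proof (cases "S = {}")
    case True
    then show ?thesis by simp
  next
    case False
    then obtain x where x: "x \<in> S" by blast
    \<comment> \<open>The orbit of \<open>x\<close> is removed as a whole, so that
      \<open>\<sigma>\<close> still acts on the rest.\<close>
    let ?T = "S - {x, \<sigma> x}"
    have T: "\<sigma> y \<in> ?T" if "y \<in> ?T" for y
      using that x psubset.prems(2) by (metis Diff_iff insert_iff singletonD)
    have IH: "finprod G f ?T = \<one>"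
      by (rule psubset.IH) (use x T psubset.prems in auto)
    have fx: "f x \<in> carrier G" using x psubset.prems(1) by auto
    show ?thesis
    proof (cases "\<sigma> x = x")
      case True
      then have "S = insert x ?T" using x by auto
      then have "finprod G f S = f x \<otimes> finprod G f ?T"
        using True psubset.hyps psubset.prems(1) fx
        by (metis (no_types, lifting) finprod_insert Diff_iff Pi_I' Pi_mem finite_Diff insertI1)
      then show ?thesis using IH fx True psubset.prems(2)[OF x] by simp
    next
      case False
      have S: "S = insert x (insert (\<sigma> x) ?T)" using x psubset.prems(2)[OF x] by auto
      have "finprod G f (insert x (insert (\<sigma> x) ?T)) = f x \<otimes> (f (\<sigma> x) \<otimes> finprod G f ?T)"
        using False psubset.hyps psubset.prems fx x by (subst finprod_insert; (subst finprod_insert)?) auto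
      then show ?thesis using IH fx psubset.prems(2)[OF x] S by simp
    qed
  qed
qed

lemma gfinprod_involution:
  assumes fin: "finite {x \<in> A. f x \<noteq> \<one>}" and f: "f \<in> A \<rightarrow> carrier G"
    and \<sigma>: "\<And>x. x \<in> A \<Longrightarrow> \<sigma> x \<in> A \<and> \<sigma> (\<sigma> x) = x \<and> f (\<sigma> x) = inv (f x) \<and> (\<sigma> x = x \<longrightarrow> f x = \<one>)"
  shows "gfinprod G f A = \<one>"
proof -
  have "finprod G f {x \<in> A. f x \<noteq> \<one>} = \<one>"
    using fin f \<sigma> by (intro finprod_involution [where \<sigma> = \<sigma>]) (auto simp: inv_eq_1_iff Pi_iff)
  then show ?thesis by (simp add: gfinprod_def)
qed

end

section \<open>Alternating functions on lists\<close>

definition finsupp :: "('g, 'm) monoid_scheme \<Rightarrow> ('x \<Rightarrow> 'g) \<Rightarrow> bool" where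
  "finsupp G c \<longleftrightarrow> (\<forall>x. c x \<in> carrier G) \<and> finite {x. c x \<noteq> \<one>\<^bsub>G\<^esub>}"

definition alternating :: "('g, 'm) monoid_scheme \<Rightarrow> ('v list \<Rightarrow> 'g) \<Rightarrow> bool" where
  "alternating G c \<longleftrightarrow> (\<forall>vs i j. i < j \<and> j < length vs \<longrightarrow>
      c (vs[i := vs ! j, j := vs ! i]) = inv\<^bsub>G\<^esub> (c vs))"

definition distinct_supp :: "('g, 'm) monoid_scheme \<Rightarrow> ('v list \<Rightarrow> 'g) \<Rightarrow> bool" where
  "distinct_supp G c \<longleftrightarrow> (\<forall>vs. \<not> distinct vs \<longrightarrow> c vs = \<one>\<^bsub>G\<^esub>)"

text \<open>The sum over the fibre without the distinctness test of
  \<open>simplicial_chain_map\<close>; the two agree on chains by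
  \<open>chain_map_eq_list_push\<close>.\<close>

definition list_push :: "('g, 'm) monoid_scheme \<Rightarrow> ('v \<Rightarrow> 'w) \<Rightarrow> ('v list \<Rightarrow> 'g) \<Rightarrow> 'w list \<Rightarrow> 'g" where
  "list_push G p c ws = gfinprod G c {vs. map p vs = ws}"

text \<open>The boundary in positive degrees. On functions supported on one-element lists it is the
  augmentation, as a value at \<open>[]\<close>, where \<open>simplicial_boundary\<close> is
  trivial.\<close>

definition face_sum :: "('g, 'm) monoid_scheme \<Rightarrow> ('v list \<Rightarrow> 'g) \<Rightarrow> 'v list \<Rightarrow> 'g" where
  "face_sum G c ws = gfinprod G (\<lambda>v. c (v # ws)) UNIV"

text \<open>Left exterior multiplication by the vertex \<open>x\<close>.\<close>

primrec wedge :: "('g, 'm) monoid_scheme \<Rightarrow> 'v \<Rightarrow> ('v list \<Rightarrow> 'g) \<Rightarrow> 'v list \<Rightarrow> 'g" where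
  "wedge G x m [] = \<one>\<^bsub>G\<^esub>"
| "wedge G x m (w # ws) =
     (if w = x then (if x \<in> set ws then \<one>\<^bsub>G\<^esub> else m ws)
      else inv\<^bsub>G\<^esub> (wedge G x (\<lambda>us. m (w # us)) ws))"

context comm_group
begin

section \<open>Alternation and adjacent exchanges\<close>

lemma alternating_Cons:
  fixes c :: "'v list \<Rightarrow> 'a"
  shows "alternating G c \<Longrightarrow> alternating G (\<lambda>vs. c (v # vs))"
  unfolding alternating_def
proof (intro allI impI)
  fix vs :: "'v list" and i j
  assume c: "\<forall>vs i j. i < j \<and> j < length vs \<longrightarrow> c (vs[i := vs ! j, j := vs ! i]) = inv c vs"
    and ij: "i < j \<and> j < length vs"
  from c[rule_format, of "Suc i" "Suc j" "v # vs"] ij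
  show "c (v # vs[i := vs ! j, j := vs ! i]) = inv c (v # vs)" by simp
qed

lemma alternating_adjacent:
  assumes "alternating G c"
  shows "c (us @ v # w # ws) = inv (c (us @ w # v # ws))"
proof -
  have "length us < Suc (length us) \<and> Suc (length us) < length (us @ w # v # ws)" by simp
  then have "c ((us @ w # v # ws)[length us := (us @ w # v # ws) ! Suc (length us),
      Suc (length us) := (us @ w # v # ws) ! length us]) = inv (c (us @ w # v # ws))"
    using assms unfolding alternating_def by blast
  then show ?thesis by (simp add: list_update_append nth_append)
qed

lemma alternating_adjacent0:
  assumes "alternating G c"
  shows "c (v # w # ws) = inv (c (w # v # ws))"
  by (rule alternating_adjacent [OF assms, of "[]", unfolded append_Nil])

text \<open>Carrying \<open>v\<close> across \<open>zs\<close> takes one adjacent exchange per entry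
  of \<open>zs\<close>, each contributing an inverse.\<close>

lemma alternating_moveI:
  assumes c: "\<And>vs. c vs \<in> carrier G"
    and adj: "\<And>us v w ws. c (us @ v # w # ws) = inv (c (us @ w # v # ws))"
  shows "c (us @ v # zs @ ws) = (if even (length zs) then c (us @ zs @ v # ws) else inv (c (us @ zs @ v # ws)))"
proof (induction zs arbitrary: us)
  case Nil
  then show ?case by simp
next
  case (Cons z zs)
  show ?case using adj [of us v z "zs @ ws"] Cons.IH [of "us @ [z]"] c by auto
qed

text \<open>Every transposition is an odd product of adjacent exchanges. This is the criterion by
  which wedges and face sums are recognised as alternating.\<close>

lemma alternatingI:
  fixes c :: "'v list \<Rightarrow> 'a"
  assumes c: "\<And>vs. c vs \<in> carrier G"
    and adj: "\<And>us v w ws. c (us @ v # w # ws) = inv (c (us @ w # v # ws))"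
  shows "alternating G c"
  unfolding alternating_def
proof (intro allI impI)
  fix vs :: "'v list" and i j
  assume ij: "i < j \<and> j < length vs"
  \<comment> \<open>Cut \<open>vs\<close> at the two positions: \<open>A\<close>, the entry at
    \<open>i\<close>, \<open>B\<close>, the entry at \<open>j\<close>, \<open>C\<close>.\<close>
  define A where "A = take i vs"
  define B where "B = take (j - Suc i) (drop (Suc i) vs)"
  define C where "C = drop (Suc j) vs"
  have "drop (Suc i) vs = B @ vs ! j # C"
    using ij id_take_nth_drop [of "j - Suc i" "drop (Suc i) vs"]
    by (simp add: B_def C_def diff_less_mono Suc_leI)
  then have vs: "vs = A @ vs ! i # B @ vs ! j # C"
    using ij id_take_nth_drop [of i vs] by (simp add: A_def)
  have lA: "length A = i" using ij by (simp add: A_def)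
  have lB: "j = Suc (i + length B)" using ij by (simp add: B_def min_absorb2 diff_le_mono)
  have 1: "(A @ x # B @ y # C)[i := y', j := x'] = A @ y' # B @ x' # C" for x y x' y'
    unfolding lB lA [symmetric] by (simp add: list_update_append)
  have sw: "vs[i := vs ! j, j := vs ! i] = A @ vs ! j # B @ vs ! i # C"
    by (subst vs, subst 1) (rule refl)
  note mv = alternating_moveI [of c, OF c adj]
  \<comment> \<open>Both arrangements are compared with \<open>A @ B @ vs ! i # vs ! j # C\<close>:
    one needs \<open>length B + 1\<close> exchanges, the other \<open>length B\<close>, so the signs
    differ.\<close>
  have "c (A @ vs ! j # B @ vs ! i # C) = inv (c (A @ vs ! i # B @ vs ! j # C))"
    using mv [of A "vs ! j" "B @ [vs ! i]" C] mv [of A "vs ! i" "B" "vs ! j # C"] c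
    by auto
  then show "c (vs[i := vs ! j, j := vs ! i]) = inv c vs"
    unfolding sw using vs by simp
qed

section \<open>Exterior multiplication by a vertex\<close>

lemma wedge_closed: "(\<And>us. m us \<in> carrier G) \<Longrightarrow> wedge G x m ws \<in> carrier G"
  by (induction ws arbitrary: m) auto

lemma wedge_one [simp]: "wedge G x (\<lambda>us. \<one>) ws = \<one>"
  by (induction ws) auto

lemma wedge_inv: "(\<And>us. m us \<in> carrier G) \<Longrightarrow> wedge G x (\<lambda>us. inv (m us)) ws = inv (wedge G x m ws)"
  by (induction ws arbitrary: m) auto

lemma wedge_mult:
  "(\<And>us. m us \<in> carrier G) \<Longrightarrow> (\<And>us. m' us \<in> carrier G) \<Longrightarrow>
    wedge G x (\<lambda>us. m us \<otimes> m' us) ws = wedge G x m ws \<otimes> wedge G x m' ws"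
  by (induction ws arbitrary: m m') (auto simp: inv_mult wedge_closed)

text \<open>At a given \<open>ws\<close> the wedge is the unit, or one value of \<open>m\<close>, or
  the inverse of one; so it commutes even with products over families of infinite support.\<close>

lemma wedge_gfinprod:
  "(\<And>v us. m v us \<in> carrier G) \<Longrightarrow>
    wedge G x (\<lambda>us. gfinprod G (\<lambda>v. m v us) A) ws = gfinprod G (\<lambda>v. wedge G x (m v) ws) A"
proof (induction ws arbitrary: m)
  case Nil
  then show ?case by (simp add: gfinprod_trivial)
next
  case (Cons w ws)
  then show ?case
    by (simp add: gfinprod_trivial gfinprod_inv wedge_closed)
qed

text \<open>A nontrivial value arises by inserting \<open>x\<close> once into a list of the support
  of \<open>m\<close>. Finiteness, distinctness and the vertices of a wedge are all read off from
  this.\<close>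

lemma wedge_support:
  assumes "wedge G x m ws \<noteq> \<one>" and "\<And>us. m us \<in> carrier G"
  shows "\<exists>us vs. ws = us @ x # vs \<and> x \<notin> set us \<and> x \<notin> set vs \<and> m (us @ vs) \<noteq> \<one>"
  using assms
proof (induction ws arbitrary: m)
  case Nil
  then show ?case by simp
next
  case (Cons w ws)
  show ?case
  proof (cases "w = x")
    case True
    then have "w # ws = [] @ x # ws \<and> x \<notin> set [] \<and> x \<notin> set ws \<and> m ([] @ ws) \<noteq> \<one>"
      using Cons.prems by (auto split: if_splits)
    then show ?thesis by blast
  next
    case False
    then have "wedge G x (\<lambda>us. m (w # us)) ws \<noteq> \<one>" using Cons.prems by auto
    from Cons.IH [OF this] Cons.prems(2) obtain us vs
      where "ws = us @ x # vs \<and> x \<notin> set us \<and> x \<notin> set vs \<and> m (w # us @ vs) \<noteq> \<one>"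
      by blast
    then have "w # ws = (w # us) @ x # vs \<and> x \<notin> set (w # us) \<and> x \<notin> set vs \<and> m ((w # us) @ vs) \<noteq> \<one>"
      using False by simp
    then show ?thesis by blast
  qed
qed

lemma finsupp_closed: "finsupp G c \<Longrightarrow> c x \<in> carrier G"
  by (simp add: finsupp_def)

lemma finsupp_wedge:
  assumes m: "finsupp G m"
  shows "finsupp G (wedge G x m)"
proof -
  \<comment> \<open>A list of the support together with a position at which \<open>x\<close> is
    inserted.\<close>
  let ?T = "SIGMA us:{us. m us \<noteq> \<one>}. {..length us}"
  have "ws \<in> (\<lambda>(us, i). take i us @ x # drop i us) ` ?T" if nz: "wedge G x m ws \<noteq> \<one>" for ws
  proof -
    obtain us vs where uv: "ws = us @ x # vs" "m (us @ vs) \<noteq> \<one>"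
      using wedge_support [OF nz] m by (auto simp: finsupp_def)
    then have "(us @ vs, length us) \<in> ?T" by simp
    then show ?thesis by (rule rev_image_eqI) (simp add: uv(1))
  qed
  then have "{ws. wedge G x m ws \<noteq> \<one>} \<subseteq> (\<lambda>(us, i). take i us @ x # drop i us) ` ?T" by blast
  moreover have "finite ?T" using m by (auto simp: finsupp_def)
  ultimately show ?thesis
    using m by (auto simp: finsupp_def wedge_closed intro: finite_subset)
qed

text \<open>Induction over the prefix before the exchanged pair, with \<open>m\<close> general
  because the recursion of \<open>wedge\<close> replaces it by a contraction. When one of the pair
  is \<open>x\<close>, the sign comes from \<open>wedge\<close> itself, otherwise from
  \<open>m\<close>.\<close>

lemma alternating_wedge:
  assumes m: "\<And>us. m us \<in> carrier G" and alt: "alternating G m"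
  shows "alternating G (wedge G x m)"
proof (rule alternatingI)
  show "wedge G x m ws \<in> carrier G" for ws using m by (rule wedge_closed)
  show "wedge G x m (us @ v # w # ws) = inv (wedge G x m (us @ w # v # ws))" for us v w ws
    using m alt
  proof (induction us arbitrary: m)
    case Nil
    have "wedge G x (\<lambda>us. m (v # w # us)) ws = wedge G x (\<lambda>us. inv (m (w # v # us))) ws"
      using alternating_adjacent0 [OF Nil(2)] by metis
    also have "\<dots> = inv (wedge G x (\<lambda>us. m (w # v # us)) ws)"
      using Nil by (simp add: wedge_inv)
    finally show ?case using Nil(1) by (auto simp: wedge_closed)
  next
    case (Cons u us)
    have 1: "m (us @ v # w # ws) = inv (m (us @ w # v # ws))"
      by (rule alternating_adjacent [OF Cons.prems(2)])
    have 2: "wedge G x (\<lambda>us. m (u # us)) (us @ v # w # ws) = inv (wedge G x (\<lambda>us. m (u # us)) (us @ w # v # ws))"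
      by (rule Cons.IH) (use Cons.prems alternating_Cons in auto)
    show ?case
      using Cons.prems(1) by (simp add: 1 2 wedge_closed insert_commute)
  qed
qed

lemma distinct_supp_wedge:
  fixes m :: "'v list \<Rightarrow> 'a"
  assumes m: "\<And>us. m us \<in> carrier G" and d: "distinct_supp G m"
  shows "distinct_supp G (wedge G x m)"
  unfolding distinct_supp_def
proof (intro allI impI, rule ccontr)
  fix ws :: "'v list"
  assume nd: "\<not> distinct ws" and nz: "wedge G x m ws \<noteq> \<one>"
  obtain us vs where "ws = us @ x # vs" "x \<notin> set us" "x \<notin> set vs" "m (us @ vs) \<noteq> \<one>"
    using wedge_support [OF nz m] by blast
  moreover then have "distinct (us @ vs)" using d unfolding distinct_supp_def by blast
  ultimately show False using nd by auto
qed

lemma distinct_supp_Cons: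
  "distinct_supp G c \<Longrightarrow> distinct_supp G (\<lambda>vs. c (v # vs))"
  by (simp add: distinct_supp_def)

lemma finsupp_Cons:
  assumes "finsupp G c"
  shows "finsupp G (\<lambda>vs. c (v # vs))"
proof -
  have "{vs. c (v # vs) \<noteq> \<one>} \<subseteq> tl ` {vs. c vs \<noteq> \<one>}" by force
  then show ?thesis using assms by (auto simp: finsupp_def intro: finite_subset)
qed

lemma finite_hd_support:
  assumes "finsupp G c"
  shows "finite {v. c (v # ws) \<noteq> \<one>}"
proof -
  have "{v. c (v # ws) \<noteq> \<one>} \<subseteq> hd ` {vs. c vs \<noteq> \<one>}" by force
  then show ?thesis using assms by (auto simp: finsupp_def intro: finite_subset)
qed

text \<open>Evaluating with \<open>x\<close> in front and multiplying by \<open>x\<close> again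
  projects to the lists that contain \<open>x\<close>: the signs collected while
  \<open>wedge\<close> searches for \<open>x\<close> are those of moving \<open>x\<close> from the
  front back to its place.\<close>

lemma wedge_contraction:
  assumes "\<And>us. m us \<in> carrier G" "alternating G m" "distinct_supp G m"
  shows "wedge G x (\<lambda>us. m (x # us)) ws = (if x \<in> set ws then m ws else \<one>)"
  using assms
proof (induction ws arbitrary: m)
  case Nil
  then show ?case by simp
next
  case (Cons w ws)
  show ?case
  proof (cases "w = x")
    case True
    then show ?thesis using Cons.prems by (auto simp: distinct_supp_def)
  next
    case False
    have "wedge G x (\<lambda>us. m (x # w # us)) ws = wedge G x (\<lambda>us. inv (m (w # x # us))) ws"
      using alternating_adjacent0 [OF Cons.prems(2)] by metis
    also have "\<dots> = inv (wedge G x (\<lambda>us. m (w # x # us)) ws)"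
      using Cons.prems by (simp add: wedge_inv)
    also have "\<dots> = inv (if x \<in> set ws then m (w # ws) else \<one>)"
      using Cons.IH [of "\<lambda>us. m (w # us)"] Cons.prems
      by (simp add: alternating_Cons distinct_supp_Cons)
    finally show ?thesis using False Cons.prems by auto
  qed
qed

section \<open>Face sums: Leibniz rule and vanishing square\<close>

lemma face_sum_closed: "(\<And>us. m us \<in> carrier G) \<Longrightarrow> face_sum G m ws \<in> carrier G"
  by (auto simp: face_sum_def intro!: gfinprod_closed)

lemma face_sum_support:
  assumes "face_sum G c ws \<noteq> \<one>"
  obtains v where "c (v # ws) \<noteq> \<one>"
  using assms unfolding face_sum_def by (rule gfinprod_nontrivial_obtain)

lemma finsupp_face_sum:
  assumes "finsupp G c"
  shows "finsupp G (face_sum G c)"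
proof -
  have "{ws. face_sum G c ws \<noteq> \<one>} \<subseteq> tl ` {vs. c vs \<noteq> \<one>}"
    by (force elim: face_sum_support)
  then show ?thesis
    using assms by (auto simp: finsupp_def face_sum_closed intro: finite_subset)
qed

lemma alternating_face_sum:
  assumes c: "\<And>us. c us \<in> carrier G" and alt: "alternating G c"
  shows "alternating G (face_sum G c)"
proof (rule alternatingI)
  show "face_sum G c (us @ v # w # ws) = inv (face_sum G c (us @ w # v # ws))" for us v w ws
  proof -
    have "c (z # us @ v # w # ws) = inv (c (z # us @ w # v # ws))" for z
      by (rule alternating_adjacent [OF alt, of "z # us", unfolded append_Cons])
    then show ?thesis
      using c by (simp add: face_sum_def gfinprod_inv)
  qed
qed (simp add: face_sum_closed c)

lemma face_sum_mult:
  assumes "finsupp G c" "finsupp G d"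
  shows "face_sum G (\<lambda>vs. c vs \<otimes> d vs) ws = face_sum G c ws \<otimes> face_sum G d ws"
  unfolding face_sum_def
  by (rule gfinprod_distrib) (use assms finite_hd_support in \<open>auto simp: finsupp_closed\<close>)

text \<open>The Leibniz rule d(x m) = m - x d m. Among the added vertices, \<open>x\<close> accounts
  for \<open>m\<close> on lists without \<open>x\<close>, every other one for a term of the second
  summand; \<open>wedge_contraction\<close> supplies what is missing on lists with
  \<open>x\<close>.\<close>

lemma face_sum_wedge:
  assumes m: "finsupp G m" and alt: "alternating G m" and d: "distinct_supp G m"
  shows "face_sum G (wedge G x m) ws = m ws \<otimes> inv (wedge G x (face_sum G m) ws)"
proof -
  have mc: "m us \<in> carrier G" for us using m by (simp add: finsupp_def)
  define F where "F v = wedge G x (\<lambda>us. m (v # us)) ws" for v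
  have Fc: "F v \<in> carrier G" for v by (simp add: F_def wedge_closed mc)
  have Fx: "F x = (if x \<in> set ws then m ws else \<one>)"
    unfolding F_def by (rule wedge_contraction [OF mc alt d])
  have finF: "finite {v. F v \<noteq> \<one>}"
  proof -
    have "v \<in> (\<Union>vs\<in>{vs. m vs \<noteq> \<one>}. set vs)" if nz: "F v \<noteq> \<one>" for v
    proof -
      obtain us vs where "m (v # us @ vs) \<noteq> \<one>"
        using wedge_support [OF nz [unfolded F_def]] mc by blast
      then show ?thesis by force
    qed
    then have "{v. F v \<noteq> \<one>} \<subseteq> (\<Union>vs\<in>{vs. m vs \<noteq> \<one>}. set vs)" by blast
    moreover have "finite (\<Union>vs\<in>{vs. m vs \<noteq> \<one>}. set vs)" using m by (auto simp: finsupp_def)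
    ultimately show ?thesis by (rule finite_subset)
  qed
  \<comment> \<open>Writing each term as \<open>?m v\<close> against \<open>F v\<close> also covers
    \<open>v = x\<close>, where \<open>F x\<close> cancels \<open>m ws\<close> exactly if
    \<open>x\<close> occurs in \<open>ws\<close>.\<close>
  let ?m = "\<lambda>v. if v = x then m ws else \<one>"
  have finm: "finite {v. ?m v \<noteq> \<one>}" by (rule finite_subset [of _ "{x}"]) auto
  have "wedge G x m (v # ws) = ?m v \<otimes> inv (F v)" for v
    using Fx mc Fc by (auto simp: F_def)
  then have "face_sum G (wedge G x m) ws = gfinprod G (\<lambda>v. ?m v \<otimes> inv (F v)) UNIV"
    by (simp only: face_sum_def)
  also have "\<dots> = gfinprod G ?m UNIV \<otimes> gfinprod G (\<lambda>v. inv (F v)) UNIV"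
    by (rule gfinprod_distrib) (use finm finF Fc mc in \<open>auto simp: inv_eq_1_iff\<close>)
  also have "gfinprod G (\<lambda>v. inv (F v)) UNIV = inv (gfinprod G F UNIV)"
    by (rule gfinprod_inv) (use Fc in auto)
  also have "gfinprod G F UNIV = wedge G x (face_sum G m) ws"
    unfolding F_def face_sum_def [abs_def] using mc by (simp add: wedge_gfinprod)
  also have "gfinprod G ?m UNIV = finprod G ?m {x}"
    by (rule gfinprod_eq_finprod_superset) (use mc in auto)
  also have "\<dots> = m ws" using mc by (simp add: finprod_insert)
  finally show ?thesis .
qed

text \<open>The double sum runs over ordered pairs of removed vertices; exchanging the pair reverses
  the sign, and a pair of equal vertices contributes nothing by
  \<open>distinct_supp\<close>.\<close>

lemma face_sum_face_sum:
  assumes m: "finsupp G m" and alt: "alternating G m" and d: "distinct_supp G m"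
  shows "face_sum G (face_sum G m) ws = \<one>"
proof -
  have mc: "m us \<in> carrier G" for us using m by (simp add: finsupp_def)
  let ?f = "\<lambda>(v, w). m (w # v # ws)"
  have "finite {vw. ?f vw \<noteq> \<one>}"
  proof -
    have "{vw. ?f vw \<noteq> \<one>} \<subseteq> (\<lambda>vs. (hd (tl vs), hd vs)) ` {vs. m vs \<noteq> \<one>}" by force
    then show ?thesis using m by (auto simp: finsupp_def intro: finite_subset)
  qed
  then have fin: "finite {vw \<in> UNIV. ?f vw \<noteq> \<one>}" by simp
  have "gfinprod G ?f {vw \<in> UNIV. fst vw = v} = face_sum G m (v # ws)" for v
  proof -
    have "{vw \<in> UNIV. fst vw = v} = (\<lambda>w. (v, w)) ` UNIV" by auto
    then show ?thesis
      using mc by (subst \<open>_ = _ ` _\<close>) (subst gfinprod_reindex, auto simp: inj_on_def face_sum_def)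
  qed
  then have "face_sum G (face_sum G m) ws = gfinprod G (\<lambda>v. gfinprod G ?f {vw \<in> UNIV. fst vw = v}) UNIV"
    by (simp add: face_sum_def [of G "face_sum G m"])
  also have "\<dots> = gfinprod G ?f UNIV"
    by (rule gfinprod_fibers [OF fin]) (use mc in auto)
  also have "\<dots> = \<one>"
  proof (rule gfinprod_involution [where \<sigma> = prod.swap, OF fin])
    show "?f \<in> UNIV \<rightarrow> carrier G" using mc by auto
    have 1: "?f (prod.swap vw) = inv (?f vw)" for vw
      by (cases vw) (simp, rule alternating_adjacent0 [OF alt])
    have 2: "prod.swap vw = vw \<longrightarrow> ?f vw = \<one>" for vw
    proof
      assume "prod.swap vw = vw"
      then have "fst vw = snd vw" by (metis fst_swap)
      then have vw: "vw = (fst vw, fst vw)" by (simp add: prod_eq_iff)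
      have "\<not> distinct (fst vw # fst vw # ws)" by simp
      then show "?f vw = \<one>" using d unfolding distinct_supp_def by (subst vw) (simp only: prod.case, blast)
    qed
    show "prod.swap vw \<in> UNIV \<and> prod.swap (prod.swap vw) = vw \<and> ?f (prod.swap vw) = inv (?f vw) \<and>
         (prod.swap vw = vw \<longrightarrow> ?f vw = \<one>)" for vw
      by (intro conjI 1 2) auto
  qed
  finally show ?thesis .
qed

section \<open>Push-forward along a vertex map\<close>

lemma list_push_closed: "(\<And>us. c us \<in> carrier G) \<Longrightarrow> list_push G p c ws \<in> carrier G"
  by (auto simp: list_push_def intro!: gfinprod_closed)

lemma list_push_support:
  assumes "list_push G p c ws \<noteq> \<one>"
  obtains vs where "map p vs = ws" "c vs \<noteq> \<one>"
  using assms unfolding list_push_def by (auto elim: gfinprod_nontrivial_obtain)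

lemma finsupp_list_push:
  assumes "finsupp G c"
  shows "finsupp G (list_push G p c)"
proof -
  have "{ws. list_push G p c ws \<noteq> \<one>} \<subseteq> map p ` {vs. c vs \<noteq> \<one>}"
    by (auto elim: list_push_support)
  then show ?thesis
    using assms by (auto simp: finsupp_def list_push_closed intro: finite_subset)
qed

lemma list_push_mult:
  assumes "finsupp G c" "finsupp G d"
  shows "list_push G p (\<lambda>vs. c vs \<otimes> d vs) ws = list_push G p c ws \<otimes> list_push G p d ws"
  unfolding list_push_def
  by (rule gfinprod_distrib) (use assms in \<open>auto simp: finsupp_def intro: rev_finite_subset\<close>)

lemma list_push_inv:
  assumes "\<And>us. c us \<in> carrier G"
  shows "list_push G p (\<lambda>vs. inv (c vs)) ws = inv (list_push G p c ws)"
  unfolding list_push_def by (rule gfinprod_inv) (use assms in auto)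

text \<open>Both sums reduce to the lists that \<open>p\<close> and \<open>q\<close> alike send to
  \<open>ws\<close>. Agreement is asked on the support only, which permits a change at a vertex that
  does not occur there.\<close>

lemma list_push_cong:
  assumes c: "\<And>us. c us \<in> carrier G" and pq: "\<And>vs. c vs \<noteq> \<one> \<Longrightarrow> map p vs = map q vs"
  shows "list_push G p c ws = list_push G q c ws"
proof -
  have "list_push G p c ws = gfinprod G c {vs. map p vs = ws \<and> map q vs = ws}"
    unfolding list_push_def
    by (rule gfinprod_mono_neutral_cong_right) (use c pq in \<open>force simp del: map_eq_conv\<close>)+
  also have "\<dots> = list_push G q c ws"
    unfolding list_push_def
    by (rule gfinprod_mono_neutral_cong_left) (use c pq in \<open>force simp del: map_eq_conv\<close>)+
  finally show ?thesis .
qed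

lemma list_push_ident:
  assumes "\<And>us. c us \<in> carrier G"
  shows "list_push G (\<lambda>v. v) c ws = c ws"
proof -
  have "gfinprod G c {vs. vs = ws} = finprod G c {ws}"
    by (rule gfinprod_eq_finprod_superset) (use assms in auto)
  then show ?thesis using assms by (simp add: list_push_def finprod_insert)
qed

lemma list_push_compose:
  assumes c: "finsupp G c"
  shows "list_push G q (list_push G p c) ws = list_push G (\<lambda>v. q (p v)) c ws"
proof -
  let ?A = "{vs. map (\<lambda>v. q (p v)) vs = ws}"
  have fib: "gfinprod G c {vs. map p vs = us} = gfinprod G c {vs \<in> ?A. map p vs = us}" if "map q us = ws" for us
  proof -
    have "{vs. map p vs = us} = {vs \<in> ?A. map p vs = us}" using that by (auto simp: comp_def)
    then show ?thesis by simp
  qed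
  have "list_push G q (list_push G p c) ws = gfinprod G (\<lambda>us. gfinprod G c {vs \<in> ?A. map p vs = us}) {us. map q us = ws}"
    unfolding list_push_def
    by (rule gfinprod_cong) (use c fib in \<open>auto simp: finsupp_def simp_implies_def intro!: gfinprod_closed\<close>)
  also have "\<dots> = gfinprod G c ?A"
    by (rule gfinprod_fibers) (use c in \<open>auto simp: finsupp_def comp_def intro: rev_finite_subset\<close>)
  finally show ?thesis by (simp add: list_push_def)
qed

text \<open>Sorts the lists over \<open>w # ws\<close> by their first vertex; this is the recursion
  that matches the one of \<open>wedge\<close>.\<close>

lemma list_push_Cons:
  assumes c: "finsupp G c"
  shows "list_push G p c (w # ws) = gfinprod G (\<lambda>v. list_push G p (\<lambda>vs. c (v # vs)) ws) {v. p v = w}"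
proof -
  let ?A = "{vs. map p vs = w # ws}"
  have fib: "gfinprod G c {vs \<in> ?A. hd vs = v} = list_push G p (\<lambda>vs. c (v # vs)) ws" if "p v = w" for v
  proof -
    have "vs \<in> {vs \<in> ?A. hd vs = v} \<longleftrightarrow> vs \<in> (\<lambda>vs. v # vs) ` {vs. map p vs = ws}" for vs
      using that by (cases vs) (auto simp: image_iff)
    then have "{vs \<in> ?A. hd vs = v} = (\<lambda>vs. v # vs) ` {vs. map p vs = ws}" by (rule Set.set_eqI)
    then show ?thesis
      unfolding list_push_def using c
      by (simp add: gfinprod_reindex finsupp_def)
  qed
  have "list_push G p c (w # ws) = gfinprod G (\<lambda>v. gfinprod G c {vs \<in> ?A. hd vs = v}) {v. p v = w}"
    unfolding list_push_def
    by (rule gfinprod_fibers [symmetric]) (use c in \<open>auto simp: finsupp_def intro: rev_finite_subset\<close>)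
  also have "\<dots> = gfinprod G (\<lambda>v. list_push G p (\<lambda>vs. c (v # vs)) ws) {v. p v = w}"
    by (rule gfinprod_cong) (use c fib in \<open>auto simp: finsupp_def simp_implies_def intro!: list_push_closed\<close>)
  finally show ?thesis .
qed

lemma face_sum_list_push:
  assumes c: "finsupp G c"
  shows "face_sum G (list_push G p c) ws = list_push G p (face_sum G c) ws"
proof -
  \<comment> \<open>The lists counted on both sides: grouped by the image of the head they give the
    left-hand side, grouped by the tail the right-hand side.\<close>
  let ?A = "{vs. vs \<noteq> [] \<and> map p (tl vs) = ws}"
  have fin: "finite {vs \<in> ?A. c vs \<noteq> \<one>}"
    using c by (auto simp: finsupp_def intro: rev_finite_subset)
  have cc: "c vs \<in> carrier G" for vs using c by (simp add: finsupp_def)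
  have 1: "list_push G p c (w # ws) = gfinprod G c {vs \<in> ?A. p (hd vs) = w}" for w
  proof -
    have "{vs. map p vs = w # ws} = {vs \<in> ?A. p (hd vs) = w}"
    proof (rule Set.set_eqI)
      show "vs \<in> {vs. map p vs = w # ws} \<longleftrightarrow> vs \<in> {vs \<in> ?A. p (hd vs) = w}" for vs
        by (cases vs) auto
    qed
    then show ?thesis by (simp add: list_push_def)
  qed
  have 2: "face_sum G c us = gfinprod G c {vs \<in> ?A. tl vs = us}" if "map p us = ws" for us
  proof -
    have "{vs \<in> ?A. tl vs = us} = (\<lambda>v. v # us) ` UNIV" using that by (auto simp: image_iff neq_Nil_conv)
    then show ?thesis using cc by (simp add: face_sum_def gfinprod_reindex inj_on_def)
  qed
  have "face_sum G (list_push G p c) ws = gfinprod G (\<lambda>w. gfinprod G c {vs \<in> ?A. p (hd vs) = w}) UNIV"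
    by (simp add: face_sum_def 1)
  also have "\<dots> = gfinprod G c ?A"
    by (rule gfinprod_fibers [OF fin]) (use cc in auto)
  also have "\<dots> = gfinprod G (\<lambda>us. gfinprod G c {vs \<in> ?A. tl vs = us}) {us. map p us = ws}"
    by (rule gfinprod_fibers [OF fin, symmetric]) (use cc in auto)
  also have "\<dots> = list_push G p (face_sum G c) ws"
    unfolding list_push_def
    by (rule gfinprod_cong) (use cc 2 in \<open>auto simp: simp_implies_def intro!: face_sum_closed\<close>)
  finally show ?thesis .
qed

text \<open>Exchanging two positions commutes with \<open>map p\<close>, so it carries the fibre
  over \<open>ws\<close> bijectively to the fibre over the exchanged list and inverts every
  term.\<close>

lemma alternating_list_push:
  fixes c :: "'v list \<Rightarrow> 'a" and p :: "'v \<Rightarrow> 'w"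
  assumes c: "\<And>us. c us \<in> carrier G" and alt: "alternating G c"
  shows "alternating G (list_push G p c)"
  unfolding alternating_def
proof (intro allI impI)
  fix ws :: "'w list" and i j
  assume ij: "i < j \<and> j < length ws"
  let ?s = "\<lambda>vs. vs[i := vs ! j, j := vs ! i]"
  let ?A = "{vs. map p vs = ws}"
  have ss: "?s (?s vs) = vs" if "length vs = length ws" for vs :: "'z list"
    using that ij by (auto intro!: nth_equalityI simp: nth_list_update)
  have ms: "map p (?s vs) = ?s (map p vs)" if "length vs = length ws" for vs
    using that ij by (auto simp: map_update)
  have "{vs. map p vs = ?s ws} = ?s ` ?A"
  proof (intro equalityI subsetI)
    fix vs assume "vs \<in> {vs. map p vs = ?s ws}"
    then have m: "map p vs = ?s ws" by simp
    then have l: "length vs = length ws" by (metis length_map length_list_update)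
    have "map p (?s vs) = ws" using ms [OF l] ss [of ws] m by simp
    then show "vs \<in> ?s ` ?A" using ss [OF l] by (intro rev_image_eqI [of "?s vs"]) auto
  next
    fix vs assume "vs \<in> ?s ` ?A"
    then show "vs \<in> {vs. map p vs = ?s ws}" using ms by auto
  qed
  then have "list_push G p c (?s ws) = gfinprod G c (?s ` ?A)" by (simp add: list_push_def)
  also have "\<dots> = gfinprod G (\<lambda>vs. c (?s vs)) ?A"
  proof (rule gfinprod_reindex)
    show "inj_on ?s ?A"
    proof (rule inj_on_inverseI)
      show "?s (?s vs) = vs" if "vs \<in> ?A" for vs
        using that by (intro ss) auto
    qed
  qed (use c in auto)
  also have "\<dots> = gfinprod G (\<lambda>vs. inv (c vs)) ?A"
    by (rule gfinprod_cong) (use c alt ij in \<open>auto simp: simp_implies_def alternating_def\<close>)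
  also have "\<dots> = inv (list_push G p c ws)"
    unfolding list_push_def by (rule gfinprod_inv) (use c in auto)
  finally show "list_push G p c (?s ws) = inv (list_push G p c ws)" .
qed

text \<open>The two preimages of a repeated vertex can be interchanged, which cancels all contributions.\<close>

lemma distinct_supp_list_push:
  fixes c :: "'v list \<Rightarrow> 'a" and p :: "'v \<Rightarrow> 'w"
  assumes c: "finsupp G c" and alt: "alternating G c" and d: "distinct_supp G c"
  shows "distinct_supp G (list_push G p c)"
  unfolding distinct_supp_def
proof (intro allI impI)
  fix ws :: "'w list"
  assume "\<not> distinct ws"
  then obtain i j where ij: "i < j" "j < length ws" and eq: "ws ! i = ws ! j"
    by (metis distinct_conv_nth linorder_neqE_nat)
  let ?s = "\<lambda>vs. vs[i := vs ! j, j := vs ! i]"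
  show "list_push G p c ws = \<one>"
    unfolding list_push_def
  proof (rule gfinprod_involution [where \<sigma> = ?s])
    fix vs assume "vs \<in> {vs. map p vs = ws}"
    then have m: "map p vs = ws" by simp
    then have l: "length vs = length ws" by auto
    have "map p (?s vs) = ?s (map p vs)"
      using l ij by (auto simp: map_update)
    also have "\<dots> = ws" using m eq ij by (auto intro!: nth_equalityI simp: nth_list_update)
    finally have 1: "map p (?s vs) = ws" .
    have 2: "?s (?s vs) = vs" using l ij by (auto intro!: nth_equalityI simp: nth_list_update)
    have 3: "c (?s vs) = inv (c vs)" using alt ij l by (auto simp: alternating_def)
    have 4: "c vs = \<one>" if "?s vs = vs"
    proof -
      have "vs ! i = vs ! j" using that ij l by (metis nth_list_update_eq nth_list_update_neq less_trans nat_neq_iff length_list_update)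
      then have "\<not> distinct vs" using ij l by (metis nth_eq_iff_index_eq less_trans nat_neq_iff)
      then show ?thesis using d by (simp add: distinct_supp_def)
    qed
    show "?s vs \<in> {vs. map p vs = ws} \<and> ?s (?s vs) = vs \<and> c (?s vs) = inv (c vs) \<and> (?s vs = vs \<longrightarrow> c vs = \<one>)"
      using 1 2 3 4 by simp
  qed (use c in \<open>auto simp: finsupp_def intro: rev_finite_subset\<close>)
qed

end

section \<open>Simplicial chains and chain homotopies\<close>

definition simplicial_complex :: "'v set set \<Rightarrow> bool" where
  "simplicial_complex K \<longleftrightarrow> (\<forall>s\<in>K. finite s \<and> s \<noteq> {} \<and> (\<forall>t\<subseteq>s. t \<noteq> {} \<longrightarrow> t \<in> K))"

text \<open>The elementary homotopy from \<open>p\<close> to \<open>p(a := y)\<close>: it sends \<open>[a, v\<^sub>1, \<dots>, v\<^sub>n]\<close> to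
  \<open>[p a, y, p v\<^sub>1, \<dots>, p v\<^sub>n]\<close> and the simplexes without the vertex \<open>a\<close> to zero.\<close>

definition vertex_homotopy ::
  "('g, 'm) monoid_scheme \<Rightarrow> ('v \<Rightarrow> 'w) \<Rightarrow> 'v \<Rightarrow> 'w \<Rightarrow> ('v list \<Rightarrow> 'g) \<Rightarrow> 'w list \<Rightarrow> 'g" where
  "vertex_homotopy G p a y c = wedge G (p a) (wedge G y (list_push G p (\<lambda>vs. c (a # vs))))"

text \<open>Additively q - p = dD + Dd, for all degrees at once; the second condition makes
  \<open>D\<close> relative. In degree 0 the boundary is the unit, which \<open>D\<close> preserves
  as a homomorphism, so the last term drops out.\<close>

definition chain_homotopy ::
  "('g, 'm) monoid_scheme \<Rightarrow> 'v set set \<times> 'v set set \<Rightarrow> 'w set set \<times> 'w set set \<Rightarrow>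
    ('v \<Rightarrow> 'w) \<Rightarrow> ('v \<Rightarrow> 'w) \<Rightarrow> (('v list \<Rightarrow> 'g) \<Rightarrow> 'w list \<Rightarrow> 'g) \<Rightarrow> bool" where
  "chain_homotopy G KL KL' p q D \<longleftrightarrow> (\<forall>n.
     D \<in> hom (simplicial_chain_group G (fst KL) n) (simplicial_chain_group G (fst KL') (Suc n)) \<and>
     D ` carrier (simplicial_chain_group G (snd KL) n) \<subseteq> carrier (simplicial_chain_group G (snd KL') (Suc n)) \<and>
     (\<forall>c\<in>carrier (simplicial_chain_group G (fst KL) n). \<forall>ws.
        simplicial_chain_map G q c ws = simplicial_chain_map G p c ws \<otimes>\<^bsub>G\<^esub>
          (simplicial_boundary G (Suc n) (D c) ws \<otimes>\<^bsub>G\<^esub> D (simplicial_boundary G n c) ws)))"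

definition complex_pair :: "'v set set \<times> 'v set set \<Rightarrow> bool" where
  "complex_pair KL \<longleftrightarrow> simplicial_complex (fst KL) \<and> simplicial_complex (snd KL) \<and> snd KL \<subseteq> fst KL"

definition simplicial_map :: "'v set set \<times> 'v set set \<Rightarrow> 'w set set \<times> 'w set set \<Rightarrow> ('v \<Rightarrow> 'w) \<Rightarrow> bool" where
  "simplicial_map KL KL' p \<longleftrightarrow> (\<forall>s\<in>fst KL. p ` s \<in> fst KL') \<and> (\<forall>s\<in>snd KL. p ` s \<in> snd KL')"

definition contiguous ::
  "'v set set \<times> 'v set set \<Rightarrow> 'w set set \<times> 'w set set \<Rightarrow> ('v \<Rightarrow> 'w) \<Rightarrow> ('v \<Rightarrow> 'w) \<Rightarrow> bool" where
  "contiguous KL KL' p q \<longleftrightarrow>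
     (\<forall>s\<in>fst KL. p ` s \<union> q ` s \<in> fst KL') \<and> (\<forall>s\<in>snd KL. p ` s \<union> q ` s \<in> snd KL')"

context comm_group
begin

section \<open>The homotopy identity for a change at one vertex\<close>

lemma finsupp_filter: "finsupp G c \<Longrightarrow> finsupp G (\<lambda>vs. if P vs then c vs else \<one>)"
  by (auto simp: finsupp_def intro: rev_finite_subset)

text \<open>The part of \<open>c\<close> through \<open>a\<close> is \<open>a\<close> times the
  contraction of \<open>c\<close> by \<open>a\<close>, and pushing forward respects this product.
  Induction on \<open>ws\<close> compares its first vertex with \<open>p a\<close>.\<close>

lemma list_push_involving:
  assumes "finsupp G c" "alternating G c" "distinct_supp G c" "distinct ws"
  shows "list_push G p (\<lambda>vs. if a \<in> set vs then c vs else \<one>) ws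
       = wedge G (p a) (list_push G p (\<lambda>vs. c (a # vs))) ws"
  using assms
proof (induction ws arbitrary: c)
  case Nil
  then show ?case by (simp add: list_push_def gfinprod_trivial)
next
  case (Cons w ws)
  let ?F = "\<lambda>c vs. if a \<in> set vs then c vs else \<one>"
  have cc: "c vs \<in> carrier G" for vs using Cons.prems(1) by (simp add: finsupp_def)
  have split: "list_push G p (?F c) (w # ws)
      = gfinprod G (\<lambda>v. list_push G p (\<lambda>vs. ?F c (v # vs)) ws) {v. p v = w}"
    by (rule list_push_Cons [OF finsupp_filter [OF Cons.prems(1)]])
  show ?case
  proof (cases "w = p a")
    case True
    \<comment> \<open>If a list over \<open>w # ws\<close> contained \<open>a\<close> behind a first
      vertex \<open>v \<noteq> a\<close>, then \<open>p a\<close> would occur twice in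
      \<open>w # ws\<close>.\<close>
    have 0: "list_push G p (\<lambda>vs. ?F c (v # vs)) ws = \<one>" if "v \<noteq> a" "p v = w" for v
    proof (rule ccontr)
      assume "list_push G p (\<lambda>vs. ?F c (v # vs)) ws \<noteq> \<one>"
      then obtain vs where "map p vs = ws" "?F c (v # vs) \<noteq> \<one>" by (rule list_push_support)
      then have "p a \<in> set ws" using that by (auto split: if_splits)
      then show False using True Cons.prems(4) by simp
    qed
    have "list_push G p (?F c) (w # ws) = finprod G (\<lambda>v. list_push G p (\<lambda>vs. ?F c (v # vs)) ws) {a}"
      unfolding split
    proof (rule gfinprod_eq_finprod_superset)
      show "{v \<in> {v. p v = w}. list_push G p (\<lambda>vs. ?F c (v # vs)) ws \<noteq> \<one>} \<subseteq> {a}"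
        using 0 by blast
    qed (use True cc in \<open>auto intro!: list_push_closed\<close>)
    also have "\<dots> = list_push G p (\<lambda>vs. c (a # vs)) ws"
      using cc by (simp add: finprod_insert list_push_closed)
    finally show ?thesis using True Cons.prems(4) by simp
  next
    case False
    \<comment> \<open>Here \<open>a\<close> lies behind \<open>v\<close>; the induction hypothesis
      applies to the contraction by \<open>v\<close>, and exchanging \<open>a\<close> with
      \<open>v\<close> produces the inverse in the recursion of \<open>wedge\<close>.\<close>
    have 1: "list_push G p (\<lambda>vs. ?F c (v # vs)) ws
        = inv (wedge G (p a) (list_push G p (\<lambda>vs. c (a # v # vs))) ws)" if "p v = w" for v
    proof -
      have "(\<lambda>vs. ?F c (v # vs)) = ?F (\<lambda>vs. c (v # vs))" using False that by auto
      then have "list_push G p (\<lambda>vs. ?F c (v # vs)) ws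
          = wedge G (p a) (list_push G p (\<lambda>vs. c (v # a # vs))) ws"
        using Cons.IH [of "\<lambda>vs. c (v # vs)"] Cons.prems
        by (simp add: finsupp_Cons alternating_Cons distinct_supp_Cons)
      also have "(\<lambda>vs. c (v # a # vs)) = (\<lambda>vs. inv (c (a # v # vs)))"
        using alternating_adjacent0 [OF Cons.prems(2)] by blast
      also have "list_push G p (\<lambda>vs. inv (c (a # v # vs))) = (\<lambda>us. inv (list_push G p (\<lambda>vs. c (a # v # vs)) us))"
        using cc by (simp add: list_push_inv fun_eq_iff)
      also have "wedge G (p a) \<dots> ws = inv (wedge G (p a) (list_push G p (\<lambda>vs. c (a # v # vs))) ws)"
        using cc by (intro wedge_inv list_push_closed)
      finally show ?thesis .
    qed
    have "list_push G p (?F c) (w # ws)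
        = gfinprod G (\<lambda>v. inv (wedge G (p a) (list_push G p (\<lambda>vs. c (a # v # vs))) ws)) {v. p v = w}"
      unfolding split
      by (rule gfinprod_cong) (use 1 cc in \<open>auto simp: simp_implies_def intro!: wedge_closed list_push_closed\<close>)
    also have "\<dots> = inv (gfinprod G (\<lambda>v. wedge G (p a) (list_push G p (\<lambda>vs. c (a # v # vs))) ws) {v. p v = w})"
      by (rule gfinprod_inv) (use cc in \<open>auto intro!: wedge_closed list_push_closed\<close>)
    also have "gfinprod G (\<lambda>v. wedge G (p a) (list_push G p (\<lambda>vs. c (a # v # vs))) ws) {v. p v = w}
        = wedge G (p a) (\<lambda>us. gfinprod G (\<lambda>v. list_push G p (\<lambda>vs. c (a # v # vs)) us) {v. p v = w}) ws"
      by (rule wedge_gfinprod [symmetric]) (use cc in \<open>auto intro!: list_push_closed\<close>)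
    also have "\<dots> = wedge G (p a) (\<lambda>us. list_push G p (\<lambda>vs. c (a # vs)) (w # us)) ws"
      using list_push_Cons [OF finsupp_Cons [OF Cons.prems(1)], of p a w] by simp
    finally show ?thesis using False by simp
  qed
qed

text \<open>Only the part of \<open>c\<close> through \<open>a\<close> sees the change: it goes to x
  m under \<open>p\<close>, with x = \<open>p a\<close>, and to y m under \<open>p(a := y)\<close>.
  The homotopy takes c to x y m; the Leibniz rule applied twice gives d(x y m) = y m - x m + x y d
  m, and the last term is cancelled by the homotopy of the boundary, because contraction
  anticommutes with d.\<close>

lemma list_push_update_eq:
  fixes c :: "'v list \<Rightarrow> 'a" and p :: "'v \<Rightarrow> 'w"
  assumes c: "finsupp G c" "alternating G c" "distinct_supp G c" and ws: "distinct ws"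
  shows "list_push G (p(a := y)) c ws = list_push G p c ws \<otimes>
     (face_sum G (vertex_homotopy G p a y c) ws \<otimes> vertex_homotopy G p a y (face_sum G c) ws)"
proof -
  let ?q = "p(a := y)"
  let ?i = "\<lambda>vs. c (a # vs)"
  define m where "m = list_push G p ?i"
  have cc: "c vs \<in> carrier G" for vs using c by (simp add: finsupp_def)
  have fi: "finsupp G ?i" and ai: "alternating G ?i" and di: "distinct_supp G ?i"
    using c by (simp_all add: finsupp_Cons alternating_Cons distinct_supp_Cons)
  have m: "finsupp G m" "alternating G m" "distinct_supp G m"
    unfolding m_def using cc
    by (simp_all add: finsupp_list_push fi alternating_list_push ai distinct_supp_list_push di)
  have mc: "m us \<in> carrier G" for us using m by (simp add: finsupp_def)
  have bc: "face_sum G m us \<in> carrier G" for us by (rule face_sum_closed) (rule mc)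
  let ?A = "\<lambda>vs. if a \<in> set vs then c vs else \<one>"
  let ?B = "\<lambda>vs. if a \<notin> set vs then c vs else \<one>"
  have AB: "c = (\<lambda>vs. ?A vs \<otimes> ?B vs)" using cc by auto
  have split: "list_push G r c ws = wedge G (r a) (list_push G r ?i) ws \<otimes> list_push G r ?B ws" for r :: "'v \<Rightarrow> 'w"
  proof -
    have "list_push G r c ws = list_push G r (\<lambda>vs. ?A vs \<otimes> ?B vs) ws" using AB by simp
    also have "\<dots> = list_push G r ?A ws \<otimes> list_push G r ?B ws"
      by (rule list_push_mult) (use c in \<open>simp_all add: finsupp_filter\<close>)
    also have "list_push G r ?A ws = wedge G (r a) (list_push G r ?i) ws"
      by (rule list_push_involving) (use c ws in auto)
    finally show ?thesis .
  qed
  \<comment> \<open>A list in the support of the contraction does not contain \<open>a\<close>, so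
    both vertex maps agree on it and share the same \<open>m\<close>.\<close>
  have qi: "list_push G ?q ?i us = m us" for us
    unfolding m_def
  proof (rule list_push_cong)
    show "map ?q vs = map p vs" if "?i vs \<noteq> \<one>" for vs
    proof -
      have "distinct (a # vs)" using that c(3) unfolding distinct_supp_def by blast
      then show ?thesis by auto
    qed
  qed (rule cc)
  have qB: "list_push G ?q ?B ws = list_push G p ?B ws"
    by (rule list_push_cong) (use cc in \<open>auto split: if_splits\<close>)
  have Bc: "list_push G p ?B ws \<in> carrier G" by (rule list_push_closed) (use cc in auto)
  have q: "list_push G ?q c ws = wedge G y m ws \<otimes> list_push G p ?B ws"
    using split [of ?q] qB ext [of "list_push G ?q ?i" m, OF qi] by simp
  have p: "list_push G p c ws = wedge G (p a) m ws \<otimes> list_push G p ?B ws"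
    using split [of p] by (simp add: m_def)
  let ?W = "wedge G (p a) (wedge G y (face_sum G m)) ws"
  have "face_sum G (vertex_homotopy G p a y c) ws
      = wedge G y m ws \<otimes> inv (wedge G (p a) (face_sum G (wedge G y m)) ws)"
    unfolding vertex_homotopy_def m_def [symmetric]
    by (rule face_sum_wedge) (use m mc in \<open>simp_all add: finsupp_wedge alternating_wedge distinct_supp_wedge\<close>)
  also have "face_sum G (wedge G y m) = (\<lambda>us. m us \<otimes> inv (wedge G y (face_sum G m) us))"
    using face_sum_wedge [OF m] by blast
  also have "wedge G (p a) \<dots> ws = wedge G (p a) m ws \<otimes> inv ?W"
    using mc bc by (simp add: wedge_mult wedge_inv wedge_closed)
  finally have 1: "face_sum G (vertex_homotopy G p a y c) ws = wedge G y m ws \<otimes> inv (wedge G (p a) m ws \<otimes> inv ?W)" .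
  \<comment> \<open>Summing over a front vertex and evaluating at \<open>a\<close> anticommute: the
    two vertices are read in opposite order.\<close>
  have "face_sum G ?i us = inv (face_sum G c (a # us))" for us
  proof -
    have "(\<lambda>v. c (a # v # us)) = (\<lambda>v. inv (c (v # a # us)))"
      using alternating_adjacent0 [OF c(2)] by blast
    then show ?thesis using cc by (simp add: face_sum_def gfinprod_inv)
  qed
  then have fi': "(\<lambda>vs. face_sum G c (a # vs)) = (\<lambda>us. inv (face_sum G ?i us))"
    using cc by (simp add: face_sum_closed)
  have "list_push G p (\<lambda>vs. face_sum G c (a # vs)) = (\<lambda>us. inv (face_sum G m us))"
    unfolding fi' m_def using cc
    by (simp add: list_push_inv face_sum_closed fun_eq_iff face_sum_list_push [OF fi])
  then have 2: "vertex_homotopy G p a y (face_sum G c) ws = inv ?W"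
    unfolding vertex_homotopy_def using bc
    by (simp add: wedge_inv wedge_closed ext [of "wedge G y (\<lambda>us. inv (face_sum G m us))", OF wedge_inv])
  have Wc: "?W \<in> carrier G" using bc by (simp add: wedge_closed)
  \<comment> \<open>Additively Y + B = (X + B) + ((Y - (X - W)) - W), where B comes from the part of
    \<open>c\<close> that misses \<open>a\<close>.\<close>
  have alg: "Y \<otimes> B = (X \<otimes> B) \<otimes> ((Y \<otimes> inv (X \<otimes> inv W)) \<otimes> inv W)"
    if "X \<in> carrier G" "Y \<in> carrier G" "B \<in> carrier G" "W \<in> carrier G" for X Y B W
  proof -
    have "(X \<otimes> B) \<otimes> ((Y \<otimes> inv (X \<otimes> inv W)) \<otimes> inv W) = (X \<otimes> inv X) \<otimes> (W \<otimes> inv W) \<otimes> (Y \<otimes> B)"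
      using that by (simp only: inv_mult inv_inv m_ac m_closed inv_closed)
    also have "\<dots> = Y \<otimes> B" using that by simp
    finally show ?thesis by simp
  qed
  show ?thesis
    unfolding 1 2 q p by (rule alg) (use mc Bc Wc in \<open>auto intro: wedge_closed\<close>)
qed

section \<open>Chain groups, boundaries and chain maps\<close>

lemma mem_chain_group:
  "c \<in> carrier (simplicial_chain_group G K n) \<longleftrightarrow>
     finsupp G c \<and> alternating G c \<and> (\<forall>vs. c vs \<noteq> \<one> \<longrightarrow> vs \<in> ordered_simplexes K n)"
  by (auto simp: simplicial_chain_group_def finsupp_def alternating_def)

lemma chain_finsupp: "c \<in> carrier (simplicial_chain_group G K n) \<Longrightarrow> finsupp G c"
  and chain_alternating: "c \<in> carrier (simplicial_chain_group G K n) \<Longrightarrow> alternating G c"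
  and chain_support: "c \<in> carrier (simplicial_chain_group G K n) \<Longrightarrow> c vs \<noteq> \<one> \<Longrightarrow> vs \<in> ordered_simplexes K n"
  by (simp_all add: mem_chain_group)

lemma chain_distinct_supp: "c \<in> carrier (simplicial_chain_group G K n) \<Longrightarrow> distinct_supp G c"
  by (auto simp: mem_chain_group distinct_supp_def ordered_simplexes_def)

lemma chain_closed: "c \<in> carrier (simplicial_chain_group G K n) \<Longrightarrow> c vs \<in> carrier G"
  by (simp add: mem_chain_group finsupp_def)

lemma mult_chain_group [simp]: "c \<otimes>\<^bsub>simplicial_chain_group G K n\<^esub> d = (\<lambda>vs. c vs \<otimes> d vs)"
  by (simp add: simplicial_chain_group_def)

lemma one_chain_group [simp]: "\<one>\<^bsub>simplicial_chain_group G K n\<^esub> = (\<lambda>vs. \<one>)"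
  by (simp add: simplicial_chain_group_def)

lemma one_in_chain_group: "(\<lambda>vs. \<one>) \<in> carrier (simplicial_chain_group G K n)"
  by (simp add: mem_chain_group finsupp_def alternating_def)

lemma mult_in_chain_group:
  assumes "c \<in> carrier (simplicial_chain_group G K n)" "d \<in> carrier (simplicial_chain_group G K n)"
  shows "(\<lambda>vs. c vs \<otimes> d vs) \<in> carrier (simplicial_chain_group G K n)"
proof -
  have "{vs. c vs \<otimes> d vs \<noteq> \<one>} \<subseteq> {vs. c vs \<noteq> \<one>} \<union> {vs. d vs \<noteq> \<one>}" by auto
  moreover have "finite ({vs. c vs \<noteq> \<one>} \<union> {vs. d vs \<noteq> \<one>})"
    using assms by (simp add: mem_chain_group finsupp_def)
  ultimately have "finite {vs. c vs \<otimes> d vs \<noteq> \<one>}" by (rule finite_subset)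
  then have "finsupp G (\<lambda>vs. c vs \<otimes> d vs)" using assms by (simp add: mem_chain_group finsupp_def)
  moreover have "alternating G (\<lambda>vs. c vs \<otimes> d vs)"
    using assms by (auto simp: mem_chain_group finsupp_def alternating_def inv_mult)
  moreover have "vs \<in> ordered_simplexes K n" if "c vs \<otimes> d vs \<noteq> \<one>" for vs
    using that chain_support [OF assms(1)] chain_support [OF assms(2)] chain_closed [OF assms(2)]
    by (cases "c vs = \<one>") auto
  ultimately show ?thesis by (simp add: mem_chain_group)
qed

lemma inv_in_chain_group:
  assumes "c \<in> carrier (simplicial_chain_group G K n)"
  shows "(\<lambda>vs. inv (c vs)) \<in> carrier (simplicial_chain_group G K n)"
proof -
  have "{vs. inv (c vs) \<noteq> \<one>} = {vs. c vs \<noteq> \<one>}"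
    using chain_closed [OF assms] by (auto simp: inv_eq_1_iff)
  then show ?thesis
    using assms chain_closed [OF assms]
    by (auto simp: mem_chain_group finsupp_def alternating_def inv_eq_1_iff)
qed

lemma comm_group_chain_group: "comm_group (simplicial_chain_group G K n)"
proof (rule comm_groupI)
  fix c assume c: "c \<in> carrier (simplicial_chain_group G K n)"
  show "\<exists>d\<in>carrier (simplicial_chain_group G K n). d \<otimes>\<^bsub>simplicial_chain_group G K n\<^esub> c = \<one>\<^bsub>simplicial_chain_group G K n\<^esub>"
    by (rule bexI [OF _ inv_in_chain_group [OF c]]) (use chain_closed [OF c] in \<open>simp add: l_inv\<close>)
qed (auto simp: mult_in_chain_group one_in_chain_group fun_eq_iff chain_closed intro!: m_assoc m_comm)

lemma inv_chain_group:
  assumes "c \<in> carrier (simplicial_chain_group G K n)"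
  shows "inv\<^bsub>simplicial_chain_group G K n\<^esub> c = (\<lambda>vs. inv (c vs))"
proof -
  interpret C: comm_group "simplicial_chain_group G K n" by (rule comm_group_chain_group)
  show ?thesis
    by (rule C.inv_equality) (use assms chain_closed [OF assms] in \<open>auto simp: inv_in_chain_group l_inv\<close>)
qed

lemma ordered_simplexes_mono: "L \<subseteq> K \<Longrightarrow> ordered_simplexes L n \<subseteq> ordered_simplexes K n"
  by (auto simp: ordered_simplexes_def)

lemma chain_group_mono:
  "L \<subseteq> K \<Longrightarrow> carrier (simplicial_chain_group G L n) \<subseteq> carrier (simplicial_chain_group G K n)"
  using ordered_simplexes_mono [of L K n] unfolding mem_chain_group subset_iff by blast

lemma subgroup_chain_group:
  assumes "L \<subseteq> K"
  shows "subgroup (carrier (simplicial_chain_group G L n)) (simplicial_chain_group G K n)"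
proof
  show "inv\<^bsub>simplicial_chain_group G K n\<^esub> c \<in> carrier (simplicial_chain_group G L n)"
    if "c \<in> carrier (simplicial_chain_group G L n)" for c
    using inv_chain_group [of c K n] inv_in_chain_group [OF that] that chain_group_mono [OF assms, of n] by auto
qed (use chain_group_mono [OF assms] in \<open>auto simp: mult_in_chain_group one_in_chain_group\<close>)

lemma boundary_0 [simp]: "simplicial_boundary G 0 c = (\<lambda>ws. \<one>)"
  by (simp add: simplicial_boundary_def)

lemma boundary_pos: "n \<noteq> 0 \<Longrightarrow> simplicial_boundary G n c = face_sum G c"
  by (simp add: simplicial_boundary_def face_sum_def [abs_def])

lemma boundary_in_chain_group:
  assumes K: "simplicial_complex K" and c: "c \<in> carrier (simplicial_chain_group G K n)"
  shows "simplicial_boundary G n c \<in> carrier (simplicial_chain_group G K (n - 1))"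
proof (cases n)
  case 0
  then show ?thesis by (simp add: one_in_chain_group)
next
  case (Suc k)
  have "ws \<in> ordered_simplexes K k" if nz: "face_sum G c ws \<noteq> \<one>" for ws
  proof -
    obtain v where "c (v # ws) \<noteq> \<one>" using nz by (rule face_sum_support)
    then have v: "v # ws \<in> ordered_simplexes K (Suc k)" using chain_support [OF c] Suc by simp
    \<comment> \<open>In positive degree a face keeps at least one vertex, hence is again a
      simplex.\<close>
    then have "set ws \<subseteq> set (v # ws)" "set ws \<noteq> {}" "set (v # ws) \<in> K"
      by (auto simp: ordered_simplexes_def)
    then have "set ws \<in> K" using K unfolding simplicial_complex_def by blast
    then show ?thesis using v by (simp add: ordered_simplexes_def)
  qed
  then show ?thesis
    using Suc chain_finsupp [OF c] chain_alternating [OF c] chain_closed [OF c]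
    by (simp add: boundary_pos mem_chain_group finsupp_face_sum alternating_face_sum)
qed

lemma boundary_mult:
  assumes "c \<in> carrier (simplicial_chain_group G K n)" "d \<in> carrier (simplicial_chain_group G K n)"
  shows "simplicial_boundary G n (\<lambda>vs. c vs \<otimes> d vs) = (\<lambda>ws. simplicial_boundary G n c ws \<otimes> simplicial_boundary G n d ws)"
  using chain_finsupp [OF assms(1)] chain_finsupp [OF assms(2)]
  by (cases "n = 0") (simp_all add: boundary_pos face_sum_mult fun_eq_iff)

lemma boundary_hom:
  "simplicial_complex K \<Longrightarrow>
    simplicial_boundary G n \<in> hom (simplicial_chain_group G K n) (simplicial_chain_group G K (n - 1))"
  by (rule homI) (simp_all only: boundary_in_chain_group mult_chain_group boundary_mult)

lemma boundary_boundary: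
  assumes "c \<in> carrier (simplicial_chain_group G K (Suc n))"
  shows "simplicial_boundary G n (simplicial_boundary G (Suc n) c) = (\<lambda>ws. \<one>)"
  using face_sum_face_sum [OF chain_finsupp [OF assms] chain_alternating [OF assms] chain_distinct_supp [OF assms]]
  by (cases "n = 0") (simp_all add: boundary_pos fun_eq_iff)

text \<open>On a list with a repeated vertex the definition prescribes the unit, and the fibre sum
  attains it by cancellation. Through this equation chain maps inherit the rules for
  \<open>list_push\<close>.\<close>

lemma chain_map_eq_list_push:
  assumes "c \<in> carrier (simplicial_chain_group G K n)"
  shows "simplicial_chain_map G p c = list_push G p c"
proof
  fix ws
  have "distinct_supp G (list_push G p c)"
    using assms chain_finsupp chain_alternating chain_distinct_supp by (intro distinct_supp_list_push)
  then show "simplicial_chain_map G p c ws = list_push G p c ws"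
    by (simp add: simplicial_chain_map_def list_push_def distinct_supp_def)
qed

lemma chain_map_in_chain_group:
  assumes p: "\<forall>s\<in>K. p ` s \<in> K'" and c: "c \<in> carrier (simplicial_chain_group G K n)"
  shows "simplicial_chain_map G p c \<in> carrier (simplicial_chain_group G K' n)"
proof -
  have "ws \<in> ordered_simplexes K' n" if nz: "list_push G p c ws \<noteq> \<one>" for ws
  proof -
    have "distinct_supp G (list_push G p c)"
      using c chain_finsupp chain_alternating chain_distinct_supp by (intro distinct_supp_list_push)
    then have "distinct ws" using nz unfolding distinct_supp_def by blast
    obtain vs where vs: "map p vs = ws" "c vs \<noteq> \<one>" using nz by (rule list_push_support)
    then have "vs \<in> ordered_simplexes K n" using chain_support [OF c] by simp
    then have "length vs = Suc n" "set vs \<in> K" by (auto simp: ordered_simplexes_def)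
    then have "length ws = Suc n" "set ws \<in> K'" using p vs(1) by auto
    then show ?thesis using \<open>distinct ws\<close> by (simp add: ordered_simplexes_def)
  qed
  then show ?thesis
    using chain_finsupp [OF c] chain_alternating [OF c] chain_closed [OF c]
    by (simp add: chain_map_eq_list_push [OF c] mem_chain_group finsupp_list_push alternating_list_push)
qed

lemma chain_map_mult:
  assumes "c \<in> carrier (simplicial_chain_group G K n)" "d \<in> carrier (simplicial_chain_group G K n)"
  shows "simplicial_chain_map G p (\<lambda>vs. c vs \<otimes> d vs) = (\<lambda>ws. simplicial_chain_map G p c ws \<otimes> simplicial_chain_map G p d ws)"
  using assms mult_in_chain_group [OF assms]
  by (simp add: chain_map_eq_list_push [of _ K n] list_push_mult chain_finsupp fun_eq_iff)

lemma chain_map_hom: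
  "\<forall>s\<in>K. p ` s \<in> K' \<Longrightarrow>
    simplicial_chain_map G p \<in> hom (simplicial_chain_group G K n) (simplicial_chain_group G K' n)"
  by (rule homI) (auto simp: chain_map_in_chain_group chain_map_mult)

lemma chain_map_one [simp]: "simplicial_chain_map G p (\<lambda>vs. \<one>) = (\<lambda>ws. \<one>)"
  by (rule ext) (simp add: simplicial_chain_map_def gfinprod_trivial)

lemma chain_map_boundary:
  assumes K: "simplicial_complex K" and c: "c \<in> carrier (simplicial_chain_group G K n)"
  shows "simplicial_boundary G n (simplicial_chain_map G p c) = simplicial_chain_map G p (simplicial_boundary G n c)"
proof (cases "n = 0")
  case False
  have "simplicial_chain_map G p (face_sum G c) = list_push G p (face_sum G c)"
    by (rule chain_map_eq_list_push [OF boundary_in_chain_group [OF K c, unfolded boundary_pos [OF False]]])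
  then show ?thesis
    using False
    by (simp add: boundary_pos chain_map_eq_list_push [OF c] fun_eq_iff face_sum_list_push [OF chain_finsupp [OF c]])
qed simp

lemma chain_map_compose:
  assumes "\<forall>s\<in>K. p ` s \<in> K'" and "c \<in> carrier (simplicial_chain_group G K n)"
  shows "simplicial_chain_map G q (simplicial_chain_map G p c) = simplicial_chain_map G (\<lambda>v. q (p v)) c"
  using chain_map_in_chain_group [OF assms] assms(2)
  by (simp add: chain_map_eq_list_push [of _ K n] chain_map_eq_list_push [of _ K' n] fun_eq_iff
      list_push_compose [OF chain_finsupp [OF assms(2)]])

lemma chain_map_cong:
  assumes "\<And>v. v \<in> \<Union>K \<Longrightarrow> p v = q v" and c: "c \<in> carrier (simplicial_chain_group G K n)"
  shows "simplicial_chain_map G p c = simplicial_chain_map G q c"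
proof -
  have "map p vs = map q vs" if "c vs \<noteq> \<one>" for vs
    using chain_support [OF c that] assms(1) by (auto simp: ordered_simplexes_def)
  then show ?thesis
    using chain_closed [OF c] by (auto simp: chain_map_eq_list_push [OF c] fun_eq_iff intro!: list_push_cong)
qed

lemma chain_map_ident:
  assumes "c \<in> carrier (simplicial_chain_group G K n)"
  shows "simplicial_chain_map G (\<lambda>v. v) c = c"
  using assms chain_closed [OF assms] by (auto simp: chain_map_eq_list_push fun_eq_iff list_push_ident)

section \<open>Chain homotopies between contiguous maps\<close>

lemma vertex_homotopy_in_chain_group:
  assumes K': "simplicial_complex K'" and pq: "\<forall>s\<in>K. insert y (p ` s) \<in> K' \<or> a \<notin> s"
    and c: "c \<in> carrier (simplicial_chain_group G K n)"
  shows "vertex_homotopy G p a y c \<in> carrier (simplicial_chain_group G K' (Suc n))"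
proof -
  let ?m = "list_push G p (\<lambda>vs. c (a # vs))"
  have cc: "\<And>vs. c vs \<in> carrier G" by (rule chain_closed [OF c])
  have fi: "finsupp G (\<lambda>vs. c (a # vs))" and ai: "alternating G (\<lambda>vs. c (a # vs))"
    and di: "distinct_supp G (\<lambda>vs. c (a # vs))"
    using c by (auto intro: finsupp_Cons alternating_Cons distinct_supp_Cons chain_finsupp chain_alternating chain_distinct_supp)
  have m: "finsupp G ?m" "alternating G ?m" "distinct_supp G ?m" "\<And>us. ?m us \<in> carrier G"
    using cc by (simp_all add: finsupp_list_push fi alternating_list_push ai distinct_supp_list_push di list_push_closed)
  have w: "finsupp G (wedge G y ?m)" "alternating G (wedge G y ?m)" "distinct_supp G (wedge G y ?m)"
     "\<And>us. wedge G y ?m us \<in> carrier G"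
    using m by (simp_all add: finsupp_wedge alternating_wedge distinct_supp_wedge wedge_closed)
  have h: "finsupp G (vertex_homotopy G p a y c)" "alternating G (vertex_homotopy G p a y c)"
    "distinct_supp G (vertex_homotopy G p a y c)"
    unfolding vertex_homotopy_def using w by (simp_all add: finsupp_wedge alternating_wedge distinct_supp_wedge)
  have "ws \<in> ordered_simplexes K' (Suc n)" if nz: "vertex_homotopy G p a y c ws \<noteq> \<one>" for ws
  proof -
    have d: "distinct ws" using h(3) nz unfolding distinct_supp_def by blast
    \<comment> \<open>Taking off the two factors in turn removes \<open>p a\<close>, then
      \<open>y\<close>, and leaves the image of a list \<open>vs\<close> with \<open>a # vs\<close>
      in the support of \<open>c\<close>.\<close>
    obtain us1 us2 where 1: "ws = us1 @ p a # us2" and nz1: "wedge G y ?m (us1 @ us2) \<noteq> \<one>"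
      using wedge_support [OF nz [unfolded vertex_homotopy_def]] w(4) by blast
    obtain vs1 vs2 where 2: "us1 @ us2 = vs1 @ y # vs2" and nz2: "?m (vs1 @ vs2) \<noteq> \<one>"
      using wedge_support [OF nz1] m(4) by blast
    obtain vs where 3: "map p vs = vs1 @ vs2" and nz3: "c (a # vs) \<noteq> \<one>"
      using nz2 by (rule list_push_support)
    have 4: "a # vs \<in> ordered_simplexes K n" by (rule chain_support [OF c nz3])
    have "length ws = Suc (length (us1 @ us2))" by (simp add: 1)
    also have "\<dots> = Suc (Suc (length (map p vs)))" by (simp add: 2 3)
    also have "\<dots> = Suc (Suc n)" using 4 by (simp add: ordered_simplexes_def)
    finally have l: "length ws = Suc (Suc n)" .
    have "set ws = insert (p a) (set (us1 @ us2))" by (auto simp: 1)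
    also have "\<dots> = insert (p a) (insert y (set (map p vs)))" by (simp add: 2 3)
    finally have "set ws = insert y (p ` set (a # vs))" by auto
    moreover have "set (a # vs) \<in> K" using 4 by (simp add: ordered_simplexes_def)
    \<comment> \<open>The simplex \<open>set (a # vs)\<close> contains \<open>a\<close>, the case in
      which \<open>pq\<close> provides the enlarged image.\<close>
    ultimately have "set ws \<in> K'" using pq by (metis list.set_intros(1))
    then show ?thesis using d l by (simp add: ordered_simplexes_def)
  qed
  then show ?thesis using h by (simp add: mem_chain_group)
qed

lemma vertex_homotopy_mult:
  assumes "c \<in> carrier (simplicial_chain_group G K n)" "d \<in> carrier (simplicial_chain_group G K n)"
  shows "vertex_homotopy G p a y (\<lambda>vs. c vs \<otimes> d vs) = (\<lambda>ws. vertex_homotopy G p a y c ws \<otimes> vertex_homotopy G p a y d ws)"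
proof
  fix ws
  have m: "list_push G p (\<lambda>vs. c (a # vs) \<otimes> d (a # vs))
      = (\<lambda>us. list_push G p (\<lambda>vs. c (a # vs)) us \<otimes> list_push G p (\<lambda>vs. d (a # vs)) us)"
    by (rule ext, rule list_push_mult) (auto intro: finsupp_Cons chain_finsupp assms)
  have w: "wedge G y \<dots> = (\<lambda>us. wedge G y (list_push G p (\<lambda>vs. c (a # vs))) us \<otimes> wedge G y (list_push G p (\<lambda>vs. d (a # vs))) us)"
    by (rule ext, rule wedge_mult) (auto intro!: list_push_closed intro: chain_closed assms)
  show "vertex_homotopy G p a y (\<lambda>vs. c vs \<otimes> d vs) ws = vertex_homotopy G p a y c ws \<otimes> vertex_homotopy G p a y d ws"
    unfolding vertex_homotopy_def m w
    by (rule wedge_mult) (auto intro!: wedge_closed list_push_closed intro: chain_closed assms)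
qed

lemma chain_homotopy_vertex:
  assumes KL: "complex_pair KL" and KL': "complex_pair KL'"
    and con: "contiguous KL KL' p (p(a := y))"
  shows "chain_homotopy G KL KL' p (p(a := y)) (vertex_homotopy G p a y)"
proof -
  have K': "simplicial_complex (fst KL')" "simplicial_complex (snd KL')" and K: "simplicial_complex (fst KL)"
    using KL KL' by (auto simp: complex_pair_def)
  have un: "p ` s \<union> (p(a := y)) ` s = insert y (p ` s)" if "a \<in> s" for s using that by auto
  have pq: "\<forall>s\<in>fst KL. insert y (p ` s) \<in> fst KL' \<or> a \<notin> s" "\<forall>s\<in>snd KL. insert y (p ` s) \<in> snd KL' \<or> a \<notin> s"
    using con un unfolding contiguous_def by metis+
  show ?thesis
    unfolding chain_homotopy_def
  proof (intro allI conjI ballI)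
    fix n
    show "vertex_homotopy G p a y \<in> hom (simplicial_chain_group G (fst KL) n) (simplicial_chain_group G (fst KL') (Suc n))"
      by (rule homI) (auto simp: vertex_homotopy_in_chain_group [OF K'(1) pq(1)] vertex_homotopy_mult)
    show "vertex_homotopy G p a y ` carrier (simplicial_chain_group G (snd KL) n)
        \<subseteq> carrier (simplicial_chain_group G (snd KL') (Suc n))"
      by (auto simp: vertex_homotopy_in_chain_group [OF K'(2) pq(2)])
    fix c ws assume c: "c \<in> carrier (simplicial_chain_group G (fst KL) n)"
    let ?h = "vertex_homotopy G p a y"
    have hc: "?h c \<in> carrier (simplicial_chain_group G (fst KL') (Suc n))"
      by (rule vertex_homotopy_in_chain_group [OF K'(1) pq(1) c])
    have bc: "simplicial_boundary G n c \<in> carrier (simplicial_chain_group G (fst KL) (n - 1))"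
      by (rule boundary_in_chain_group [OF K c])
    \<comment> \<open>In degree 0 \<open>face_sum\<close> is the augmentation while
      \<open>simplicial_boundary\<close> is trivial. The homotopy does not tell them apart: it
      evaluates the face sum on lists starting with \<open>a\<close>, whose values come from lists
      of length at least two.\<close>
    have hb: "?h (simplicial_boundary G n c) ws = ?h (face_sum G c) ws"
    proof (cases "n = 0")
      case True
      have "c (v # a # vs) = \<one>" for v vs
        using chain_support [OF c, of "v # a # vs"] True by (auto simp: ordered_simplexes_def)
      then have "(\<lambda>vs. face_sum G c (a # vs)) = (\<lambda>vs. \<one>)"
        by (simp add: face_sum_def gfinprod_trivial)
      then have "?h (face_sum G c) ws = ?h (\<lambda>vs. \<one>) ws"
        by (simp add: vertex_homotopy_def)
      then show ?thesis using True by simp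
    qed (simp add: boundary_pos)
    show "simplicial_chain_map G (p(a := y)) c ws = simplicial_chain_map G p c ws \<otimes>
       (simplicial_boundary G (Suc n) (?h c) ws \<otimes> ?h (simplicial_boundary G n c) ws)"
    proof (cases "distinct ws")
      case True
      then show ?thesis
        using list_push_update_eq [OF chain_finsupp [OF c] chain_alternating [OF c] chain_distinct_supp [OF c] True]
        by (simp add: chain_map_eq_list_push [OF c] boundary_pos hb)
    next
      case False
      \<comment> \<open>\<open>list_push_update_eq\<close> speaks of distinct lists; on the others
        every term is the unit.\<close>
      have "simplicial_boundary G (Suc n) (?h c) ws = \<one>"
        using chain_distinct_supp [OF boundary_in_chain_group [OF K'(1) hc]] False
        by (simp add: distinct_supp_def)
      moreover have "?h (simplicial_boundary G n c) ws = \<one>"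
        using chain_distinct_supp [OF vertex_homotopy_in_chain_group [OF K'(1) pq(1) bc]] False
        by (simp add: distinct_supp_def)
      ultimately show ?thesis using False by (simp add: simplicial_chain_map_def)
    qed
  qed
qed

text \<open>Vertex maps are defined on a whole type, but chains see only the vertices of the
  complex; maps that agree there induce the same chain map.\<close>

lemma chain_homotopy_refl:
  assumes "\<And>v. v \<in> \<Union>(fst KL) \<Longrightarrow> p v = q v" "simplicial_map KL KL' p"
  shows "chain_homotopy G KL KL' p q (\<lambda>c ws. \<one>)"
  unfolding chain_homotopy_def
proof (intro allI conjI ballI)
  fix n c ws
  assume c: "c \<in> carrier (simplicial_chain_group G (fst KL) n)"
  have "simplicial_chain_map G p c = simplicial_chain_map G q c"
    by (rule chain_map_cong [OF assms(1) c])
  moreover have "simplicial_chain_map G p c \<in> carrier (simplicial_chain_group G (fst KL') n)"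
    by (rule chain_map_in_chain_group [OF _ c]) (use assms(2) in \<open>simp add: simplicial_map_def\<close>)
  ultimately show "simplicial_chain_map G q c ws = simplicial_chain_map G p c ws \<otimes>
      (simplicial_boundary G (Suc n) (\<lambda>ws. \<one>) ws \<otimes> \<one>)"
    by (simp add: boundary_pos face_sum_def gfinprod_trivial chain_closed)
qed (auto simp: one_in_chain_group intro: homI)

lemma chain_homotopy_trans:
  assumes KL: "complex_pair KL" and KL': "complex_pair KL'"
    and p: "simplicial_map KL KL' p"
    and D: "chain_homotopy G KL KL' p q D" and E: "chain_homotopy G KL KL' q r E"
  shows "chain_homotopy G KL KL' p r (\<lambda>c ws. D c ws \<otimes> E c ws)"
  unfolding chain_homotopy_def
proof (intro allI conjI ballI)
  fix n
  have K: "simplicial_complex (fst KL)" and K': "simplicial_complex (fst KL')"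
    using KL KL' by (simp_all add: complex_pair_def)
  have Dh: "D \<in> hom (simplicial_chain_group G (fst KL) n) (simplicial_chain_group G (fst KL') (Suc n))" for n
    using D by (simp add: chain_homotopy_def)
  have Eh: "E \<in> hom (simplicial_chain_group G (fst KL) n) (simplicial_chain_group G (fst KL') (Suc n))" for n
    using E by (simp add: chain_homotopy_def)
  show "(\<lambda>c ws. D c ws \<otimes> E c ws) \<in> hom (simplicial_chain_group G (fst KL) n) (simplicial_chain_group G (fst KL') (Suc n))"
  proof (rule homI)
    fix c d assume cd: "c \<in> carrier (simplicial_chain_group G (fst KL) n)" "d \<in> carrier (simplicial_chain_group G (fst KL) n)"
    have "D (\<lambda>vs. c vs \<otimes> d vs) = (\<lambda>vs. D c vs \<otimes> D d vs)" "E (\<lambda>vs. c vs \<otimes> d vs) = (\<lambda>vs. E c vs \<otimes> E d vs)"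
      using hom_mult [OF Dh cd] hom_mult [OF Eh cd] by simp_all
    then show "(\<lambda>ws. D (c \<otimes>\<^bsub>simplicial_chain_group G (fst KL) n\<^esub> d) ws \<otimes> E (c \<otimes>\<^bsub>simplicial_chain_group G (fst KL) n\<^esub> d) ws) =
       (\<lambda>ws. D c ws \<otimes> E c ws) \<otimes>\<^bsub>simplicial_chain_group G (fst KL') (Suc n)\<^esub> (\<lambda>ws. D d ws \<otimes> E d ws)"
      using chain_closed [OF hom_in_carrier [OF Dh cd(1)]] chain_closed [OF hom_in_carrier [OF Dh cd(2)]]
        chain_closed [OF hom_in_carrier [OF Eh cd(1)]] chain_closed [OF hom_in_carrier [OF Eh cd(2)]]
      by (simp add: m_ac)
  qed (use hom_in_carrier [OF Dh] hom_in_carrier [OF Eh] in \<open>auto simp: mult_in_chain_group\<close>)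
  show "(\<lambda>c ws. D c ws \<otimes> E c ws) ` carrier (simplicial_chain_group G (snd KL) n)
      \<subseteq> carrier (simplicial_chain_group G (snd KL') (Suc n))"
  proof (intro image_subsetI mult_in_chain_group)
    fix c assume "c \<in> carrier (simplicial_chain_group G (snd KL) n)"
    then show "D c \<in> carrier (simplicial_chain_group G (snd KL') (Suc n))"
      "E c \<in> carrier (simplicial_chain_group G (snd KL') (Suc n))"
      using D E unfolding chain_homotopy_def by blast+
  qed
  fix c ws assume c: "c \<in> carrier (simplicial_chain_group G (fst KL) n)"
  have bc: "simplicial_boundary G n c \<in> carrier (simplicial_chain_group G (fst KL) (n - 1))"
    by (rule boundary_in_chain_group [OF K c])
  have Dc: "D c \<in> carrier (simplicial_chain_group G (fst KL') (Suc n))" and Ec: "E c \<in> carrier (simplicial_chain_group G (fst KL') (Suc n))"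
    using hom_in_carrier [OF Dh c] hom_in_carrier [OF Eh c] by simp_all
  have pc: "simplicial_chain_map G p c \<in> carrier (simplicial_chain_group G (fst KL') n)"
    by (rule chain_map_in_chain_group [OF _ c]) (use p in \<open>simp add: simplicial_map_def\<close>)
  have "simplicial_chain_map G q c ws = simplicial_chain_map G p c ws \<otimes>
      (simplicial_boundary G (Suc n) (D c) ws \<otimes> D (simplicial_boundary G n c) ws)"
    "simplicial_chain_map G r c ws = simplicial_chain_map G q c ws \<otimes>
      (simplicial_boundary G (Suc n) (E c) ws \<otimes> E (simplicial_boundary G n c) ws)"
    using c D E by (simp_all add: chain_homotopy_def)
  then show "simplicial_chain_map G r c ws = simplicial_chain_map G p c ws \<otimes>
      (simplicial_boundary G (Suc n) (\<lambda>ws. D c ws \<otimes> E c ws) ws \<otimes>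
       (D (simplicial_boundary G n c) ws \<otimes> E (simplicial_boundary G n c) ws))"
    using chain_closed [OF pc] chain_closed [OF boundary_in_chain_group [OF K' Dc]]
      chain_closed [OF boundary_in_chain_group [OF K' Ec]]
      chain_closed [OF hom_in_carrier [OF Dh bc]] chain_closed [OF hom_in_carrier [OF Eh bc]]
    by (simp add: boundary_mult [OF Dc Ec] m_ac)
qed

lemma contiguous_chain_homotopy:
  assumes KL: "complex_pair KL" and KL': "complex_pair KL'" and fin: "finite (\<Union>(fst KL))"
    and con: "contiguous KL KL' p q"
  shows "\<exists>D. chain_homotopy G KL KL' p q D"
proof -
  \<comment> \<open>Follows \<open>q\<close> on \<open>S\<close> and \<open>p\<close> off
    \<open>S\<close>; enlarging \<open>S\<close> by one vertex changes the map at that vertex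
    only.\<close>
  define r where "r S v = (if v \<in> S then q v else p v)" for S v
  \<comment> \<open>Every nonempty subset of p(s) \<union> q(s) is a simplex, so all intermediate
    maps are simplicial and contiguous to one another.\<close>
  have face: "t \<in> fst KL'" if "t \<subseteq> p ` s \<union> q ` s" "t \<noteq> {}" "s \<in> fst KL" for t s
    using KL' con that unfolding complex_pair_def simplicial_complex_def contiguous_def by blast
  have face': "t \<in> snd KL'" if "t \<subseteq> p ` s \<union> q ` s" "t \<noteq> {}" "s \<in> snd KL" for t s
    using KL' con that unfolding complex_pair_def simplicial_complex_def contiguous_def by blast
  have ne: "s \<noteq> {}" if "s \<in> fst KL \<or> s \<in> snd KL" for s
    using KL that unfolding complex_pair_def simplicial_complex_def by blast
  have rs: "simplicial_map KL KL' (r S)" for S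
    unfolding simplicial_map_def r_def using ne by (auto intro!: face face')
  have rc: "contiguous KL KL' (r S) (r T)" for S T
    unfolding contiguous_def r_def using ne by (auto intro!: face face')
  have "\<exists>D. chain_homotopy G KL KL' p (r S) D" if "finite S" for S
    using that
  proof (induction S rule: finite_induct)
    case empty
    have "r {} = p" by (simp add: r_def fun_eq_iff)
    then show ?case using chain_homotopy_refl [of KL p p KL'] rs [of "{}"] by auto
  next
    case (insert a S)
    then obtain D where D: "chain_homotopy G KL KL' p (r S) D" by blast
    have upd: "r (insert a S) = (r S)(a := q a)" by (auto simp: r_def fun_eq_iff)
    have "chain_homotopy G KL KL' (r S) (r (insert a S)) (vertex_homotopy G (r S) a (q a))"
      unfolding upd by (rule chain_homotopy_vertex [OF KL KL']) (use rc [of S "insert a S"] upd in simp)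
    moreover have "simplicial_map KL KL' p" using rs [of "{}"] by (simp add: r_def [abs_def])
    ultimately show ?case using chain_homotopy_trans [OF KL KL' _ D] by blast
  qed
  from this [OF fin] obtain D where D: "chain_homotopy G KL KL' p (r (\<Union>(fst KL))) D" by blast
  \<comment> \<open>On the vertices of the complex the map has become \<open>q\<close>; elsewhere it
    is still \<open>p\<close>.\<close>
  have "chain_homotopy G KL KL' (r (\<Union>(fst KL))) q (\<lambda>c ws. \<one>)"
    by (rule chain_homotopy_refl) (auto simp: r_def rs [unfolded r_def [abs_def]] intro!: rs)
  moreover have "simplicial_map KL KL' p" using rs [of "{}"] by (simp add: r_def [abs_def])
  ultimately show ?thesis using chain_homotopy_trans [OF KL KL' _ D] by blast
qed

end

section \<open>Simplicial homology\<close>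

text \<open>Homology and cohomology both have the form cycles modulo boundaries inside an ambient
  abelian group, so cosets and induced maps are treated once for both.\<close>

locale subquotient = comm_group G for G (structure) +
  fixes Z B
  assumes subgroup_Z: "subgroup Z G" and subgroup_B: "subgroup B G" and B_subset: "B \<subseteq> Z"
begin

lemma Z_closed: "z \<in> Z \<Longrightarrow> z \<in> carrier G"
  using subgroup.mem_carrier [OF subgroup_Z] .

lemma normal_B: "B \<lhd> G"
  using subgroup_B by (rule subgroup_imp_normal)

lemma comm_group_subquotient: "comm_group (G\<lparr>carrier := Z\<rparr> Mod B)"
proof -
  interpret S: group "G\<lparr>carrier := Z\<rparr>" by (rule subgroup_imp_group [OF subgroup_Z])
  have "comm_group (G\<lparr>carrier := Z\<rparr>)"
    by (rule S.group_comm_groupI) (auto intro: m_comm Z_closed)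
  then show ?thesis
    by (rule comm_group.abelian_FactGroup) (rule subgroup_incl [OF subgroup_B subgroup_Z B_subset])
qed

lemma carrier_subquotient: "carrier (G\<lparr>carrier := Z\<rparr> Mod B) = (\<lambda>z. B #> z) ` Z"
  by (simp add: carrier_FactGroup)

lemma coset_in_subquotient: "z \<in> Z \<Longrightarrow> B #> z \<in> carrier (G\<lparr>carrier := Z\<rparr> Mod B)"
  by (simp add: carrier_subquotient)

lemma mult_subquotient:
  "z \<in> Z \<Longrightarrow> w \<in> Z \<Longrightarrow> (B #> z) \<otimes>\<^bsub>G\<lparr>carrier := Z\<rparr> Mod B\<^esub> (B #> w) = B #> (z \<otimes> w)"
  by (simp add: normal.rcos_sum [OF normal_B] Z_closed)

text \<open>The form in which a homotopy is used: representatives differing by a boundary have the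
  same class.\<close>

lemma coset_mult_absorb: "b \<in> B \<Longrightarrow> z \<in> carrier G \<Longrightarrow> B #> (b \<otimes> z) = B #> z"
  using coset_mult_assoc [of B b z] subgroup.rcos_const [OF subgroup_B is_group, of b]
    subgroup.subset [OF subgroup_B] by auto

end

locale subquotient_hom = src: subquotient G Z B + tgt: subquotient H Z' B'
  for G (structure) and Z B and H (structure) and Z' B' +
  fixes h
  assumes hom_h: "h \<in> hom G H" and h_Z: "h ` Z \<subseteq> Z'" and h_B: "h ` B \<subseteq> B'"
begin

lemma coset_map_coset: "z \<in> Z \<Longrightarrow> coset_map H B' h (B #>\<^bsub>G\<^esub> z) = B' #>\<^bsub>H\<^esub> h z"
proof -
  assume z: "z \<in> Z"
  have B: "b \<in> carrier G" if "b \<in> B" for b using that src.Z_closed src.B_subset by blast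
  \<comment> \<open>All representatives yield one coset, so the union in \<open>coset_map\<close>
    collapses to it.\<close>
  have eq: "B' #>\<^bsub>H\<^esub> h w = B' #>\<^bsub>H\<^esub> h z" if w: "w \<in> B #>\<^bsub>G\<^esub> z" for w
  proof -
    obtain b where b: "b \<in> B" "w = b \<otimes>\<^bsub>G\<^esub> z" using w by (auto simp: r_coset_def)
    have "h w = h b \<otimes>\<^bsub>H\<^esub> h z" unfolding b(2) using B [OF b(1)] src.Z_closed [OF z] by (rule hom_mult [OF hom_h])
    moreover have "h z \<in> carrier H" using h_Z z tgt.Z_closed by blast
    ultimately show ?thesis using tgt.coset_mult_absorb h_B b(1) by auto
  qed
  have "z \<in> B #>\<^bsub>G\<^esub> z" using src.rcos_self [OF src.Z_closed [OF z] src.subgroup_B] .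
  then show ?thesis unfolding coset_map_def using eq by blast
qed

lemma coset_map_closed:
  "S \<in> carrier (G\<lparr>carrier := Z\<rparr> Mod B) \<Longrightarrow> coset_map H B' h S \<in> carrier (H\<lparr>carrier := Z'\<rparr> Mod B')"
  using h_Z by (auto simp: src.carrier_subquotient tgt.carrier_subquotient coset_map_coset)

lemma coset_map_hom:
  "(\<lambda>S\<in>carrier (G\<lparr>carrier := Z\<rparr> Mod B). coset_map H B' h S)
     \<in> hom (G\<lparr>carrier := Z\<rparr> Mod B) (H\<lparr>carrier := Z'\<rparr> Mod B')"
proof -
  show ?thesis
  proof (rule homI)
    fix S T assume ST: "S \<in> carrier (G\<lparr>carrier := Z\<rparr> Mod B)" "T \<in> carrier (G\<lparr>carrier := Z\<rparr> Mod B)"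
    then obtain z w where zw: "z \<in> Z" "w \<in> Z" and S: "S = B #>\<^bsub>G\<^esub> z" and T: "T = B #>\<^bsub>G\<^esub> w"
      by (auto simp: src.carrier_subquotient)
    have "h z \<in> Z'" "h w \<in> Z'" "z \<otimes>\<^bsub>G\<^esub> w \<in> Z"
      using h_Z zw subgroup.m_closed [OF src.subgroup_Z] by auto
    moreover have "h (z \<otimes>\<^bsub>G\<^esub> w) = h z \<otimes>\<^bsub>H\<^esub> h w"
      using hom_mult [OF hom_h] zw src.Z_closed by blast
    ultimately show "(\<lambda>S\<in>carrier (G\<lparr>carrier := Z\<rparr> Mod B). coset_map H B' h S) (S \<otimes>\<^bsub>G\<lparr>carrier := Z\<rparr> Mod B\<^esub> T)
      = (\<lambda>S\<in>carrier (G\<lparr>carrier := Z\<rparr> Mod B). coset_map H B' h S) S \<otimes>\<^bsub>H\<lparr>carrier := Z'\<rparr> Mod B'\<^esub>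
        (\<lambda>S\<in>carrier (G\<lparr>carrier := Z\<rparr> Mod B). coset_map H B' h S) T"
      unfolding S T
      by (simp only: src.mult_subquotient zw restrict_apply' src.coset_in_subquotient
          coset_map_coset tgt.mult_subquotient)
  qed (simp add: coset_map_closed)
qed

end

lemma subgroup_preimage:
  assumes "group G" "group H" and h: "h \<in> hom G H" and M: "subgroup M H"
  shows "subgroup {x \<in> carrier G. h x \<in> M} G"
proof -
  interpret group_hom G H h using assms by (simp add: group_hom_def group_hom_axioms_def)
  show ?thesis
    by (rule G.subgroupI)
      (use subgroup.one_closed [OF M] subgroup.m_closed [OF M] subgroup.m_inv_closed [OF M] in auto)
qed

context comm_group
begin

lemma relcycles_eq:
  "simplicial_relcycles G n K L = {c \<in> carrier (simplicial_chain_group G K n).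
     simplicial_boundary G n c \<in> carrier (simplicial_chain_group G L (n - 1))}"
  by (simp add: simplicial_relcycles_def)

text \<open>A product of two subgroups, hence itself a subgroup, the ambient group being
  abelian.\<close>

lemma relboundaries_eq:
  "simplicial_relboundaries G n K L =
     (simplicial_boundary G (Suc n) ` carrier (simplicial_chain_group G K (Suc n)))
       <#>\<^bsub>simplicial_chain_group G K n\<^esub> carrier (simplicial_chain_group G L n)"
  by (auto simp: simplicial_relboundaries_def set_mult_def)

lemma subquotient_homology:
  assumes KL: "complex_pair (K, L)"
  shows "subquotient (simplicial_chain_group G K n) (simplicial_relcycles G n K L) (simplicial_relboundaries G n K L)"
proof -
  have K: "simplicial_complex K" and L: "simplicial_complex L" and LK: "L \<subseteq> K"
    using KL by (simp_all add: complex_pair_def)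
  interpret C: comm_group "simplicial_chain_group G K n" by (rule comm_group_chain_group)
  interpret C': comm_group "simplicial_chain_group G K (n - 1)" by (rule comm_group_chain_group)
  interpret C'': comm_group "simplicial_chain_group G K (Suc n)" by (rule comm_group_chain_group)
  show ?thesis
  proof (intro subquotient.intro subquotient_axioms.intro comm_group_chain_group)
    show "subgroup (simplicial_relcycles G n K L) (simplicial_chain_group G K n)"
      unfolding relcycles_eq
      by (rule subgroup_preimage [OF C.is_group C'.is_group boundary_hom [OF K] subgroup_chain_group [OF LK]])
    have "group_hom (simplicial_chain_group G K (Suc n)) (simplicial_chain_group G K n) (simplicial_boundary G (Suc n))"
      using boundary_hom [OF K, of "Suc n"]
      by (simp add: group_hom_def group_hom_axioms_def C.is_group C''.is_group)
    then show "subgroup (simplicial_relboundaries G n K L) (simplicial_chain_group G K n)"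
      unfolding relboundaries_eq
      by (intro C.mult_subgroups subgroup_chain_group [OF LK] group_hom.img_is_subgroup)
    show "simplicial_relboundaries G n K L \<subseteq> simplicial_relcycles G n K L"
    proof
      fix c assume "c \<in> simplicial_relboundaries G n K L"
      then obtain d e where d: "d \<in> carrier (simplicial_chain_group G K (Suc n))"
        and e: "e \<in> carrier (simplicial_chain_group G L n)"
        and c: "c = (\<lambda>vs. simplicial_boundary G (Suc n) d vs \<otimes> e vs)"
        by (auto simp: simplicial_relboundaries_def)
      have e': "e \<in> carrier (simplicial_chain_group G K n)" using e chain_group_mono [OF LK] by blast
      have bd: "simplicial_boundary G (Suc n) d \<in> carrier (simplicial_chain_group G K n)"
        using boundary_in_chain_group [OF K d] by simp
      have be: "simplicial_boundary G n e \<in> carrier (simplicial_chain_group G L (n - 1))"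
        by (rule boundary_in_chain_group [OF L e])
      \<comment> \<open>The term from \<open>d\<close> drops out because the boundary squares to
        zero; the rest lies in the subcomplex.\<close>
      have "simplicial_boundary G n c = simplicial_boundary G n e"
        unfolding c boundary_mult [OF bd e'] boundary_boundary [OF d] using chain_closed [OF be] by simp
      then show "c \<in> simplicial_relcycles G n K L"
        using be mult_in_chain_group [OF bd e'] by (simp add: relcycles_eq c)
    qed
  qed
qed

section \<open>Induced maps in homology\<close>

lemma simplicial_homology_eq:
  "simplicial_homology G n KL = (simplicial_chain_group G (fst KL) n)
     \<lparr>carrier := simplicial_relcycles G n (fst KL) (snd KL)\<rparr> Mod simplicial_relboundaries G n (fst KL) (snd KL)"
  by (simp add: simplicial_homology_def split_beta)

lemma subquotient_hom_homology:
  assumes KL: "complex_pair KL" and KL': "complex_pair KL'" and p: "simplicial_map KL KL' p"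
  shows "subquotient_hom (simplicial_chain_group G (fst KL) n)
      (simplicial_relcycles G n (fst KL) (snd KL)) (simplicial_relboundaries G n (fst KL) (snd KL))
      (simplicial_chain_group G (fst KL') n)
      (simplicial_relcycles G n (fst KL') (snd KL')) (simplicial_relboundaries G n (fst KL') (snd KL'))
      (simplicial_chain_map G p)"
proof -
  have pK: "\<forall>s\<in>fst KL. p ` s \<in> fst KL'" and pL: "\<forall>s\<in>snd KL. p ` s \<in> snd KL'"
    using p by (simp_all add: simplicial_map_def)
  have K: "simplicial_complex (fst KL)" using KL by (simp add: complex_pair_def)
  have LK: "snd KL \<subseteq> fst KL" using KL by (simp add: complex_pair_def)
  have "subquotient (simplicial_chain_group G (fst KL) n)
      (simplicial_relcycles G n (fst KL) (snd KL)) (simplicial_relboundaries G n (fst KL) (snd KL))"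
    "subquotient (simplicial_chain_group G (fst KL') n)
      (simplicial_relcycles G n (fst KL') (snd KL')) (simplicial_relboundaries G n (fst KL') (snd KL'))"
    using KL KL' by (auto intro: subquotient_homology)
  moreover have "simplicial_chain_map G p ` simplicial_relcycles G n (fst KL) (snd KL)
      \<subseteq> simplicial_relcycles G n (fst KL') (snd KL')"
    using chain_map_in_chain_group [OF pK] chain_map_in_chain_group [OF pL]
    by (auto simp: relcycles_eq chain_map_boundary [OF K])
  moreover have "simplicial_chain_map G p ` simplicial_relboundaries G n (fst KL) (snd KL)
      \<subseteq> simplicial_relboundaries G n (fst KL') (snd KL')"
  proof
    fix c' assume "c' \<in> simplicial_chain_map G p ` simplicial_relboundaries G n (fst KL) (snd KL)"
    then obtain d e where d: "d \<in> carrier (simplicial_chain_group G (fst KL) (Suc n))"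
      and e: "e \<in> carrier (simplicial_chain_group G (snd KL) n)"
      and c': "c' = simplicial_chain_map G p (\<lambda>vs. simplicial_boundary G (Suc n) d vs \<otimes> e vs)"
      by (auto simp: simplicial_relboundaries_def)
    have e': "e \<in> carrier (simplicial_chain_group G (fst KL) n)" using e chain_group_mono [OF LK] by blast
    have bd: "simplicial_boundary G (Suc n) d \<in> carrier (simplicial_chain_group G (fst KL) n)"
      using boundary_in_chain_group [OF K d] by simp
    have "c' = (\<lambda>vs. simplicial_boundary G (Suc n) (simplicial_chain_map G p d) vs \<otimes> simplicial_chain_map G p e vs)"
      unfolding c' chain_map_mult [OF bd e'] by (simp add: chain_map_boundary [OF K d])
    then show "c' \<in> simplicial_relboundaries G n (fst KL') (snd KL')"
      using chain_map_in_chain_group [OF pK d] chain_map_in_chain_group [OF pL e]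
      by (auto simp: simplicial_relboundaries_def)
  qed
  ultimately show ?thesis
    by (simp add: subquotient_hom_def subquotient_hom_axioms_def chain_map_hom [OF pK])
qed

lemma comm_group_homology: "complex_pair KL \<Longrightarrow> comm_group (simplicial_homology G n KL)"
  unfolding simplicial_homology_eq by (rule subquotient.comm_group_subquotient [OF subquotient_homology]) simp

lemma homology_map_hom:
  assumes "complex_pair KL" "complex_pair KL'" "simplicial_map KL KL' p"
  shows "simplicial_homology_map G n KL KL' p \<in> hom (simplicial_homology G n KL) (simplicial_homology G n KL')"
  unfolding simplicial_homology_map_def simplicial_homology_eq
  by (rule subquotient_hom.coset_map_hom [OF subquotient_hom_homology [OF assms]])

lemma homology_carrierE:
  assumes "S \<in> carrier (simplicial_homology G n KL)"
  obtains z where "z \<in> simplicial_relcycles G n (fst KL) (snd KL)"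
    "S = simplicial_relboundaries G n (fst KL) (snd KL) #>\<^bsub>simplicial_chain_group G (fst KL) n\<^esub> z"
  using assms unfolding simplicial_homology_eq carrier_FactGroup by auto

lemma homology_map_coset:
  assumes "complex_pair KL" "complex_pair KL'" "simplicial_map KL KL' p"
    and z: "z \<in> simplicial_relcycles G n (fst KL) (snd KL)"
  shows "simplicial_homology_map G n KL KL' p
      (simplicial_relboundaries G n (fst KL) (snd KL) #>\<^bsub>simplicial_chain_group G (fst KL) n\<^esub> z)
    = simplicial_relboundaries G n (fst KL') (snd KL') #>\<^bsub>simplicial_chain_group G (fst KL') n\<^esub> simplicial_chain_map G p z"
proof -
  interpret subquotient_hom "simplicial_chain_group G (fst KL) n"
      "simplicial_relcycles G n (fst KL) (snd KL)" "simplicial_relboundaries G n (fst KL) (snd KL)"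
      "simplicial_chain_group G (fst KL') n"
      "simplicial_relcycles G n (fst KL') (snd KL')" "simplicial_relboundaries G n (fst KL') (snd KL')"
      "simplicial_chain_map G p"
    by (rule subquotient_hom_homology [OF assms(1-3)])
  show ?thesis
    unfolding simplicial_homology_map_def simplicial_homology_eq
    by (simp only: restrict_apply' src.coset_in_subquotient coset_map_coset z)
qed

lemma homology_map_compose:
  assumes KL: "complex_pair KL" and KL': "complex_pair KL'" and KL'': "complex_pair KL''"
    and p: "simplicial_map KL KL' p" and q: "simplicial_map KL' KL'' q"
    and S: "S \<in> carrier (simplicial_homology G n KL)"
  shows "simplicial_homology_map G n KL' KL'' q (simplicial_homology_map G n KL KL' p S)
       = simplicial_homology_map G n KL KL'' (\<lambda>v. q (p v)) S"
proof -
  obtain z where z: "z \<in> simplicial_relcycles G n (fst KL) (snd KL)"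
    and S: "S = simplicial_relboundaries G n (fst KL) (snd KL) #>\<^bsub>simplicial_chain_group G (fst KL) n\<^esub> z"
    using S by (rule homology_carrierE)
  have qp: "simplicial_map KL KL'' (\<lambda>v. q (p v))"
    using p q by (auto simp: simplicial_map_def image_image [symmetric, of q p])
  have pz: "simplicial_chain_map G p z \<in> simplicial_relcycles G n (fst KL') (snd KL')"
    using subquotient_hom.h_Z [OF subquotient_hom_homology [OF KL KL' p]] z by blast
  have "simplicial_chain_map G q (simplicial_chain_map G p z) = simplicial_chain_map G (\<lambda>v. q (p v)) z"
    by (rule chain_map_compose [of "fst KL" p "fst KL'"]) (use p z in \<open>auto simp: simplicial_map_def relcycles_eq\<close>)
  then show ?thesis
    unfolding S homology_map_coset [OF KL KL' p z] homology_map_coset [OF KL' KL'' q pz]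
      homology_map_coset [OF KL KL'' qp z] by simp
qed

lemma homology_map_ident:
  assumes KL: "complex_pair KL" and S: "S \<in> carrier (simplicial_homology G n KL)"
  shows "simplicial_homology_map G n KL KL (\<lambda>v. v) S = S"
proof -
  obtain z where z: "z \<in> simplicial_relcycles G n (fst KL) (snd KL)"
    and S: "S = simplicial_relboundaries G n (fst KL) (snd KL) #>\<^bsub>simplicial_chain_group G (fst KL) n\<^esub> z"
    using S by (rule homology_carrierE)
  have id: "simplicial_map KL KL (\<lambda>v. v)" by (simp add: simplicial_map_def)
  have "simplicial_chain_map G (\<lambda>v. v) z = z"
    using z by (auto simp: relcycles_eq intro: chain_map_ident)
  then show ?thesis unfolding S homology_map_coset [OF KL KL id z] by simp
qed

text \<open>For a relative cycle z the homotopy gives q z = d(D z) + D(d z) + p z with d z in the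
  subcomplex, and D respects subcomplexes; so the two images differ by a relative boundary.\<close>

lemma homology_map_contiguous:
  assumes KL: "complex_pair KL" and KL': "complex_pair KL'" and fin: "finite (\<Union>(fst KL))"
    and p: "simplicial_map KL KL' p" and q: "simplicial_map KL KL' q" and con: "contiguous KL KL' p q"
  shows "simplicial_homology_map G n KL KL' p = simplicial_homology_map G n KL KL' q"
proof
  fix S
  show "simplicial_homology_map G n KL KL' p S = simplicial_homology_map G n KL KL' q S"
  proof (cases "S \<in> carrier (simplicial_homology G n KL)")
    case True
    then obtain z where z: "z \<in> simplicial_relcycles G n (fst KL) (snd KL)"
      and S: "S = simplicial_relboundaries G n (fst KL) (snd KL) #>\<^bsub>simplicial_chain_group G (fst KL) n\<^esub> z"
      by (rule homology_carrierE)
    obtain D where D: "chain_homotopy G KL KL' p q D"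
      using contiguous_chain_homotopy [OF KL KL' fin con] by blast
    have zc: "z \<in> carrier (simplicial_chain_group G (fst KL) n)"
      and bz: "simplicial_boundary G n z \<in> carrier (simplicial_chain_group G (snd KL) (n - 1))"
      using z by (simp_all add: relcycles_eq)
    have pz: "simplicial_chain_map G p z \<in> carrier (simplicial_chain_group G (fst KL') n)"
      by (rule chain_map_in_chain_group [OF _ zc]) (use p in \<open>simp add: simplicial_map_def\<close>)
    have Dh: "D \<in> hom (simplicial_chain_group G (fst KL) n) (simplicial_chain_group G (fst KL') (Suc n))"
      using D unfolding chain_homotopy_def by blast
    have Dz: "D z \<in> carrier (simplicial_chain_group G (fst KL') (Suc n))"
      by (rule hom_in_carrier [OF Dh zc])
    \<comment> \<open>For \<open>n = 0\<close> the truncated \<open>n - 1\<close> would put the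
      image under \<open>D\<close> in degree 1 instead of 0; but the boundary is then trivial, and
      its image, the unit, is a chain in every degree.\<close>
    have Db: "D (simplicial_boundary G n z) \<in> carrier (simplicial_chain_group G (snd KL') n)"
    proof (cases "n = 0")
      case True
      interpret C: group_hom "simplicial_chain_group G (fst KL) 0" "simplicial_chain_group G (fst KL') (Suc 0)" D
        using Dh True
        by (simp add: group_hom_def group_hom_axioms_def comm_group.axioms(2) [OF comm_group_chain_group])
      have "D (\<lambda>vs. \<one>) = (\<lambda>vs. \<one>)" using C.hom_one by simp
      then show ?thesis using True by (simp add: one_in_chain_group)
    next
      case False
      have "D ` carrier (simplicial_chain_group G (snd KL) (n - 1)) \<subseteq> carrier (simplicial_chain_group G (snd KL') (Suc (n - 1)))"
        using D unfolding chain_homotopy_def by blast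
      then show ?thesis using bz False by auto
    qed
    let ?b = "\<lambda>vs. simplicial_boundary G (Suc n) (D z) vs \<otimes> D (simplicial_boundary G n z) vs"
    have b: "?b \<in> simplicial_relboundaries G n (fst KL') (snd KL')"
      using Dz Db by (auto simp: simplicial_relboundaries_def)
    interpret Q: subquotient "simplicial_chain_group G (fst KL') n"
      "simplicial_relcycles G n (fst KL') (snd KL')" "simplicial_relboundaries G n (fst KL') (snd KL')"
      using KL' by (auto intro: subquotient_homology)
    have bc: "?b vs \<in> carrier G" for vs
      using Q.Z_closed [OF subsetD [OF Q.B_subset b]] by (rule chain_closed)
    have "simplicial_chain_map G q z = ?b \<otimes>\<^bsub>simplicial_chain_group G (fst KL') n\<^esub> simplicial_chain_map G p z"
      using D zc bc chain_closed [OF pz] by (auto simp: chain_homotopy_def fun_eq_iff m_comm)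
    then show ?thesis
      unfolding S homology_map_coset [OF KL KL' p z] homology_map_coset [OF KL KL' q z]
      using Q.coset_mult_absorb [OF b pz] by simp
  next
    case False
    then show ?thesis by (simp add: simplicial_homology_map_def)
  qed
qed

end

section \<open>Simplicial cohomology\<close>

text \<open>Cochains live on integral chains whatever the coefficients, so boundaries, chain maps
  and homotopies are reused with \<open>integer_group\<close> in place of \<open>G\<close>.\<close>

interpretation int_chain: comm_group integer_group
  by (rule abelian_integer_group)

abbreviation (input) int_chains :: "'v set set \<Rightarrow> nat \<Rightarrow> ('v list \<Rightarrow> int) monoid" where
  "int_chains \<equiv> simplicial_chain_group integer_group"

context comm_group
begin

section \<open>Cochain groups and the coboundary\<close>

lemma mem_cochain_group:
  "\<phi> \<in> carrier (simplicial_cochain_group G n K L) \<longleftrightarrow>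
     \<phi> \<in> hom (int_chains K n) G \<and> \<phi> \<in> extensional (carrier (int_chains K n)) \<and>
     (\<forall>c\<in>carrier (int_chains L n). \<phi> c = \<one>)"
  by (auto simp: simplicial_cochain_group_def Let_def)

lemma mult_cochain_group [simp]:
  "\<phi> \<otimes>\<^bsub>simplicial_cochain_group G n K L\<^esub> \<psi> = (\<lambda>c\<in>carrier (int_chains K n). \<phi> c \<otimes> \<psi> c)"
  by (simp add: simplicial_cochain_group_def Let_def)

lemma one_cochain_group [simp]:
  "\<one>\<^bsub>simplicial_cochain_group G n K L\<^esub> = (\<lambda>c\<in>carrier (int_chains K n). \<one>)"
  by (simp add: simplicial_cochain_group_def Let_def)

lemma cochain_hom: "\<phi> \<in> carrier (simplicial_cochain_group G n K L) \<Longrightarrow> \<phi> \<in> hom (int_chains K n) G"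
  by (simp add: mem_cochain_group)

lemma cochain_closed:
  "\<phi> \<in> carrier (simplicial_cochain_group G n K L) \<Longrightarrow> c \<in> carrier (int_chains K n) \<Longrightarrow> \<phi> c \<in> carrier G"
  by (erule hom_in_carrier [OF cochain_hom])

text \<open>Evaluates cochains on the zero chain, which is what a double boundary and the trivial
  boundary in degree 0 produce.\<close>

lemma cochain_one:
  assumes "\<phi> \<in> carrier (simplicial_cochain_group G n K L)"
  shows "\<phi> (\<lambda>vs. 0) = \<one>"
proof -
  interpret \<phi>: group_hom "int_chains K n" G \<phi>
    using cochain_hom [OF assms]
    by (simp add: group_hom_def group_hom_axioms_def comm_group.axioms(2) [OF int_chain.comm_group_chain_group])
  show ?thesis using \<phi>.hom_one by simp
qed

text \<open>Cochains are extensional, so each construction on them is a restriction to the chains of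
  \<open>K\<close>; this one criterion serves for products, inverses, coboundaries and induced
  maps.\<close>

lemma restrict_in_cochain_group:
  assumes f: "f \<in> hom (int_chains K n) G" and L: "\<And>c. c \<in> carrier (int_chains L n) \<Longrightarrow> f c = \<one>" and LK: "L \<subseteq> K"
  shows "(\<lambda>c\<in>carrier (int_chains K n). f c) \<in> carrier (simplicial_cochain_group G n K L)"
proof -
  interpret C: comm_group "int_chains K n" by (rule int_chain.comm_group_chain_group)
  have "(\<lambda>c\<in>carrier (int_chains K n). f c) \<in> hom (int_chains K n) G"
    using f C.m_closed by (auto simp: hom_def Pi_iff simp del: int_chain.mult_chain_group)
  then show ?thesis
    using L int_chain.chain_group_mono [OF LK, of n] by (auto simp: mem_cochain_group)
qed

lemma mult_in_cochain_group:
  assumes LK: "L \<subseteq> K" and \<phi>: "\<phi> \<in> carrier (simplicial_cochain_group G n K L)" and \<psi>: "\<psi> \<in> carrier (simplicial_cochain_group G n K L)"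
  shows "(\<lambda>c\<in>carrier (int_chains K n). \<phi> c \<otimes> \<psi> c) \<in> carrier (simplicial_cochain_group G n K L)"
proof (rule restrict_in_cochain_group [OF _ _ LK])
  show "(\<lambda>c. \<phi> c \<otimes> \<psi> c) \<in> hom (int_chains K n) G"
    using cochain_hom [OF \<phi>] cochain_hom [OF \<psi>]
    by (auto simp: hom_def Pi_iff m_ac simp del: int_chain.mult_chain_group)
qed (use \<phi> \<psi> in \<open>simp add: mem_cochain_group\<close>)

lemma one_in_cochain_group:
  "L \<subseteq> K \<Longrightarrow> (\<lambda>c\<in>carrier (int_chains K n). \<one>) \<in> carrier (simplicial_cochain_group G n K L)"
  by (rule restrict_in_cochain_group) (auto simp: hom_def)

lemma inv_in_cochain_group:
  assumes LK: "L \<subseteq> K" and \<phi>: "\<phi> \<in> carrier (simplicial_cochain_group G n K L)"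
  shows "(\<lambda>c\<in>carrier (int_chains K n). inv (\<phi> c)) \<in> carrier (simplicial_cochain_group G n K L)"
proof (rule restrict_in_cochain_group [OF _ _ LK])
  show "(\<lambda>c. inv (\<phi> c)) \<in> hom (int_chains K n) G"
    using cochain_hom [OF \<phi>]
    by (auto simp: hom_def Pi_iff inv_mult simp del: int_chain.mult_chain_group)
qed (use \<phi> in \<open>simp add: mem_cochain_group\<close>)

lemma comm_group_cochain_group:
  assumes LK: "L \<subseteq> K"
  shows "comm_group (simplicial_cochain_group G n K L)"
proof (rule comm_groupI)
  fix \<phi> assume \<phi>: "\<phi> \<in> carrier (simplicial_cochain_group G n K L)"
  show "\<exists>\<psi>\<in>carrier (simplicial_cochain_group G n K L). \<psi> \<otimes>\<^bsub>simplicial_cochain_group G n K L\<^esub> \<phi> = \<one>\<^bsub>simplicial_cochain_group G n K L\<^esub>"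
    by (rule bexI [OF _ inv_in_cochain_group [OF LK \<phi>]]) (auto simp: fun_eq_iff cochain_closed [OF \<phi>])
  show "\<one>\<^bsub>simplicial_cochain_group G n K L\<^esub> \<otimes>\<^bsub>simplicial_cochain_group G n K L\<^esub> \<phi> = \<phi>"
    using \<phi> by (auto simp: mem_cochain_group cochain_closed [OF \<phi>] intro!: extensionalityI [of _ "carrier (int_chains K n)"])
qed (auto simp: mult_in_cochain_group [OF LK] one_in_cochain_group [OF LK] fun_eq_iff cochain_closed m_ac)

text \<open>Covers \<open>n = 0\<close> as well: there the boundary is the trivial map into degree
  \<open>0 - 1 = 0\<close>, and the coboundary is the trivial cochain.\<close>

lemma coboundary_in_cochain_group:
  assumes KL: "complex_pair (K, L)" and \<phi>: "\<phi> \<in> carrier (simplicial_cochain_group G (n - 1) K L)"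
  shows "simplicial_coboundary n K \<phi> \<in> carrier (simplicial_cochain_group G n K L)"
  unfolding simplicial_coboundary_def
proof (rule restrict_in_cochain_group)
  have K: "simplicial_complex K" and L: "simplicial_complex L" using KL by (simp_all add: complex_pair_def)
  show "L \<subseteq> K" using KL by (simp add: complex_pair_def)
  have "\<phi> \<circ> simplicial_boundary integer_group n \<in> hom (int_chains K n) G"
    by (rule Group.hom_compose [OF int_chain.boundary_hom [OF K] cochain_hom [OF \<phi>]])
  then show "(\<lambda>c. \<phi> (simplicial_boundary integer_group n c)) \<in> hom (int_chains K n) G"
    by (simp add: comp_def)
  show "\<phi> (simplicial_boundary integer_group n c) = \<one>" if "c \<in> carrier (int_chains L n)" for c
    using int_chain.boundary_in_chain_group [OF L that] \<phi> by (simp add: mem_cochain_group)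
qed

lemma coboundary_hom:
  assumes KL: "complex_pair (K, L)"
  shows "simplicial_coboundary n K \<in> hom (simplicial_cochain_group G (n - 1) K L) (simplicial_cochain_group G n K L)"
proof (rule homI)
  have K: "simplicial_complex K" using KL by (simp add: complex_pair_def)
  fix \<phi> \<psi> assume "\<phi> \<in> carrier (simplicial_cochain_group G (n - 1) K L)" "\<psi> \<in> carrier (simplicial_cochain_group G (n - 1) K L)"
  then show "simplicial_coboundary n K (\<phi> \<otimes>\<^bsub>simplicial_cochain_group G (n - 1) K L\<^esub> \<psi>)
     = simplicial_coboundary n K \<phi> \<otimes>\<^bsub>simplicial_cochain_group G n K L\<^esub> simplicial_coboundary n K \<psi>"
    using int_chain.boundary_in_chain_group [OF K]
    by (auto simp: simplicial_coboundary_def fun_eq_iff)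
qed (use coboundary_in_cochain_group [OF KL] in simp)

lemma coboundary_coboundary:
  assumes KL: "complex_pair (K, L)" and \<phi>: "\<phi> \<in> carrier (simplicial_cochain_group G (n - 1) K L)"
  shows "simplicial_coboundary (Suc n) K (simplicial_coboundary n K \<phi>) = \<one>\<^bsub>simplicial_cochain_group G (Suc n) K L\<^esub>"
proof -
  have K: "simplicial_complex K" using KL by (simp add: complex_pair_def)
  show ?thesis
    using int_chain.boundary_in_chain_group [OF K, of _ "Suc n"] cochain_one [OF \<phi>]
    by (simp add: simplicial_coboundary_def int_chain.boundary_boundary cong: restrict_cong)
qed

lemma subquotient_cohomology:
  assumes KL: "complex_pair (K, L)"
  shows "subquotient (simplicial_cochain_group G n K L) (simplicial_cocycles G n K L) (simplicial_coboundaries G n K L)"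
proof -
  have LK: "L \<subseteq> K" using KL by (simp add: complex_pair_def)
  have gr: "group (simplicial_cochain_group G n K L)" for n
    by (rule comm_group.axioms(2) [OF comm_group_cochain_group [OF LK]])
  show ?thesis
  proof (intro subquotient.intro subquotient_axioms.intro comm_group_cochain_group LK)
    have "simplicial_cocycles G n K L = {\<phi> \<in> carrier (simplicial_cochain_group G n K L).
        simplicial_coboundary (Suc n) K \<phi> \<in> {\<one>\<^bsub>simplicial_cochain_group G (Suc n) K L\<^esub>}}"
      by (simp add: simplicial_cocycles_def)
    also have "subgroup \<dots> (simplicial_cochain_group G n K L)"
      by (rule subgroup_preimage [OF gr gr _ group.triv_subgroup [OF gr]])
        (use coboundary_hom [OF KL, of "Suc n"] in simp)
    finally show "subgroup (simplicial_cocycles G n K L) (simplicial_cochain_group G n K L)" .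
    have "group_hom (simplicial_cochain_group G (n - 1) K L) (simplicial_cochain_group G n K L) (simplicial_coboundary n K)"
      using coboundary_hom [OF KL] by (simp add: group_hom_def group_hom_axioms_def gr)
    then show "subgroup (simplicial_coboundaries G n K L) (simplicial_cochain_group G n K L)"
      unfolding simplicial_coboundaries_def by (rule group_hom.img_is_subgroup)
    show "simplicial_coboundaries G n K L \<subseteq> simplicial_cocycles G n K L"
      unfolding simplicial_coboundaries_def simplicial_cocycles_def
      using coboundary_in_cochain_group [OF KL] coboundary_coboundary [OF KL] by blast
  qed
qed

section \<open>Induced maps in cohomology\<close>

lemma simplicial_cohomology_eq:
  "simplicial_cohomology G n KL = (simplicial_cochain_group G n (fst KL) (snd KL))
     \<lparr>carrier := simplicial_cocycles G n (fst KL) (snd KL)\<rparr> Mod simplicial_coboundaries G n (fst KL) (snd KL)"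
  by (simp add: simplicial_cohomology_def split_beta)

lemma cochain_map_in_cochain_group:
  assumes KL: "complex_pair KL" and p: "simplicial_map KL KL' p"
    and \<phi>: "\<phi> \<in> carrier (simplicial_cochain_group G n (fst KL') (snd KL'))"
  shows "simplicial_cochain_map n (fst KL) p \<phi> \<in> carrier (simplicial_cochain_group G n (fst KL) (snd KL))"
  unfolding simplicial_cochain_map_def
proof (rule restrict_in_cochain_group)
  have pK: "\<forall>s\<in>fst KL. p ` s \<in> fst KL'" and pL: "\<forall>s\<in>snd KL. p ` s \<in> snd KL'"
    using p by (simp_all add: simplicial_map_def)
  show "snd KL \<subseteq> fst KL" using KL by (simp add: complex_pair_def)
  have "\<phi> \<circ> simplicial_chain_map integer_group p \<in> hom (int_chains (fst KL) n) G"
    by (rule Group.hom_compose [OF int_chain.chain_map_hom [OF pK] cochain_hom [OF \<phi>]])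
  then show "(\<lambda>c. \<phi> (simplicial_chain_map integer_group p c)) \<in> hom (int_chains (fst KL) n) G"
    by (simp add: comp_def)
  show "\<phi> (simplicial_chain_map integer_group p c) = \<one>" if "c \<in> carrier (int_chains (snd KL) n)" for c
    using int_chain.chain_map_in_chain_group [OF pL that] \<phi> by (simp add: mem_cochain_group)
qed

lemma cochain_map_coboundary:
  assumes KL: "complex_pair KL" and p: "simplicial_map KL KL' p"
  shows "simplicial_coboundary n (fst KL) (simplicial_cochain_map (n - 1) (fst KL) p \<phi>)
       = simplicial_cochain_map n (fst KL) p (simplicial_coboundary n (fst KL') \<phi>)"
proof -
  have K: "simplicial_complex (fst KL)" using KL by (simp add: complex_pair_def)
  have pK: "\<forall>s\<in>fst KL. p ` s \<in> fst KL'" using p by (simp add: simplicial_map_def)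
  show ?thesis
    using int_chain.boundary_in_chain_group [OF K] int_chain.chain_map_in_chain_group [OF pK]
    by (auto simp: simplicial_coboundary_def simplicial_cochain_map_def fun_eq_iff int_chain.chain_map_boundary [OF K])
qed

lemma subquotient_hom_cohomology:
  assumes KL: "complex_pair KL" and KL': "complex_pair KL'" and p: "simplicial_map KL KL' p"
  shows "subquotient_hom
      (simplicial_cochain_group G n (fst KL') (snd KL'))
      (simplicial_cocycles G n (fst KL') (snd KL')) (simplicial_coboundaries G n (fst KL') (snd KL'))
      (simplicial_cochain_group G n (fst KL) (snd KL))
      (simplicial_cocycles G n (fst KL) (snd KL)) (simplicial_coboundaries G n (fst KL) (snd KL))
      (simplicial_cochain_map n (fst KL) p)"
proof -
  have pK: "\<forall>s\<in>fst KL. p ` s \<in> fst KL'" using p by (simp add: simplicial_map_def)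
  have "simplicial_cochain_map n (fst KL) p
     \<in> hom (simplicial_cochain_group G n (fst KL') (snd KL')) (simplicial_cochain_group G n (fst KL) (snd KL))"
    by (rule homI)
      (use int_chain.chain_map_in_chain_group [OF pK] cochain_map_in_cochain_group [OF KL p] in
        \<open>auto simp: simplicial_cochain_map_def fun_eq_iff\<close>)
  moreover have "simplicial_cochain_map n (fst KL) p ` simplicial_cocycles G n (fst KL') (snd KL')
      \<subseteq> simplicial_cocycles G n (fst KL) (snd KL)"
  proof (rule image_subsetI)
    fix \<phi> assume "\<phi> \<in> simplicial_cocycles G n (fst KL') (snd KL')"
    then have \<phi>: "\<phi> \<in> carrier (simplicial_cochain_group G n (fst KL') (snd KL'))"
      and d: "simplicial_coboundary (Suc n) (fst KL') \<phi> = (\<lambda>c\<in>carrier (int_chains (fst KL') (Suc n)). \<one>)"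
      by (simp_all add: simplicial_cocycles_def)
    have "simplicial_coboundary (Suc n) (fst KL) (simplicial_cochain_map n (fst KL) p \<phi>)
        = simplicial_cochain_map (Suc n) (fst KL) p (\<lambda>c\<in>carrier (int_chains (fst KL') (Suc n)). \<one>)"
      using cochain_map_coboundary [OF KL p, of "Suc n" \<phi>] d by simp
    also have "\<dots> = (\<lambda>c\<in>carrier (int_chains (fst KL) (Suc n)). \<one>)"
      using int_chain.chain_map_in_chain_group [OF pK] by (auto simp: simplicial_cochain_map_def fun_eq_iff)
    finally show "simplicial_cochain_map n (fst KL) p \<phi> \<in> simplicial_cocycles G n (fst KL) (snd KL)"
      using cochain_map_in_cochain_group [OF KL p \<phi>] by (simp add: simplicial_cocycles_def)
  qed
  moreover have "simplicial_cochain_map n (fst KL) p ` simplicial_coboundaries G n (fst KL') (snd KL')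
      \<subseteq> simplicial_coboundaries G n (fst KL) (snd KL)"
    unfolding simplicial_coboundaries_def
  proof (intro image_subsetI, elim imageE, hypsubst)
    fix \<phi> assume "\<phi> \<in> carrier (simplicial_cochain_group G (n - 1) (fst KL') (snd KL'))"
    then show "simplicial_cochain_map n (fst KL) p (simplicial_coboundary n (fst KL') \<phi>)
        \<in> simplicial_coboundary n (fst KL) ` carrier (simplicial_cochain_group G (n - 1) (fst KL) (snd KL))"
      unfolding cochain_map_coboundary [OF KL p, symmetric] by (intro imageI cochain_map_in_cochain_group [OF KL p])
  qed
  ultimately show ?thesis
    using subquotient_cohomology [of "fst KL" "snd KL" n] subquotient_cohomology [of "fst KL'" "snd KL'" n] KL KL'
    by (simp add: subquotient_hom_def subquotient_hom_axioms_def)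
qed

lemma comm_group_cohomology: "complex_pair KL \<Longrightarrow> comm_group (simplicial_cohomology G n KL)"
  unfolding simplicial_cohomology_eq by (rule subquotient.comm_group_subquotient [OF subquotient_cohomology]) simp

lemma cohomology_map_hom:
  assumes "complex_pair KL" "complex_pair KL'" "simplicial_map KL KL' p"
  shows "simplicial_cohomology_map G n KL KL' p \<in> hom (simplicial_cohomology G n KL') (simplicial_cohomology G n KL)"
  unfolding simplicial_cohomology_map_def simplicial_cohomology_eq
  by (rule subquotient_hom.coset_map_hom [OF subquotient_hom_cohomology [OF assms]])

lemma cohomology_carrierE:
  assumes "S \<in> carrier (simplicial_cohomology G n KL)"
  obtains z where "z \<in> simplicial_cocycles G n (fst KL) (snd KL)"
    "S = simplicial_coboundaries G n (fst KL) (snd KL) #>\<^bsub>simplicial_cochain_group G n (fst KL) (snd KL)\<^esub> z"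
  using assms unfolding simplicial_cohomology_eq carrier_FactGroup by auto

lemma cohomology_map_coset:
  assumes "complex_pair KL" "complex_pair KL'" "simplicial_map KL KL' p"
    and z: "z \<in> simplicial_cocycles G n (fst KL') (snd KL')"
  shows "simplicial_cohomology_map G n KL KL' p
      (simplicial_coboundaries G n (fst KL') (snd KL') #>\<^bsub>simplicial_cochain_group G n (fst KL') (snd KL')\<^esub> z)
    = simplicial_coboundaries G n (fst KL) (snd KL) #>\<^bsub>simplicial_cochain_group G n (fst KL) (snd KL)\<^esub>
        simplicial_cochain_map n (fst KL) p z"
proof -
  interpret subquotient_hom "simplicial_cochain_group G n (fst KL') (snd KL')"
      "simplicial_cocycles G n (fst KL') (snd KL')" "simplicial_coboundaries G n (fst KL') (snd KL')"
      "simplicial_cochain_group G n (fst KL) (snd KL)"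
      "simplicial_cocycles G n (fst KL) (snd KL)" "simplicial_coboundaries G n (fst KL) (snd KL)"
      "simplicial_cochain_map n (fst KL) p"
    by (rule subquotient_hom_cohomology [OF assms(1-3)])
  show ?thesis
    unfolding simplicial_cohomology_map_def simplicial_cohomology_eq
    by (simp only: restrict_apply' src.coset_in_subquotient coset_map_coset z)
qed

lemma cohomology_map_compose:
  assumes KL: "complex_pair KL" and KL': "complex_pair KL'" and KL'': "complex_pair KL''"
    and p: "simplicial_map KL KL' p" and q: "simplicial_map KL' KL'' q"
    and S: "S \<in> carrier (simplicial_cohomology G n KL'')"
  shows "simplicial_cohomology_map G n KL KL' p (simplicial_cohomology_map G n KL' KL'' q S)
       = simplicial_cohomology_map G n KL KL'' (\<lambda>v. q (p v)) S"
proof -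
  obtain z where z: "z \<in> simplicial_cocycles G n (fst KL'') (snd KL'')"
    and S: "S = simplicial_coboundaries G n (fst KL'') (snd KL'') #>\<^bsub>simplicial_cochain_group G n (fst KL'') (snd KL'')\<^esub> z"
    using S by (rule cohomology_carrierE)
  have qp: "simplicial_map KL KL'' (\<lambda>v. q (p v))"
    using p q by (auto simp: simplicial_map_def image_image [symmetric, of q p])
  have qz: "simplicial_cochain_map n (fst KL') q z \<in> simplicial_cocycles G n (fst KL') (snd KL')"
    using subquotient_hom.h_Z [OF subquotient_hom_cohomology [OF KL' KL'' q]] z by blast
  have pK: "\<forall>s\<in>fst KL. p ` s \<in> fst KL'" using p by (simp add: simplicial_map_def)
  have "simplicial_cochain_map n (fst KL) p (simplicial_cochain_map n (fst KL') q z)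
      = simplicial_cochain_map n (fst KL) (\<lambda>v. q (p v)) z"
    using int_chain.chain_map_in_chain_group [OF pK]
    by (auto simp: simplicial_cochain_map_def fun_eq_iff int_chain.chain_map_compose [OF pK])
  then show ?thesis
    unfolding S cohomology_map_coset [OF KL' KL'' q z] cohomology_map_coset [OF KL KL' p qz]
      cohomology_map_coset [OF KL KL'' qp z] by simp
qed

lemma cohomology_map_ident:
  assumes KL: "complex_pair KL" and S: "S \<in> carrier (simplicial_cohomology G n KL)"
  shows "simplicial_cohomology_map G n KL KL (\<lambda>v. v) S = S"
proof -
  obtain z where z: "z \<in> simplicial_cocycles G n (fst KL) (snd KL)"
    and S: "S = simplicial_coboundaries G n (fst KL) (snd KL) #>\<^bsub>simplicial_cochain_group G n (fst KL) (snd KL)\<^esub> z"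
    using S by (rule cohomology_carrierE)
  have id: "simplicial_map KL KL (\<lambda>v. v)" by (simp add: simplicial_map_def)
  have "simplicial_cochain_map n (fst KL) (\<lambda>v. v) z = z"
    using z by (auto simp: simplicial_cocycles_def mem_cochain_group simplicial_cochain_map_def int_chain.chain_map_ident
        intro!: extensionalityI [of _ "carrier (int_chains (fst KL) n)"])
  then show ?thesis unfolding S cohomology_map_coset [OF KL KL id z] by simp
qed

text \<open>A cocycle z is composed with q = p + dD + Dd. The term z d D vanishes because z is a
  cocycle, and z D d is the coboundary of z D, which is relative because \<open>D\<close> respects
  the subcomplexes.\<close>

lemma cohomology_map_contiguous:
  assumes KL: "complex_pair KL" and KL': "complex_pair KL'" and fin: "finite (\<Union>(fst KL))"
    and p: "simplicial_map KL KL' p" and q: "simplicial_map KL KL' q" and con: "contiguous KL KL' p q"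
  shows "simplicial_cohomology_map G n KL KL' p = simplicial_cohomology_map G n KL KL' q"
proof
  fix S
  show "simplicial_cohomology_map G n KL KL' p S = simplicial_cohomology_map G n KL KL' q S"
  proof (cases "S \<in> carrier (simplicial_cohomology G n KL')")
    case True
    then obtain z where z: "z \<in> simplicial_cocycles G n (fst KL') (snd KL')"
      and S: "S = simplicial_coboundaries G n (fst KL') (snd KL') #>\<^bsub>simplicial_cochain_group G n (fst KL') (snd KL')\<^esub> z"
      by (rule cohomology_carrierE)
    obtain D where D: "chain_homotopy integer_group KL KL' p q D"
      using int_chain.contiguous_chain_homotopy [OF KL KL' fin con] by blast
    have Dh: "D \<in> hom (int_chains (fst KL) m) (int_chains (fst KL') (Suc m))" for m
      using D unfolding chain_homotopy_def by blast
    have DL: "D c \<in> carrier (int_chains (snd KL') (Suc m))" if "c \<in> carrier (int_chains (snd KL) m)" for c m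
      using D that unfolding chain_homotopy_def by blast
    have K: "simplicial_complex (fst KL)" and K': "simplicial_complex (fst KL')" and LK: "snd KL \<subseteq> fst KL"
      using KL KL' by (simp_all add: complex_pair_def)
    have zc: "z \<in> carrier (simplicial_cochain_group G n (fst KL') (snd KL'))"
      and dz: "simplicial_coboundary (Suc n) (fst KL') z = (\<lambda>c\<in>carrier (int_chains (fst KL') (Suc n)). \<one>)"
      using z by (simp_all add: simplicial_cocycles_def)
    have dz': "z (simplicial_boundary integer_group (Suc n) c) = \<one>" if "c \<in> carrier (int_chains (fst KL') (Suc n))" for c
      using fun_cong [OF dz, of c] that by (simp add: simplicial_coboundary_def)
    have pz: "simplicial_cochain_map n (fst KL) p z \<in> carrier (simplicial_cochain_group G n (fst KL) (snd KL))"
      by (rule cochain_map_in_cochain_group [OF KL p zc])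
    \<comment> \<open>The cochain is z D, except for \<open>n = 0\<close>: there \<open>D\<close>
      leads from degree 0 to degree 1, on which z is not a cochain, and the trivial cochain serves
      because the boundary is zero. Only the values on boundaries are recorded, so both cases
      continue together.\<close>
    have "\<exists>\<psi>\<in>carrier (simplicial_cochain_group G (n - 1) (fst KL) (snd KL)).
        \<forall>c\<in>carrier (int_chains (fst KL) n).
          \<psi> (simplicial_boundary integer_group n c) = z (D (simplicial_boundary integer_group n c))"
    proof (cases "n = 0")
      case True
      interpret C: group_hom "int_chains (fst KL) 0" "int_chains (fst KL') (Suc 0)" D
        using Dh
        by (simp add: group_hom_def group_hom_axioms_def comm_group.axioms(2) [OF int_chain.comm_group_chain_group])
      have "D (\<lambda>vs. 0) = (\<lambda>vs. 0)" using C.hom_one by simp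
      then have "z (D (\<lambda>vs. 0)) = \<one>" using cochain_one [OF zc] by simp
      moreover have "(\<lambda>vs. 0) \<in> carrier (int_chains (fst KL) 0)"
        using int_chain.one_in_chain_group [of "fst KL" 0] by simp
      ultimately show ?thesis
        using True by (intro bexI [OF _ one_in_cochain_group [OF LK]]) simp
    next
      case False
      have "z \<circ> D \<in> hom (int_chains (fst KL) (n - 1)) G"
        using Group.hom_compose [OF Dh [of "n - 1"]] cochain_hom [OF zc] False by auto
      then have "(\<lambda>c. z (D c)) \<in> hom (int_chains (fst KL) (n - 1)) G" by (simp add: comp_def)
      moreover have "z (D c) = \<one>" if "c \<in> carrier (int_chains (snd KL) (n - 1))" for c
        using DL [OF that] zc False by (simp add: mem_cochain_group)
      ultimately have "(\<lambda>c\<in>carrier (int_chains (fst KL) (n - 1)). z (D c))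
          \<in> carrier (simplicial_cochain_group G (n - 1) (fst KL) (snd KL))"
        by (rule restrict_in_cochain_group [OF _ _ LK])
      then show ?thesis
        using int_chain.boundary_in_chain_group [OF K] by (intro bexI) auto
    qed
    then obtain \<psi> where \<psi>: "\<psi> \<in> carrier (simplicial_cochain_group G (n - 1) (fst KL) (snd KL))"
      and \<psi>D: "\<And>c. c \<in> carrier (int_chains (fst KL) n) \<Longrightarrow>
          \<psi> (simplicial_boundary integer_group n c) = z (D (simplicial_boundary integer_group n c))"
      by blast
    have b: "simplicial_coboundary n (fst KL) \<psi> \<in> simplicial_coboundaries G n (fst KL) (snd KL)"
      using \<psi> by (simp add: simplicial_coboundaries_def)
    interpret Q: subquotient "simplicial_cochain_group G n (fst KL) (snd KL)"
      "simplicial_cocycles G n (fst KL) (snd KL)" "simplicial_coboundaries G n (fst KL) (snd KL)"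
      using KL by (auto intro: subquotient_cohomology)
    have "simplicial_cochain_map n (fst KL) q z = simplicial_coboundary n (fst KL) \<psi>
        \<otimes>\<^bsub>simplicial_cochain_group G n (fst KL) (snd KL)\<^esub> simplicial_cochain_map n (fst KL) p z"
    proof (rule extensionalityI [of _ "carrier (int_chains (fst KL) n)"])
      fix c assume c: "c \<in> carrier (int_chains (fst KL) n)"
      let ?p = "simplicial_chain_map integer_group p c"
      let ?b = "simplicial_boundary integer_group (Suc n) (D c)"
      let ?d = "D (simplicial_boundary integer_group n c)"
      have pc: "?p \<in> carrier (int_chains (fst KL') n)"
        by (rule int_chain.chain_map_in_chain_group [OF _ c]) (use p in \<open>simp add: simplicial_map_def\<close>)
      have Dc: "D c \<in> carrier (int_chains (fst KL') (Suc n))" by (rule hom_in_carrier [OF Dh c])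
      have bc: "?b \<in> carrier (int_chains (fst KL') n)"
        using int_chain.boundary_in_chain_group [OF K' Dc] by simp
      have qc: "simplicial_chain_map integer_group q c \<in> carrier (int_chains (fst KL') n)"
        by (rule int_chain.chain_map_in_chain_group [OF _ c]) (use q in \<open>simp add: simplicial_map_def\<close>)
      \<comment> \<open>For \<open>n = 0\<close> counting degrees along \<open>D\<close> gives 1;
        membership in degree 0 follows instead by solving the homotopy equation for this
        term.\<close>
      have dc: "?d \<in> carrier (int_chains (fst KL') n)"
      proof (cases "n = 0")
        case True
        have "simplicial_chain_map integer_group q c = (\<lambda>vs. ?p vs + (?b vs + ?d vs))"
          using D c by (auto simp: chain_homotopy_def fun_eq_iff)
        then have "?d = (\<lambda>vs. simplicial_chain_map integer_group q c vs + (- ?p vs + - ?b vs))"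
          by (simp add: fun_eq_iff)
        then show ?thesis
          using int_chain.mult_in_chain_group [OF qc int_chain.mult_in_chain_group [OF int_chain.inv_in_chain_group [OF pc] int_chain.inv_in_chain_group [OF bc]]]
          by simp
      next
        case False
        then show ?thesis
          using hom_in_carrier [OF Dh int_chain.boundary_in_chain_group [OF K c]] by simp
      qed
      have "simplicial_chain_map integer_group q c = ?p \<otimes>\<^bsub>int_chains (fst KL') n\<^esub> (?b \<otimes>\<^bsub>int_chains (fst KL') n\<^esub> ?d)"
        using D c by (auto simp: chain_homotopy_def fun_eq_iff)
      moreover have "?b \<otimes>\<^bsub>int_chains (fst KL') n\<^esub> ?d \<in> carrier (int_chains (fst KL') n)"
        using int_chain.mult_in_chain_group [OF bc dc] by simp
      ultimately have "z (simplicial_chain_map integer_group q c) = z ?p \<otimes> (z ?b \<otimes> z ?d)"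
        using hom_mult [OF cochain_hom [OF zc]] pc bc dc by presburger
      also have "\<dots> = \<psi> (simplicial_boundary integer_group n c) \<otimes> z ?p"
        using dz' [OF Dc] cochain_closed [OF zc pc] cochain_closed [OF zc dc] \<psi>D [OF c] by (simp add: m_comm)
      finally show "simplicial_cochain_map n (fst KL) q z c = (simplicial_coboundary n (fst KL) \<psi>
        \<otimes>\<^bsub>simplicial_cochain_group G n (fst KL) (snd KL)\<^esub> simplicial_cochain_map n (fst KL) p z) c"
        using c by (simp add: simplicial_cochain_map_def simplicial_coboundary_def)
    qed (simp_all add: simplicial_cochain_map_def)
    then show ?thesis
      unfolding S cohomology_map_coset [OF KL KL' p z] cohomology_map_coset [OF KL KL' q z]
      using Q.coset_mult_absorb [OF b pz] by simp
  next
    case False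
    then show ?thesis by (simp add: simplicial_cohomology_map_def)
  qed
qed

end

section \<open>Limits of inverse and direct systems\<close>

lemma mem_inverse_limit:
  "x \<in> carrier (inverse_limit I r D \<pi>) \<longleftrightarrow>
     x \<in> (\<Pi>\<^sub>E i\<in>I. carrier (D i)) \<and> (\<forall>i\<in>I. \<forall>j\<in>I. r i j \<longrightarrow> \<pi> i j (x j) = x i)"
  by (simp add: inverse_limit_def)

lemma mult_inverse_limit [simp]:
  "x \<otimes>\<^bsub>inverse_limit I r D \<pi>\<^esub> y = (\<lambda>i\<in>I. x i \<otimes>\<^bsub>D i\<^esub> y i)"
  by (simp add: inverse_limit_def product_group_def)

lemma one_inverse_limit [simp]: "\<one>\<^bsub>inverse_limit I r D \<pi>\<^esub> = (\<lambda>i\<in>I. \<one>\<^bsub>D i\<^esub>)"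
  by (simp add: inverse_limit_def product_group_def)

lemma inverse_limit_closed: "x \<in> carrier (inverse_limit I r D \<pi>) \<Longrightarrow> i \<in> I \<Longrightarrow> x i \<in> carrier (D i)"
  by (auto simp: mem_inverse_limit)

text \<open>Because the bonding maps are homomorphisms, the compatibility conditions are stable
  under the coordinatewise operations of the product.\<close>

lemma comm_group_inverse_limit:
  assumes D: "\<And>i. i \<in> I \<Longrightarrow> comm_group (D i)"
    and \<pi>: "\<And>i j. i \<in> I \<Longrightarrow> j \<in> I \<Longrightarrow> r i j \<Longrightarrow> \<pi> i j \<in> hom (D j) (D i)"
  shows "comm_group (inverse_limit I r D \<pi>)"
proof -
  have G: "group (D i)" and M: "comm_monoid (D i)" if "i \<in> I" for i
    using D [OF that] by (simp_all add: comm_group.axioms)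
  have H: "group_hom (D j) (D i) (\<pi> i j)" if "i \<in> I" "j \<in> I" "r i j" for i j
    using G \<pi> that by (simp add: group_hom_def group_hom_axioms_def)
  show ?thesis
  proof (rule comm_groupI)
    fix x y assume x: "x \<in> carrier (inverse_limit I r D \<pi>)" and y: "y \<in> carrier (inverse_limit I r D \<pi>)"
    show "x \<otimes>\<^bsub>inverse_limit I r D \<pi>\<^esub> y \<in> carrier (inverse_limit I r D \<pi>)"
      using x y G by (auto simp: mem_inverse_limit PiE_iff group.is_monoid monoid.m_closed hom_mult [OF \<pi>])
    show "x \<otimes>\<^bsub>inverse_limit I r D \<pi>\<^esub> y = y \<otimes>\<^bsub>inverse_limit I r D \<pi>\<^esub> x"
      using x y M by (auto simp: mem_inverse_limit PiE_iff fun_eq_iff comm_monoid.m_comm)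
  next
    show "\<one>\<^bsub>inverse_limit I r D \<pi>\<^esub> \<in> carrier (inverse_limit I r D \<pi>)"
      using G by (auto simp: mem_inverse_limit group.is_monoid monoid.one_closed group_hom.hom_one [OF H])
  next
    fix x y z assume "x \<in> carrier (inverse_limit I r D \<pi>)" "y \<in> carrier (inverse_limit I r D \<pi>)"
      "z \<in> carrier (inverse_limit I r D \<pi>)"
    then show "x \<otimes>\<^bsub>inverse_limit I r D \<pi>\<^esub> y \<otimes>\<^bsub>inverse_limit I r D \<pi>\<^esub> z
      = x \<otimes>\<^bsub>inverse_limit I r D \<pi>\<^esub> (y \<otimes>\<^bsub>inverse_limit I r D \<pi>\<^esub> z)"
      using G by (auto simp: fun_eq_iff inverse_limit_closed group.is_monoid monoid.m_assoc)
  next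
    fix x assume x: "x \<in> carrier (inverse_limit I r D \<pi>)"
    show "\<one>\<^bsub>inverse_limit I r D \<pi>\<^esub> \<otimes>\<^bsub>inverse_limit I r D \<pi>\<^esub> x = x"
    proof (rule extensionalityI)
      show "x \<in> extensional I" using x by (simp add: mem_inverse_limit PiE_def)
    qed (use G inverse_limit_closed [OF x] in \<open>auto simp: group.is_monoid monoid.l_one\<close>)
    let ?y = "\<lambda>i\<in>I. inv\<^bsub>D i\<^esub> (x i)"
    have "?y \<in> carrier (inverse_limit I r D \<pi>)"
      using x G by (auto simp: mem_inverse_limit PiE_iff group.inv_closed group_hom.hom_inv [OF H])
    moreover have "?y \<otimes>\<^bsub>inverse_limit I r D \<pi>\<^esub> x = \<one>\<^bsub>inverse_limit I r D \<pi>\<^esub>"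
      using G inverse_limit_closed [OF x] by (auto simp: fun_eq_iff group.l_inv)
    ultimately show "\<exists>y\<in>carrier (inverse_limit I r D \<pi>). y \<otimes>\<^bsub>inverse_limit I r D \<pi>\<^esub> x = \<one>\<^bsub>inverse_limit I r D \<pi>\<^esub>"
      by blast
  qed
qed

text \<open>The index map \<open>g\<close> runs against the map of limits: the coordinate at
  \<open>j\<close> is computed from the one at \<open>g j\<close>. For border covers
  \<open>g\<close> is \<alpha> \<mapsto> f^{-1}(\<alpha>).\<close>

lemma inverse_limit_map_hom:
  assumes g: "\<And>j. j \<in> J \<Longrightarrow> g j \<in> I" and mono: "\<And>j k. j \<in> J \<Longrightarrow> k \<in> J \<Longrightarrow> s j k \<Longrightarrow> r (g j) (g k)"
    and D: "\<And>i. i \<in> I \<Longrightarrow> comm_group (D i)"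
    and \<pi>: "\<And>i j. i \<in> I \<Longrightarrow> j \<in> I \<Longrightarrow> r i j \<Longrightarrow> \<pi> i j \<in> hom (D j) (D i)"
    and f: "\<And>j. j \<in> J \<Longrightarrow> f j \<in> hom (D (g j)) (E j)"
    and comm: "\<And>j k x. j \<in> J \<Longrightarrow> k \<in> J \<Longrightarrow> s j k \<Longrightarrow> x \<in> carrier (D (g k)) \<Longrightarrow>
        f j (\<pi> (g j) (g k) x) = \<rho> j k (f k x)"
  shows "(\<lambda>x\<in>carrier (inverse_limit I r D \<pi>). \<lambda>j\<in>J. f j (x (g j)))
     \<in> hom (inverse_limit I r D \<pi>) (inverse_limit J s E \<rho>)"
proof (rule homI)
  fix x assume x: "x \<in> carrier (inverse_limit I r D \<pi>)"
  have "\<rho> j k (f k (x (g k))) = f j (x (g j))" if "j \<in> J" "k \<in> J" "s j k" for j k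
  proof -
    have "\<pi> (g j) (g k) (x (g k)) = x (g j)"
      using x g [OF that(1)] g [OF that(2)] mono [OF that] unfolding mem_inverse_limit by blast
    then show ?thesis
      using comm [OF that inverse_limit_closed [OF x g [OF that(2)]]] by simp
  qed
  then show "(\<lambda>x\<in>carrier (inverse_limit I r D \<pi>). \<lambda>j\<in>J. f j (x (g j))) x \<in> carrier (inverse_limit J s E \<rho>)"
    using x hom_in_carrier [OF f inverse_limit_closed [OF x g]] by (auto simp: mem_inverse_limit [of _ J])
  fix y assume y: "y \<in> carrier (inverse_limit I r D \<pi>)"
  interpret L: comm_group "inverse_limit I r D \<pi>" by (rule comm_group_inverse_limit [OF D \<pi>])
  show "(\<lambda>x\<in>carrier (inverse_limit I r D \<pi>). \<lambda>j\<in>J. f j (x (g j))) (x \<otimes>\<^bsub>inverse_limit I r D \<pi>\<^esub> y) =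
      (\<lambda>x\<in>carrier (inverse_limit I r D \<pi>). \<lambda>j\<in>J. f j (x (g j))) x \<otimes>\<^bsub>inverse_limit J s E \<rho>\<^esub>
      (\<lambda>x\<in>carrier (inverse_limit I r D \<pi>). \<lambda>j\<in>J. f j (x (g j))) y"
    using L.m_closed [OF x y] x y g inverse_limit_closed [OF x g] inverse_limit_closed [OF y g]
    by (auto simp: fun_eq_iff hom_mult [OF f])
qed

section \<open>Direct limits and their maps\<close>

locale direct_system =
  fixes I :: "'i set" and r :: "'i \<Rightarrow> 'i \<Rightarrow> bool" and D :: "'i \<Rightarrow> ('h, 'm) monoid_scheme" and \<phi> :: "'i \<Rightarrow> 'i \<Rightarrow> 'h \<Rightarrow> 'h"
  assumes group_D: "i \<in> I \<Longrightarrow> comm_group (D i)"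
    and hom_\<phi>: "\<lbrakk>i \<in> I; j \<in> I; r i j\<rbrakk> \<Longrightarrow> \<phi> i j \<in> hom (D i) (D j)"
    and nonempty: "I \<noteq> {}"
    and r_refl: "i \<in> I \<Longrightarrow> r i i"
    and r_trans: "\<lbrakk>i \<in> I; j \<in> I; k \<in> I; r i j; r j k\<rbrakk> \<Longrightarrow> r i k"
    and directed: "\<lbrakk>i \<in> I; j \<in> I\<rbrakk> \<Longrightarrow> \<exists>k\<in>I. r i k \<and> r j k"
    and \<phi>_ident: "\<lbrakk>i \<in> I; x \<in> carrier (D i)\<rbrakk> \<Longrightarrow> \<phi> i i x = x"
    and \<phi>_compose: "\<lbrakk>i \<in> I; j \<in> I; k \<in> I; r i j; r j k; x \<in> carrier (D i)\<rbrakk> \<Longrightarrow> \<phi> j k (\<phi> i j x) = \<phi> i k x"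
begin

abbreviation rel where "rel \<equiv> direct_limit_rel I r D \<phi>"

abbreviation lim where "lim \<equiv> direct_limit I r D \<phi>"

definition cls :: "'i \<Rightarrow> 'h \<Rightarrow> ('i \<times> 'h) set" where "cls i x = rel `` {(i, x)}"

lemma \<phi>_closed: "\<lbrakk>i \<in> I; j \<in> I; r i j; x \<in> carrier (D i)\<rbrakk> \<Longrightarrow> \<phi> i j x \<in> carrier (D j)"
  using hom_in_carrier [OF hom_\<phi>] .

lemma m_closed_D: "\<lbrakk>i \<in> I; x \<in> carrier (D i); y \<in> carrier (D i)\<rbrakk> \<Longrightarrow> x \<otimes>\<^bsub>D i\<^esub> y \<in> carrier (D i)"
  by (simp add: comm_group.axioms(2) [OF group_D] group.is_monoid monoid.m_closed)

text \<open>Transitivity rests on directedness and on functoriality of the bonding maps: the indices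
  at which the two equalities hold are brought to a common later one.\<close>

lemma equiv_rel: "equiv (SIGMA i:I. carrier (D i)) rel"
proof (rule equivI)
  show "rel \<subseteq> (SIGMA i:I. carrier (D i)) \<times> (SIGMA i:I. carrier (D i))"
    by (auto simp: direct_limit_rel_def)
  show "refl_on (SIGMA i:I. carrier (D i)) rel"
    using r_refl by (auto simp: direct_limit_rel_def refl_on_def)
  show "sym rel" by (rule symI) (force simp: direct_limit_rel_def)
  show "trans rel"
  proof (rule transI)
    fix ix jy kz assume 1: "(ix, jy) \<in> rel" and 2: "(jy, kz) \<in> rel"
    obtain i x j y k z where e: "ix = (i, x)" "jy = (j, y)" "kz = (k, z)" by (metis surj_pair)
    from 1 obtain a where i: "i \<in> I" "x \<in> carrier (D i)" and j: "j \<in> I" "y \<in> carrier (D j)"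
      and a: "a \<in> I" "r i a" "r j a" "\<phi> i a x = \<phi> j a y"
      by (auto simp: e direct_limit_rel_def)
    from 2 obtain b where k: "k \<in> I" "z \<in> carrier (D k)"
      and b: "b \<in> I" "r j b" "r k b" "\<phi> j b y = \<phi> k b z"
      by (auto simp: e direct_limit_rel_def)
    obtain c where c: "c \<in> I" "r a c" "r b c" using directed a(1) b(1) by blast
    have "\<phi> i c x = \<phi> a c (\<phi> i a x)" by (rule \<phi>_compose [OF i(1) a(1) c(1) a(2) c(2) i(2), symmetric])
    also have "\<dots> = \<phi> b c (\<phi> j b y)"
      unfolding a(4) by (simp only: \<phi>_compose j a(1,3) b(1,2) c)
    also have "\<dots> = \<phi> k c z" unfolding b(4) by (rule \<phi>_compose [OF k(1) b(1) c(1) b(3) c(3) k(2)])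
    finally show "(ix, kz) \<in> rel"
      using i k c r_trans [OF i(1) a(1) c(1) a(2) c(2)] r_trans [OF k(1) b(1) c(1) b(3) c(3)]
      by (auto simp: e direct_limit_rel_def)
  qed
qed

lemma cls_eq_iff:
  assumes "i \<in> I" "x \<in> carrier (D i)" "j \<in> I" "y \<in> carrier (D j)"
  shows "cls i x = cls j y \<longleftrightarrow> (\<exists>k\<in>I. r i k \<and> r j k \<and> \<phi> i k x = \<phi> j k y)"
  unfolding cls_def using assms
  by (subst eq_equiv_class_iff [OF equiv_rel]) (auto simp: direct_limit_rel_def)

lemma mem_cls:
  assumes "i \<in> I" "x \<in> carrier (D i)"
  shows "(j, y) \<in> cls i x \<longleftrightarrow> j \<in> I \<and> y \<in> carrier (D j) \<and> (\<exists>k\<in>I. r i k \<and> r j k \<and> \<phi> i k x = \<phi> j k y)"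
  using assms by (auto simp: cls_def direct_limit_rel_def)

lemma cls_self: "i \<in> I \<Longrightarrow> x \<in> carrier (D i) \<Longrightarrow> (i, x) \<in> cls i x"
  using r_refl by (auto simp: mem_cls)

lemma cls_transport:
  assumes "i \<in> I" "k \<in> I" "r i k" "x \<in> carrier (D i)"
  shows "cls k (\<phi> i k x) = cls i x"
  using assms r_refl [of k] by (subst cls_eq_iff) (auto simp: \<phi>_closed \<phi>_ident)

lemma carrier_lim: "carrier lim = {cls i x | i x. i \<in> I \<and> x \<in> carrier (D i)}"
  by (auto simp: direct_limit_def Let_def quotient_def cls_def)

lemma cls_in_lim: "i \<in> I \<Longrightarrow> x \<in> carrier (D i) \<Longrightarrow> cls i x \<in> carrier lim"
  by (auto simp: carrier_lim)

text \<open>The multiplication of \<open>direct_limit\<close> is a union over all representatives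
  and all later indices. All these products form one class, so the union collapses.\<close>

lemma mult_cls:
  assumes i: "i \<in> I" "x \<in> carrier (D i)" and j: "j \<in> I" "y \<in> carrier (D j)"
    and k: "k \<in> I" "r i k" "r j k"
  shows "cls i x \<otimes>\<^bsub>lim\<^esub> cls j y = cls k (\<phi> i k x \<otimes>\<^bsub>D k\<^esub> \<phi> j k y)"
proof -
  have eq: "rel `` {(k', \<phi> i' k' x' \<otimes>\<^bsub>D k'\<^esub> \<phi> j' k' y')} = cls k (\<phi> i k x \<otimes>\<^bsub>D k\<^esub> \<phi> j k y)"
    if m: "(i', x') \<in> cls i x" "(j', y') \<in> cls j y" and k': "k' \<in> I" "r i' k'" "r j' k'" for i' x' j' y' k'
  proof -
    from m(1) obtain a where i': "i' \<in> I" "x' \<in> carrier (D i')"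
      and a: "a \<in> I" "r i a" "r i' a" "\<phi> i a x = \<phi> i' a x'"
      using mem_cls [OF i] by blast
    from m(2) obtain b where j': "j' \<in> I" "y' \<in> carrier (D j')"
      and b: "b \<in> I" "r j b" "r j' b" "\<phi> j b y = \<phi> j' b y'"
      using mem_cls [OF j] by blast
    obtain c where c: "c \<in> I" "r a c" "r b c" using directed a(1) b(1) by blast
    obtain d where d: "d \<in> I" "r k d" "r k' d" using directed k(1) k'(1) by blast
    \<comment> \<open>Beyond \<open>a\<close> and \<open>b\<close> the representatives agree, beyond
      \<open>k\<close> and \<open>k'\<close> both products can be transported; at \<open>e\<close>
      all of them are compared.\<close>
    obtain e where e: "e \<in> I" "r c e" "r d e" using directed c(1) d(1) by blast
    have ae: "r a e" and be: "r b e" using r_trans a(1) b(1) c e by blast+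
    have ke: "r k e" and k'e: "r k' e" using r_trans k(1) k'(1) d e by blast+
    have 1: "\<phi> i e x = \<phi> i' e x'"
      using \<phi>_compose [OF i(1) a(1) e(1) a(2) ae i(2)] \<phi>_compose [OF i'(1) a(1) e(1) a(3) ae i'(2)] a(4) by simp
    have 2: "\<phi> j e y = \<phi> j' e y'"
      using \<phi>_compose [OF j(1) b(1) e(1) b(2) be j(2)] \<phi>_compose [OF j'(1) b(1) e(1) b(3) be j'(2)] b(4) by simp
    have 3: "\<phi> k e (\<phi> i k x \<otimes>\<^bsub>D k\<^esub> \<phi> j k y) = \<phi> i e x \<otimes>\<^bsub>D e\<^esub> \<phi> j e y"
      using i j k e ke by (simp add: hom_mult [OF hom_\<phi>] \<phi>_closed \<phi>_compose)
    have 4: "\<phi> k' e (\<phi> i' k' x' \<otimes>\<^bsub>D k'\<^esub> \<phi> j' k' y') = \<phi> i' e x' \<otimes>\<^bsub>D e\<^esub> \<phi> j' e y'"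
      using i' j' k' e k'e by (simp add: hom_mult [OF hom_\<phi>] \<phi>_closed \<phi>_compose)
    have "cls k' (\<phi> i' k' x' \<otimes>\<^bsub>D k'\<^esub> \<phi> j' k' y') = cls k (\<phi> i k x \<otimes>\<^bsub>D k\<^esub> \<phi> j k y)"
      using i j i' j' k k' e(1) ke k'e 1 2 3 4
      by (subst cls_eq_iff) (auto simp: \<phi>_closed m_closed_D)
    then show ?thesis by (simp add: cls_def)
  qed
  have "cls i x \<otimes>\<^bsub>lim\<^esub> cls j y = \<Union>{rel `` {(k', \<phi> i' k' x' \<otimes>\<^bsub>D k'\<^esub> \<phi> j' k' y')} | i' x' j' y' k'.
      (i', x') \<in> cls i x \<and> (j', y') \<in> cls j y \<and> k' \<in> I \<and> r i' k' \<and> r j' k'}"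
    by (simp add: direct_limit_def Let_def)
  also have "{rel `` {(k', \<phi> i' k' x' \<otimes>\<^bsub>D k'\<^esub> \<phi> j' k' y')} | i' x' j' y' k'.
      (i', x') \<in> cls i x \<and> (j', y') \<in> cls j y \<and> k' \<in> I \<and> r i' k' \<and> r j' k'}
    = {cls k (\<phi> i k x \<otimes>\<^bsub>D k\<^esub> \<phi> j k y)}"
  proof (intro equalityI subsetI)
    fix S assume "S \<in> {cls k (\<phi> i k x \<otimes>\<^bsub>D k\<^esub> \<phi> j k y)}"
    then have "S = rel `` {(k, \<phi> i k x \<otimes>\<^bsub>D k\<^esub> \<phi> j k y)}" by (simp add: cls_def)
    then show "S \<in> {rel `` {(k', \<phi> i' k' x' \<otimes>\<^bsub>D k'\<^esub> \<phi> j' k' y')} | i' x' j' y' k'.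
      (i', x') \<in> cls i x \<and> (j', y') \<in> cls j y \<and> k' \<in> I \<and> r i' k' \<and> r j' k'}"
      using cls_self [OF i] cls_self [OF j] k by blast
  qed (use eq in blast)
  finally show ?thesis by simp
qed

lemma mult_cls_same: "k \<in> I \<Longrightarrow> x \<in> carrier (D k) \<Longrightarrow> y \<in> carrier (D k) \<Longrightarrow> cls k x \<otimes>\<^bsub>lim\<^esub> cls k y = cls k (x \<otimes>\<^bsub>D k\<^esub> y)"
  using mult_cls [of k x k y k] r_refl by (simp add: \<phi>_ident)

lemma one_closed_D: "i \<in> I \<Longrightarrow> \<one>\<^bsub>D i\<^esub> \<in> carrier (D i)"
  by (simp add: comm_group.axioms(2) [OF group_D] group.is_monoid monoid.one_closed)

text \<open>As for products, the defining union runs over equal classes; \<open>nonempty\<close>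
  ensures that there is one.\<close>

lemma one_lim:
  assumes i: "i \<in> I"
  shows "\<one>\<^bsub>lim\<^esub> = cls i \<one>\<^bsub>D i\<^esub>"
proof -
  have eq: "cls j \<one>\<^bsub>D j\<^esub> = cls i \<one>\<^bsub>D i\<^esub>" if j: "j \<in> I" for j
  proof -
    obtain k where k: "k \<in> I" "r i k" "r j k" using directed i j by blast
    have "\<phi> i k \<one>\<^bsub>D i\<^esub> = \<one>\<^bsub>D k\<^esub>" "\<phi> j k \<one>\<^bsub>D j\<^esub> = \<one>\<^bsub>D k\<^esub>"
      using i j k by (auto intro!: hom_one [OF hom_\<phi>] comm_group.axioms(2) [OF group_D])
    then show ?thesis using i j k by (subst cls_eq_iff) (auto simp: one_closed_D)
  qed
  have "\<one>\<^bsub>lim\<^esub> = (\<Union>j\<in>I. cls j \<one>\<^bsub>D j\<^esub>)" by (simp add: direct_limit_def Let_def cls_def)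
  also have "\<dots> = (\<Union>j\<in>I. cls i \<one>\<^bsub>D i\<^esub>)" by (rule SUP_cong) (simp_all only: eq)
  also have "\<dots> = cls i \<one>\<^bsub>D i\<^esub>" using nonempty by simp
  finally show ?thesis .
qed

text \<open>Representability at every index beyond \<open>l\<close>, and not only at
  \<open>l\<close>, allows several classes to be treated one after the other, each starting from the
  bound found before.\<close>

lemma cls_common_index:
  assumes "S \<in> carrier lim" "k \<in> I"
  shows "\<exists>l\<in>I. r k l \<and> (\<forall>m\<in>I. r l m \<longrightarrow> (\<exists>x\<in>carrier (D m). S = cls m x))"
proof -
  obtain i x where i: "i \<in> I" "x \<in> carrier (D i)" and S: "S = cls i x" using assms by (auto simp: carrier_lim)
  obtain l where l: "l \<in> I" "r k l" "r i l" using directed i(1) assms(2) by blast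
  have "\<exists>x\<in>carrier (D m). S = cls m x" if m: "m \<in> I" "r l m" for m
  proof (rule bexI)
    have "r i m" using r_trans i(1) l m by blast
    then show "S = cls m (\<phi> i m x)" "\<phi> i m x \<in> carrier (D m)"
      using i m S by (simp_all add: cls_transport \<phi>_closed)
  qed
  then show ?thesis using l by blast
qed

lemma common_index:
  assumes "S \<in> carrier lim" "T \<in> carrier lim" "U \<in> carrier lim"
  obtains k x y z where "k \<in> I" "x \<in> carrier (D k)" "y \<in> carrier (D k)" "z \<in> carrier (D k)"
    "S = cls k x" "T = cls k y" "U = cls k z"
proof -
  obtain i where "i \<in> I" using nonempty by blast
  then obtain a where a: "a \<in> I" "\<forall>m\<in>I. r a m \<longrightarrow> (\<exists>x\<in>carrier (D m). S = cls m x)"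
    using cls_common_index [OF assms(1)] by blast
  obtain b where b: "b \<in> I" "r a b" "\<forall>m\<in>I. r b m \<longrightarrow> (\<exists>x\<in>carrier (D m). T = cls m x)"
    using cls_common_index [OF assms(2) a(1)] by blast
  obtain c where c: "c \<in> I" "r b c" "\<forall>m\<in>I. r c m \<longrightarrow> (\<exists>x\<in>carrier (D m). U = cls m x)"
    using cls_common_index [OF assms(3) b(1)] by blast
  have "r a c" using r_trans a(1) b(1,2) c(1,2) by blast
  then obtain x where x: "x \<in> carrier (D c)" "S = cls c x" using a(2) c(1) by blast
  obtain y where y: "y \<in> carrier (D c)" "T = cls c y" using b(3) c(1,2) by blast
  obtain z where z: "z \<in> carrier (D c)" "U = cls c z" using c(1,3) r_refl by blast
  show ?thesis by (rule that [OF c(1) x(1) y(1) z(1) x(2) y(2) z(2)])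
qed

text \<open>Each law involves at most three classes, which have representatives in a single group of
  the system.\<close>

lemma comm_group_lim: "comm_group lim"
proof (rule comm_groupI)
  have G: "comm_group (D k)" if "k \<in> I" for k using group_D that .
  obtain i0 where i0: "i0 \<in> I" using nonempty by blast
  show "\<one>\<^bsub>lim\<^esub> \<in> carrier lim" using i0 by (simp add: one_lim [OF i0] cls_in_lim one_closed_D)
  fix S T U assume STU: "S \<in> carrier lim" "T \<in> carrier lim" "U \<in> carrier lim"
  then obtain k x y z where k: "k \<in> I" and xyz: "x \<in> carrier (D k)" "y \<in> carrier (D k)" "z \<in> carrier (D k)"
    and eq: "S = cls k x" "T = cls k y" "U = cls k z" by (rule common_index)
  interpret Dk: comm_group "D k" by (rule G [OF k])
  show "S \<otimes>\<^bsub>lim\<^esub> T \<otimes>\<^bsub>lim\<^esub> U = S \<otimes>\<^bsub>lim\<^esub> (T \<otimes>\<^bsub>lim\<^esub> U)"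
    using k xyz by (simp add: eq mult_cls_same Dk.m_assoc)
next
  fix S T assume ST: "S \<in> carrier lim" "T \<in> carrier lim"
  obtain k x y z where k: "k \<in> I" and xyz: "x \<in> carrier (D k)" "y \<in> carrier (D k)" "z \<in> carrier (D k)"
    and eq: "S = cls k x" "T = cls k y" "T = cls k z" by (rule common_index [OF ST ST(2)])
  interpret Dk: comm_group "D k" by (rule group_D [OF k])
  show "S \<otimes>\<^bsub>lim\<^esub> T \<in> carrier lim"
    using k xyz by (simp add: eq(1,2) mult_cls_same cls_in_lim)
  show "S \<otimes>\<^bsub>lim\<^esub> T = T \<otimes>\<^bsub>lim\<^esub> S"
    using k xyz by (simp add: eq(1,2) mult_cls_same Dk.m_comm)
next
  fix S assume S: "S \<in> carrier lim"
  obtain k x y z where k: "k \<in> I" and xyz: "x \<in> carrier (D k)" "y \<in> carrier (D k)" "z \<in> carrier (D k)"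
    and eq: "S = cls k x" "S = cls k y" "S = cls k z" by (rule common_index [OF S S S])
  interpret Dk: comm_group "D k" by (rule group_D [OF k])
  show "\<one>\<^bsub>lim\<^esub> \<otimes>\<^bsub>lim\<^esub> S = S"
    using k xyz by (simp add: eq(1) one_lim [OF k] mult_cls_same)
  show "\<exists>T\<in>carrier lim. T \<otimes>\<^bsub>lim\<^esub> S = \<one>\<^bsub>lim\<^esub>"
    using k xyz by (intro bexI [of _ "cls k (inv\<^bsub>D k\<^esub> x)"]) (simp_all add: eq(1) one_lim [OF k] mult_cls_same cls_in_lim)
qed

end

locale direct_system_map = src: direct_system I r D \<phi> + tgt: direct_system J s E \<psi>
  for I :: "'i set" and r and D :: "'i \<Rightarrow> ('h, 'm) monoid_scheme" and \<phi>
  and J :: "'j set" and s and E :: "'j \<Rightarrow> ('k, 'n) monoid_scheme" and \<psi> +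
  fixes g :: "'i \<Rightarrow> 'j" and f :: "'i \<Rightarrow> 'h \<Rightarrow> 'k"
  assumes g: "i \<in> I \<Longrightarrow> g i \<in> J" and mono: "\<lbrakk>i \<in> I; j \<in> I; r i j\<rbrakk> \<Longrightarrow> s (g i) (g j)"
    and f: "i \<in> I \<Longrightarrow> f i \<in> hom (D i) (E (g i))"
    and comm: "\<lbrakk>i \<in> I; j \<in> I; r i j; x \<in> carrier (D i)\<rbrakk> \<Longrightarrow> f j (\<phi> i j x) = \<psi> (g i) (g j) (f i x)"
begin

text \<open>Has the shape of the unfolded \<open>border_cohomology_map\<close>, so that the results
  below apply to it directly.\<close>

abbreviation lim_map where
  "lim_map \<equiv> \<lambda>S\<in>carrier src.lim. \<Union>(i, x)\<in>S. tgt.rel `` {(g i, f i x)}"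

lemma f_closed: "i \<in> I \<Longrightarrow> x \<in> carrier (D i) \<Longrightarrow> f i x \<in> carrier (E (g i))"
  using hom_in_carrier [OF f] .

text \<open>Representatives that become equal at \<open>k\<close> have images that become equal at
  \<open>g k\<close>, by \<open>comm\<close> and \<open>mono\<close>; so the union over the
  representatives collapses to one class.\<close>

lemma lim_map_cls:
  assumes i: "i \<in> I" "x \<in> carrier (D i)"
  shows "lim_map (src.cls i x) = tgt.cls (g i) (f i x)"
proof -
  have eq: "tgt.rel `` {(g j, f j y)} = tgt.cls (g i) (f i x)" if jy: "(j, y) \<in> src.cls i x" for j y
  proof -
    obtain k where j: "j \<in> I" "y \<in> carrier (D j)" and k: "k \<in> I" "r i k" "r j k" "\<phi> i k x = \<phi> j k y"
      using jy src.mem_cls [OF i] by blast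
    have "\<psi> (g i) (g k) (f i x) = \<psi> (g j) (g k) (f j y)"
      using comm [OF i(1) k(1,2) i(2)] comm [OF j(1) k(1,3) j(2)] k(4) by simp
    then have "tgt.cls (g j) (f j y) = tgt.cls (g i) (f i x)"
      using i j k by (subst tgt.cls_eq_iff) (auto simp: g f_closed intro!: mono bexI [of _ "g k"])
    then show ?thesis by (simp add: tgt.cls_def)
  qed
  have "(\<Union>(j, y)\<in>src.cls i x. tgt.rel `` {(g j, f j y)}) = tgt.cls (g i) (f i x)"
  proof (intro equalityI subsetI)
    fix p assume "p \<in> tgt.cls (g i) (f i x)"
    then show "p \<in> (\<Union>(j, y)\<in>src.cls i x. tgt.rel `` {(g j, f j y)})"
      using src.cls_self [OF i] unfolding tgt.cls_def by blast
  next
    fix p assume "p \<in> (\<Union>(j, y)\<in>src.cls i x. tgt.rel `` {(g j, f j y)})"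
    then obtain j y where "(j, y) \<in> src.cls i x" "p \<in> tgt.rel `` {(g j, f j y)}" by blast
    then show "p \<in> tgt.cls (g i) (f i x)" using eq by blast
  qed
  then show ?thesis using i by (simp add: src.cls_in_lim)
qed

lemma lim_map_hom: "lim_map \<in> hom src.lim tgt.lim"
proof (rule homI)
  show "lim_map S \<in> carrier tgt.lim" if S: "S \<in> carrier src.lim" for S
  proof -
    obtain i x where "i \<in> I" "x \<in> carrier (D i)" "S = src.cls i x" using S by (auto simp: src.carrier_lim)
    then show ?thesis by (simp only: lim_map_cls) (simp add: tgt.cls_in_lim g f_closed)
  qed
  fix S T assume ST: "S \<in> carrier src.lim" "T \<in> carrier src.lim"
  obtain k x y z where k: "k \<in> I" and xy: "x \<in> carrier (D k)" "y \<in> carrier (D k)" "z \<in> carrier (D k)"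
    and eq: "S = src.cls k x" "T = src.cls k y" "T = src.cls k z" by (rule src.common_index [OF ST ST(2)])
  have "lim_map (S \<otimes>\<^bsub>src.lim\<^esub> T) = tgt.cls (g k) (f k (x \<otimes>\<^bsub>D k\<^esub> y))"
    unfolding eq(1,2) src.mult_cls_same [OF k xy(1,2)] by (rule lim_map_cls [OF k src.m_closed_D [OF k xy(1,2)]])
  also have "f k (x \<otimes>\<^bsub>D k\<^esub> y) = f k x \<otimes>\<^bsub>E (g k)\<^esub> f k y" by (rule hom_mult [OF f [OF k] xy(1,2)])
  also have "tgt.cls (g k) (f k x \<otimes>\<^bsub>E (g k)\<^esub> f k y) = tgt.cls (g k) (f k x) \<otimes>\<^bsub>tgt.lim\<^esub> tgt.cls (g k) (f k y)"
    using k xy by (simp add: tgt.mult_cls_same g f_closed)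
  also have "\<dots> = lim_map S \<otimes>\<^bsub>tgt.lim\<^esub> lim_map T"
    unfolding eq(1,2) by (simp only: lim_map_cls k xy)
  finally show "lim_map (S \<otimes>\<^bsub>src.lim\<^esub> T) = lim_map S \<otimes>\<^bsub>tgt.lim\<^esub> lim_map T" .
qed

end

section \<open>Border homology and cohomology\<close>

lemma border_coversD:
  assumes "\<alpha> \<in> border_covers P"
  shows "finite (idx \<alpha>)" "subidx \<alpha> \<subseteq> idx \<alpha>" "member \<alpha> \<in> extensional (idx \<alpha>)"
    "\<And>v. v \<in> idx \<alpha> \<Longrightarrow> member \<alpha> v \<subseteq> topspace (fst P)"
  using assms by (auto simp: border_covers_def split_beta dest: openin_subset)

lemma complex_pair_nerve:
  assumes "\<alpha> \<in> border_covers P"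
  shows "complex_pair (nerve_pair P \<alpha>)"
proof -
  have face: "Car \<alpha> s \<subseteq> Car \<alpha> t" if "t \<subseteq> s" for s t using that by (auto simp: Car_def)
  have "simplicial_complex (fst (nerve_pair P \<alpha>))"
    unfolding simplicial_complex_def nerve_pair_def fst_conv
    using face by (blast intro: finite_subset)
  moreover have "simplicial_complex (snd (nerve_pair P \<alpha>))"
    unfolding simplicial_complex_def nerve_pair_def snd_conv
    using face by (blast intro: finite_subset)
  moreover have "snd (nerve_pair P \<alpha>) \<subseteq> fst (nerve_pair P \<alpha>)"
    using border_coversD(2) [OF assms] by (auto simp: nerve_pair_def)
  ultimately show ?thesis by (simp add: complex_pair_def)
qed

lemma finite_nerve_vertices:
  assumes "\<alpha> \<in> border_covers P"
  shows "finite (\<Union>(fst (nerve_pair P \<alpha>)))"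
  by (rule finite_subset [OF _ border_coversD(1) [OF assms]]) (auto simp: nerve_pair_def)

text \<open>A point common to the members \<beta>_v with v in s lies in all \<alpha>_{p v} and all
  \<alpha>_{q v}; for the subcomplex such a point is taken in A.\<close>

lemma refinement_projections_contiguous:
  assumes \<beta>: "subidx \<beta> \<subseteq> idx \<beta>"
    and p: "refinement_projection \<alpha> \<beta> p" and q: "refinement_projection \<alpha> \<beta> q"
  shows "contiguous (nerve_pair P \<beta>) (nerve_pair P \<alpha>) p q"
proof -
  have Car: "Car \<beta> s \<subseteq> Car \<alpha> (p ` s \<union> q ` s)" if s: "s \<subseteq> idx \<beta>" for s
  proof -
    have "member \<beta> v \<subseteq> member \<alpha> (p v)" "member \<beta> v \<subseteq> member \<alpha> (q v)" if "v \<in> s" for v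
      using p q s that by (auto simp: refinement_projection_def)
    then show ?thesis by (fastforce simp: Car_def)
  qed
  have "p ` s \<union> q ` s \<in> fst (nerve_pair P \<alpha>)" if s: "s \<in> fst (nerve_pair P \<beta>)" for s
  proof -
    have s': "s \<subseteq> idx \<beta>" "finite s" "s \<noteq> {}" "Car \<beta> s \<noteq> {}" using s by (auto simp: nerve_pair_def)
    have "p ` s \<subseteq> idx \<alpha>" "q ` s \<subseteq> idx \<alpha>"
      using p q s'(1) by (auto simp: refinement_projection_def)
    moreover have "Car \<alpha> (p ` s \<union> q ` s) \<noteq> {}" using Car [OF s'(1)] s'(4) by auto
    ultimately show ?thesis using s' by (simp add: nerve_pair_def)
  qed
  moreover have "p ` s \<union> q ` s \<in> snd (nerve_pair P \<alpha>)" if s: "s \<in> snd (nerve_pair P \<beta>)" for s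
  proof -
    have s': "s \<subseteq> subidx \<beta>" "finite s" "s \<noteq> {}" "Car \<beta> s \<inter> snd P \<noteq> {}" using s by (auto simp: nerve_pair_def)
    have "p ` s \<subseteq> subidx \<alpha>" "q ` s \<subseteq> subidx \<alpha>"
      using p q s'(1) by (auto simp: refinement_projection_def image_subset_iff subset_iff)
    moreover have "Car \<alpha> (p ` s \<union> q ` s) \<inter> snd P \<noteq> {}"
      using Car [OF subset_trans [OF s'(1) \<beta>]] s'(4) by auto
    ultimately show ?thesis using s' by (simp add: nerve_pair_def)
  qed
  ultimately show ?thesis by (simp add: contiguous_def)
qed

text \<open>Contiguity of a map with itself is simpliciality.\<close>

lemma refinement_projection_simplicial_map:
  assumes "subidx \<beta> \<subseteq> idx \<beta>" "refinement_projection \<alpha> \<beta> p"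
  shows "simplicial_map (nerve_pair P \<beta>) (nerve_pair P \<alpha>) p"
  using refinement_projections_contiguous [OF assms(1) assms(2) assms(2), of P]
  by (simp add: contiguous_def simplicial_map_def)

lemma refinement_projection_ident: "refinement_projection \<alpha> \<alpha> (\<lambda>v. v)"
  by (simp add: refinement_projection_def)

lemma refinement_projection_compose:
  "refinement_projection \<alpha> \<beta> p \<Longrightarrow> refinement_projection \<beta> \<gamma> q \<Longrightarrow> refinement_projection \<alpha> \<gamma> (\<lambda>v. p (q v))"
  unfolding refinement_projection_def by (simp add: image_subset_iff) blast

lemma refinesE:
  assumes "refines \<alpha> \<beta>"
  obtains p where "refinement_projection \<alpha> \<beta> p"
  using assms by (auto simp: refines_def)

lemma border_covers_nonempty:
  assumes "P \<in> N2p_obj"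
  shows "border_covers P \<noteq> {}"
proof -
  obtain X A where P: "P = (X, A)" by fastforce
  have "A \<subseteq> topspace X" using assms by (auto simp: P N2p_obj_def dest: closedin_subset)
  \<comment> \<open>The one-member cover by the whole space, whose compact set is empty.\<close>
  then have "\<lparr>idx = {0}, subidx = {0}, member = (\<lambda>v\<in>{0}. topspace X)\<rparr> \<in> border_covers P"
    by (auto simp: P border_covers_def intro!: exI [of _ "{}"])
  then show ?thesis by blast
qed

text \<open>The intersections \<alpha>_v \<inter> \<beta>_w refine both covers, and their union is
  the complement of the compact set K \<union> L.\<close>

lemma border_covers_directed:
  assumes \<alpha>: "\<alpha> \<in> border_covers P" and \<beta>: "\<beta> \<in> border_covers P"
  shows "\<exists>\<gamma>\<in>border_covers P. refines \<alpha> \<gamma> \<and> refines \<beta> \<gamma>"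
proof -
  obtain X A where P: "P = (X, A)" by fastforce
  obtain K where K: "compactin X K" "topspace X - K = (\<Union>v\<in>idx \<alpha>. member \<alpha> v)" "A - K \<subseteq> (\<Union>v\<in>subidx \<alpha>. member \<alpha> v)"
    and a: "finite (idx \<alpha>)" "subidx \<alpha> \<subseteq> idx \<alpha>" "\<And>v. v \<in> idx \<alpha> \<Longrightarrow> openin X (member \<alpha> v)"
    using \<alpha> by (auto simp: border_covers_def P)
  obtain L where L: "compactin X L" "topspace X - L = (\<Union>v\<in>idx \<beta>. member \<beta> v)" "A - L \<subseteq> (\<Union>v\<in>subidx \<beta>. member \<beta> v)"
    and b: "finite (idx \<beta>)" "subidx \<beta> \<subseteq> idx \<beta>" "\<And>v. v \<in> idx \<beta> \<Longrightarrow> openin X (member \<beta> v)"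
    using \<beta> by (auto simp: border_covers_def P)
  \<comment> \<open>Pairs of indices are encoded as natural numbers, the index type of border
    covers; decoding gives the two refinement projections.\<close>
  let ?p = "\<lambda>w. fst (prod_decode w)" and ?q = "\<lambda>w. snd (prod_decode w)"
  define V where "V = prod_encode ` (idx \<alpha> \<times> idx \<beta>)"
  define W where "W = prod_encode ` (subidx \<alpha> \<times> subidx \<beta>)"
  define \<gamma> where "\<gamma> = \<lparr>idx = V, subidx = W, member = (\<lambda>w\<in>V. member \<alpha> (?p w) \<inter> member \<beta> (?q w))\<rparr>"
  have WV: "W \<subseteq> V" using a(2) b(2) by (auto simp: V_def W_def)
  have 1: "(\<Union>w\<in>V. member \<gamma> w) = (\<Union>v\<in>idx \<alpha>. member \<alpha> v) \<inter> (\<Union>v\<in>idx \<beta>. member \<beta> v)"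
    by (auto simp: \<gamma>_def V_def)
  have 2: "(\<Union>w\<in>W. member \<gamma> w) = (\<Union>v\<in>subidx \<alpha>. member \<alpha> v) \<inter> (\<Union>v\<in>subidx \<beta>. member \<beta> v)"
  proof -
    have "(\<Union>w\<in>W. member \<gamma> w) = (\<Union>w\<in>W. member \<alpha> (?p w) \<inter> member \<beta> (?q w))"
      using WV by (intro SUP_cong) (auto simp: \<gamma>_def)
    also have "\<dots> = (\<Union>v\<in>subidx \<alpha>. member \<alpha> v) \<inter> (\<Union>v\<in>subidx \<beta>. member \<beta> v)" by (auto simp: W_def)
    finally show ?thesis .
  qed
  have "topspace X - (K \<union> L) = (\<Union>w\<in>V. member \<gamma> w)"
    unfolding 1 K(2) [symmetric] L(2) [symmetric] by blast
  moreover have "A - (K \<union> L) \<subseteq> (\<Union>w\<in>W. member \<gamma> w)"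
    unfolding 2 using K(3) L(3) by blast
  moreover have "compactin X (K \<union> L)" using K(1) L(1) by (rule compactin_Un)
  moreover have "openin X (member \<gamma> w)" if "w \<in> V" for w
    using that a(3) b(3) by (auto simp: \<gamma>_def V_def)
  moreover have "finite V" using a(1) b(1) by (simp add: V_def)
  ultimately have "\<gamma> \<in> border_covers P"
    using WV unfolding border_covers_def P by (auto simp: \<gamma>_def simp del: UN_simps)
  moreover have "refinement_projection \<alpha> \<gamma> ?p" "refinement_projection \<beta> \<gamma> ?q"
    by (auto simp: refinement_projection_def \<gamma>_def V_def W_def)
  ultimately show ?thesis by (auto simp: refines_def)
qed

lemma idx_preimage_family [simp]: "idx (preimage_family P f \<alpha>) = idx \<alpha>" "subidx (preimage_family P f \<alpha>) = subidx \<alpha>"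
  by (simp_all add: preimage_family_def)

text \<open>The same vertex map serves for the preimages, which makes the squares in
  \<open>preimage_homology_bond\<close> commute on the nose.\<close>

lemma refinement_projection_preimage:
  assumes "refinement_projection \<alpha> \<beta> p"
  shows "refinement_projection (preimage_family P f \<alpha>) (preimage_family P f \<beta>) p"
proof -
  have "p v \<in> idx \<alpha>" "member \<beta> v \<subseteq> member \<alpha> (p v)" if "v \<in> idx \<beta>" for v
    using assms that by (auto simp: refinement_projection_def)
  then show ?thesis using assms by (auto simp: refinement_projection_def preimage_family_def)
qed

lemma refines_preimage: "refines \<alpha> \<beta> \<Longrightarrow> refines (preimage_family P f \<alpha>) (preimage_family P f \<beta>)"
  unfolding refines_def using refinement_projection_preimage by blast

text \<open>If x is common to the preimages, then f x is common to the members, and f maps A into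
  B.\<close>

lemma preimage_inclusion_simplicial_map:
  assumes f: "f \<in> N2p_hom P Q" and \<alpha>: "\<alpha> \<in> border_covers Q"
  shows "simplicial_map (nerve_pair P (preimage_family P f \<alpha>)) (nerve_pair Q \<alpha>) (\<lambda>v. v)"
proof -
  have 1: "f x \<in> Car \<alpha> s" if "x \<in> Car (preimage_family P f \<alpha>) s" "s \<subseteq> idx \<alpha>" for x s
  proof -
    have "f x \<in> member \<alpha> v" if "v \<in> s" for v
    proof -
      have "x \<in> member (preimage_family P f \<alpha>) v" using \<open>x \<in> Car _ s\<close> that by (simp add: Car_def)
      then show ?thesis using \<open>s \<subseteq> idx \<alpha>\<close> that by (auto simp: preimage_family_def)
    qed
    then show ?thesis by (simp add: Car_def)
  qed
  have 2: "f x \<in> snd Q" if "x \<in> snd P" for x using f that by (auto simp: N2p_hom_def)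
  have "s \<in> fst (nerve_pair Q \<alpha>)" if "s \<in> fst (nerve_pair P (preimage_family P f \<alpha>))" for s
    using that 1 [of _ s] by (auto simp: nerve_pair_def)
  moreover have "s \<in> snd (nerve_pair Q \<alpha>)" if "s \<in> snd (nerve_pair P (preimage_family P f \<alpha>))" for s
    using that 1 [of _ s] 2 border_coversD(2) [OF \<alpha>] by (fastforce simp: nerve_pair_def)
  ultimately show ?thesis by (simp add: simplicial_map_def)
qed

text \<open>An equality of covers and not just mutual refinement: members lie in the space and are
  extensional in the index. Coordinates of the limit can then be compared without a bonding
  map.\<close>

lemma preimage_family_ident:
  assumes "\<alpha> \<in> border_covers P"
  shows "preimage_family P (N2p_id P) \<alpha> = \<alpha>"
proof -
  have "(\<lambda>v\<in>idx \<alpha>. {x \<in> topspace (fst P). N2p_id P x \<in> member \<alpha> v}) = member \<alpha>"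
    using border_coversD(3,4) [OF assms]
    by (intro extensionalityI [of _ "idx \<alpha>"]) (auto simp: N2p_id_def)
  then show ?thesis by (simp add: preimage_family_def)
qed

text \<open>Again an equality of indices. The composite is restricted to the space of
  \<open>P\<close>, which is also where the preimages are taken.\<close>

lemma preimage_family_compose:
  assumes "f \<in> N2p_hom P Q"
  shows "preimage_family P (N2p_comp P g f) \<alpha> = preimage_family P f (preimage_family Q g \<alpha>)"
proof -
  have "f x \<in> topspace (fst Q)" if "x \<in> topspace (fst P)" for x
    using assms that by (auto simp: N2p_hom_def proper_continuous_map_def continuous_map_def)
  then show ?thesis
    by (auto simp: preimage_family_def N2p_comp_def compose_def fun_eq_iff)
qed

context comm_group
begin

section \<open>Border homology as a functor\<close>

text \<open>Replaces the projection picked by Hilbert choice by any other; from here on each bonding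
  map is represented by the projection that suits the argument.\<close>

lemma border_homology_bond_eq:
  assumes \<alpha>: "\<alpha> \<in> border_covers P" and \<beta>: "\<beta> \<in> border_covers P" and p: "refinement_projection \<alpha> \<beta> p"
  shows "border_homology_bond n G P \<alpha> \<beta> = simplicial_homology_map G n (nerve_pair P \<beta>) (nerve_pair P \<alpha>) p"
proof -
  have q: "refinement_projection \<alpha> \<beta> (SOME p. refinement_projection \<alpha> \<beta> p)" by (rule someI [of "refinement_projection \<alpha> \<beta>", OF p])
  show ?thesis
    unfolding border_homology_bond_def
    using border_coversD(2) [OF \<beta>] p q
    by (intro homology_map_contiguous complex_pair_nerve [OF \<alpha>] complex_pair_nerve [OF \<beta>]
        finite_nerve_vertices [OF \<beta>] refinement_projection_simplicial_map refinement_projections_contiguous)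
qed

lemma border_cohomology_bond_eq:
  assumes \<alpha>: "\<alpha> \<in> border_covers P" and \<beta>: "\<beta> \<in> border_covers P" and p: "refinement_projection \<alpha> \<beta> p"
  shows "border_cohomology_bond n G P \<alpha> \<beta> = simplicial_cohomology_map G n (nerve_pair P \<beta>) (nerve_pair P \<alpha>) p"
proof -
  have q: "refinement_projection \<alpha> \<beta> (SOME p. refinement_projection \<alpha> \<beta> p)" by (rule someI [of "refinement_projection \<alpha> \<beta>", OF p])
  show ?thesis
    unfolding border_cohomology_bond_def
    using border_coversD(2) [OF \<beta>] p q
    by (intro cohomology_map_contiguous complex_pair_nerve [OF \<alpha>] complex_pair_nerve [OF \<beta>]
        finite_nerve_vertices [OF \<beta>] refinement_projection_simplicial_map refinement_projections_contiguous)
qed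

lemma border_homology_bond_hom:
  assumes "\<alpha> \<in> border_covers P" "\<beta> \<in> border_covers P" "refines \<alpha> \<beta>"
  shows "border_homology_bond n G P \<alpha> \<beta>
     \<in> hom (simplicial_homology G n (nerve_pair P \<beta>)) (simplicial_homology G n (nerve_pair P \<alpha>))"
proof -
  obtain p where p: "refinement_projection \<alpha> \<beta> p" using assms(3) by (rule refinesE)
  show ?thesis
    unfolding border_homology_bond_eq [OF assms(1,2) p]
    by (intro homology_map_hom complex_pair_nerve assms refinement_projection_simplicial_map border_coversD(2) [OF assms(2)] p)
qed

lemma comm_group_border_homology: "comm_group (border_homology n G P)"
  unfolding border_homology_def
  by (rule comm_group_inverse_limit) (auto intro: comm_group_homology complex_pair_nerve border_homology_bond_hom)

text \<open>With one projection \<open>p\<close> for the covers and for their preimages, both paths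
  are induced by the vertex map \<open>p\<close>.\<close>

lemma preimage_homology_bond:
  assumes P: "P \<in> N2p_obj" and f: "f \<in> N2p_hom P Q"
    and \<alpha>: "\<alpha> \<in> border_covers Q" and \<beta>: "\<beta> \<in> border_covers Q" and r: "refines \<alpha> \<beta>"
    and S: "S \<in> carrier (simplicial_homology G n (nerve_pair P (preimage_family P f \<beta>)))"
  shows "simplicial_homology_map G n (nerve_pair P (preimage_family P f \<alpha>)) (nerve_pair Q \<alpha>) (\<lambda>v. v)
       (border_homology_bond n G P (preimage_family P f \<alpha>) (preimage_family P f \<beta>) S)
     = border_homology_bond n G Q \<alpha> \<beta>
         (simplicial_homology_map G n (nerve_pair P (preimage_family P f \<beta>)) (nerve_pair Q \<beta>) (\<lambda>v. v) S)"
proof -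
  obtain p where p: "refinement_projection \<alpha> \<beta> p" using r by (rule refinesE)
  note a = preimage_family_border_cover [OF f \<alpha> P] and b = preimage_family_border_cover [OF f \<beta> P]
  note p' = refinement_projection_preimage [OF p, of P f]
  note ia = preimage_inclusion_simplicial_map [OF f \<alpha>] and ib = preimage_inclusion_simplicial_map [OF f \<beta>]
  note sp = refinement_projection_simplicial_map [OF border_coversD(2) [OF \<beta>] p, of Q]
  note sp' = refinement_projection_simplicial_map [OF border_coversD(2) [OF b] p', of P]
  show ?thesis
    unfolding border_homology_bond_eq [OF \<alpha> \<beta> p] border_homology_bond_eq [OF a b p']
    using homology_map_compose [OF complex_pair_nerve [OF b] complex_pair_nerve [OF a] complex_pair_nerve [OF \<alpha>] sp' ia S]
      homology_map_compose [OF complex_pair_nerve [OF b] complex_pair_nerve [OF \<beta>] complex_pair_nerve [OF \<alpha>] ib sp S]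
    by simp
qed

lemma border_homology_map_hom:
  assumes P: "P \<in> N2p_obj" and f: "f \<in> N2p_hom P Q"
  shows "border_homology_map n G P Q f \<in> hom (border_homology n G P) (border_homology n G Q)"
  unfolding border_homology_map_def border_homology_def
  by (rule inverse_limit_map_hom; (rule preimage_homology_bond [OF P f]; assumption)?)
    (auto intro: refines_preimage preimage_family_border_cover [OF f _ P] comm_group_homology complex_pair_nerve border_homology_bond_hom
    homology_map_hom preimage_inclusion_simplicial_map [OF f])

lemma border_homology_map_ident:
  "border_homology_map n G P P (N2p_id P) = (\<lambda>x\<in>carrier (border_homology n G P). x)"
proof
  fix x
  show "border_homology_map n G P P (N2p_id P) x = (\<lambda>x\<in>carrier (border_homology n G P). x) x"
  proof (cases "x \<in> carrier (border_homology n G P)")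
    case True
    have "border_homology_map n G P P (N2p_id P) x = x"
    proof (rule extensionalityI [of _ "border_covers P"])
      show "x \<in> extensional (border_covers P)"
        using True by (simp add: border_homology_def mem_inverse_limit PiE_def)
      show "border_homology_map n G P P (N2p_id P) x \<alpha> = x \<alpha>" if \<alpha>: "\<alpha> \<in> border_covers P" for \<alpha>
        using True \<alpha> homology_map_ident [OF complex_pair_nerve [OF \<alpha>]] inverse_limit_closed [OF True [unfolded border_homology_def] \<alpha>]
        by (simp add: border_homology_map_def preimage_family_ident)
    qed (simp add: border_homology_map_def True)
    then show ?thesis using True by simp
  qed (simp add: border_homology_map_def)
qed

text \<open>At \<alpha> both sides are computed from the coordinate of x at
  f^{-1}(g^{-1}(\<alpha>)), by the composite of two inclusions of nerves.\<close>

lemma border_homology_map_compose: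
  assumes P: "P \<in> N2p_obj" and Q: "Q \<in> N2p_obj" and f: "f \<in> N2p_hom P Q" and g: "g \<in> N2p_hom Q R"
  shows "border_homology_map n G P R (N2p_comp P g f)
     = compose (carrier (border_homology n G P)) (border_homology_map n G Q R g) (border_homology_map n G P Q f)"
proof
  fix x
  show "border_homology_map n G P R (N2p_comp P g f) x
     = compose (carrier (border_homology n G P)) (border_homology_map n G Q R g) (border_homology_map n G P Q f) x"
  proof (cases "x \<in> carrier (border_homology n G P)")
    case True
    have fx: "border_homology_map n G P Q f x \<in> carrier (border_homology n G Q)"
      by (rule hom_in_carrier [OF border_homology_map_hom [OF P f] True])
    have "border_homology_map n G P R (N2p_comp P g f) x \<alpha> = border_homology_map n G Q R g (border_homology_map n G P Q f x) \<alpha>" for \<alpha>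
    proof (cases "\<alpha> \<in> border_covers R")
      case \<alpha>: True
      note b = preimage_family_border_cover [OF g \<alpha> Q]
      note c = preimage_family_border_cover [OF f b P]
      have "x (preimage_family P f (preimage_family Q g \<alpha>))
          \<in> carrier (simplicial_homology G n (nerve_pair P (preimage_family P f (preimage_family Q g \<alpha>))))"
        by (rule inverse_limit_closed [OF True [unfolded border_homology_def] c])
      then show ?thesis
        using True fx \<alpha> b homology_map_compose [OF complex_pair_nerve [OF c] complex_pair_nerve [OF b] complex_pair_nerve [OF \<alpha>]
            preimage_inclusion_simplicial_map [OF f b] preimage_inclusion_simplicial_map [OF g \<alpha>]]
        by (simp add: border_homology_map_def preimage_family_compose [OF f])
    qed (use True fx in \<open>simp add: border_homology_map_def\<close>)
    then show ?thesis using True by (simp add: compose_def fun_eq_iff)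
  qed (simp add: border_homology_map_def compose_def)
qed

section \<open>Border cohomology as a functor\<close>

text \<open>The bonding maps are strictly functorial in spite of the choices:
  \<open>border_cohomology_bond_eq\<close> lets the identity and composites of projections represent
  them.\<close>

lemma direct_system_border_cohomology:
  assumes P: "P \<in> N2p_obj"
  shows "direct_system (border_covers P) refines
     (\<lambda>\<alpha>. simplicial_cohomology G n (nerve_pair P \<alpha>)) (border_cohomology_bond n G P)"
proof (rule direct_system.intro)
  fix \<alpha> assume \<alpha>: "\<alpha> \<in> border_covers P"
  show "comm_group (simplicial_cohomology G n (nerve_pair P \<alpha>))"
    by (rule comm_group_cohomology [OF complex_pair_nerve [OF \<alpha>]])
  show "refines \<alpha> \<alpha>" using refinement_projection_ident unfolding refines_def by blast
  show "border_cohomology_bond n G P \<alpha> \<alpha> S = S" if "S \<in> carrier (simplicial_cohomology G n (nerve_pair P \<alpha>))" for S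
    unfolding border_cohomology_bond_eq [OF \<alpha> \<alpha> refinement_projection_ident]
    by (rule cohomology_map_ident [OF complex_pair_nerve [OF \<alpha>] that])
  fix \<beta> assume \<beta>: "\<beta> \<in> border_covers P"
  show "\<exists>\<gamma>\<in>border_covers P. refines \<alpha> \<gamma> \<and> refines \<beta> \<gamma>" by (rule border_covers_directed [OF \<alpha> \<beta>])
  show "border_cohomology_bond n G P \<alpha> \<beta>
     \<in> hom (simplicial_cohomology G n (nerve_pair P \<alpha>)) (simplicial_cohomology G n (nerve_pair P \<beta>))"
    if r: "refines \<alpha> \<beta>"
  proof -
    obtain p where p: "refinement_projection \<alpha> \<beta> p" using r by (rule refinesE)
    show ?thesis
      unfolding border_cohomology_bond_eq [OF \<alpha> \<beta> p]
      by (intro cohomology_map_hom complex_pair_nerve \<alpha> \<beta> refinement_projection_simplicial_map border_coversD(2) [OF \<beta>] p)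
  qed
  fix \<gamma> assume \<gamma>: "\<gamma> \<in> border_covers P" and r1: "refines \<alpha> \<beta>" and r2: "refines \<beta> \<gamma>"
  obtain p where p: "refinement_projection \<alpha> \<beta> p" using r1 by (rule refinesE)
  obtain q where q: "refinement_projection \<beta> \<gamma> q" using r2 by (rule refinesE)
  note pq = refinement_projection_compose [OF p q]
  show "refines \<alpha> \<gamma>" using pq unfolding refines_def by blast
  show "border_cohomology_bond n G P \<beta> \<gamma> (border_cohomology_bond n G P \<alpha> \<beta> S) = border_cohomology_bond n G P \<alpha> \<gamma> S"
    if "S \<in> carrier (simplicial_cohomology G n (nerve_pair P \<alpha>))" for S
    unfolding border_cohomology_bond_eq [OF \<alpha> \<beta> p] border_cohomology_bond_eq [OF \<beta> \<gamma> q] border_cohomology_bond_eq [OF \<alpha> \<gamma> pq]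
    by (intro cohomology_map_compose complex_pair_nerve \<alpha> \<beta> \<gamma> refinement_projection_simplicial_map border_coversD(2) [OF \<beta>]
        border_coversD(2) [OF \<gamma>] p q that)
qed (rule border_covers_nonempty [OF P])

lemma comm_group_border_cohomology: "P \<in> N2p_obj \<Longrightarrow> comm_group (border_cohomology n G P)"
  unfolding border_cohomology_def by (rule direct_system.comm_group_lim [OF direct_system_border_cohomology])

text \<open>Dual to \<open>preimage_homology_bond\<close>; the class sits at the coarser cover here,
  since the bonding maps lead to finer ones.\<close>

lemma preimage_cohomology_bond:
  assumes P: "P \<in> N2p_obj" and f: "f \<in> N2p_hom P Q"
    and \<alpha>: "\<alpha> \<in> border_covers Q" and \<beta>: "\<beta> \<in> border_covers Q" and r: "refines \<alpha> \<beta>"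
    and S: "S \<in> carrier (simplicial_cohomology G n (nerve_pair Q \<alpha>))"
  shows "simplicial_cohomology_map G n (nerve_pair P (preimage_family P f \<beta>)) (nerve_pair Q \<beta>) (\<lambda>v. v)
       (border_cohomology_bond n G Q \<alpha> \<beta> S)
     = border_cohomology_bond n G P (preimage_family P f \<alpha>) (preimage_family P f \<beta>)
         (simplicial_cohomology_map G n (nerve_pair P (preimage_family P f \<alpha>)) (nerve_pair Q \<alpha>) (\<lambda>v. v) S)"
proof -
  obtain p where p: "refinement_projection \<alpha> \<beta> p" using r by (rule refinesE)
  note a = preimage_family_border_cover [OF f \<alpha> P] and b = preimage_family_border_cover [OF f \<beta> P]
  note p' = refinement_projection_preimage [OF p, of P f]
  note ia = preimage_inclusion_simplicial_map [OF f \<alpha>] and ib = preimage_inclusion_simplicial_map [OF f \<beta>]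
  note sp = refinement_projection_simplicial_map [OF border_coversD(2) [OF \<beta>] p, of Q]
  note sp' = refinement_projection_simplicial_map [OF border_coversD(2) [OF b] p', of P]
  show ?thesis
    unfolding border_cohomology_bond_eq [OF \<alpha> \<beta> p] border_cohomology_bond_eq [OF a b p']
    using cohomology_map_compose [OF complex_pair_nerve [OF b] complex_pair_nerve [OF a] complex_pair_nerve [OF \<alpha>] sp' ia S]
      cohomology_map_compose [OF complex_pair_nerve [OF b] complex_pair_nerve [OF \<beta>] complex_pair_nerve [OF \<alpha>] ib sp S]
    by simp
qed

lemma direct_system_map_border_cohomology:
  assumes P: "P \<in> N2p_obj" and Q: "Q \<in> N2p_obj" and f: "f \<in> N2p_hom P Q"
  shows "direct_system_map
     (border_covers Q) refines (\<lambda>\<alpha>. simplicial_cohomology G n (nerve_pair Q \<alpha>)) (border_cohomology_bond n G Q)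
     (border_covers P) refines (\<lambda>\<alpha>. simplicial_cohomology G n (nerve_pair P \<alpha>)) (border_cohomology_bond n G P)
     (preimage_family P f)
     (\<lambda>\<alpha>. simplicial_cohomology_map G n (nerve_pair P (preimage_family P f \<alpha>)) (nerve_pair Q \<alpha>) (\<lambda>v. v))"
  by (intro direct_system_map.intro direct_system_map_axioms.intro direct_system_border_cohomology P Q;
      (rule preimage_cohomology_bond [OF P f]; assumption)?)
    (auto intro: refines_preimage preimage_family_border_cover [OF f _ P] complex_pair_nerve
    cohomology_map_hom preimage_inclusion_simplicial_map [OF f])

lemma border_cohomology_map_hom:
  assumes P: "P \<in> N2p_obj" and Q: "Q \<in> N2p_obj" and f: "f \<in> N2p_hom P Q"
  shows "border_cohomology_map n G P Q f \<in> hom (border_cohomology n G Q) (border_cohomology n G P)"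
  unfolding border_cohomology_map_def border_cohomology_def
  by (rule direct_system_map.lim_map_hom [OF direct_system_map_border_cohomology [OF assms]])

definition border_class where
  "border_class n P = direct_system.cls (border_covers P) refines
     (\<lambda>\<alpha>. simplicial_cohomology G n (nerve_pair P \<alpha>)) (border_cohomology_bond n G P)"

lemma border_cohomology_carrierE:
  assumes "P \<in> N2p_obj" "S \<in> carrier (border_cohomology n G P)"
  obtains \<alpha> u where "\<alpha> \<in> border_covers P" "u \<in> carrier (simplicial_cohomology G n (nerve_pair P \<alpha>))" "S = border_class n P \<alpha> u"
  using assms(2) direct_system.carrier_lim [OF direct_system_border_cohomology [OF assms(1)]]
  by (auto simp: border_cohomology_def border_class_def)

text \<open>Reduces statements about limits to representatives at a single cover.\<close>

lemma border_cohomology_map_class: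
  assumes P: "P \<in> N2p_obj" and Q: "Q \<in> N2p_obj" and f: "f \<in> N2p_hom P Q"
    and "\<alpha> \<in> border_covers Q" "u \<in> carrier (simplicial_cohomology G n (nerve_pair Q \<alpha>))"
  shows "border_cohomology_map n G P Q f (border_class n Q \<alpha> u)
     = border_class n P (preimage_family P f \<alpha>)
         (simplicial_cohomology_map G n (nerve_pair P (preimage_family P f \<alpha>)) (nerve_pair Q \<alpha>) (\<lambda>v. v) u)"
  unfolding border_cohomology_map_def border_cohomology_def border_class_def
  by (rule direct_system_map.lim_map_cls [OF direct_system_map_border_cohomology [OF P Q f] assms(4,5)])

lemma border_cohomology_map_ident:
  assumes P: "P \<in> N2p_obj"
  shows "border_cohomology_map n G P P (N2p_id P) = (\<lambda>S\<in>carrier (border_cohomology n G P). S)"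
proof
  fix S
  show "border_cohomology_map n G P P (N2p_id P) S = (\<lambda>S\<in>carrier (border_cohomology n G P). S) S"
  proof (cases "S \<in> carrier (border_cohomology n G P)")
    case True
    obtain \<alpha> u where \<alpha>: "\<alpha> \<in> border_covers P" and u: "u \<in> carrier (simplicial_cohomology G n (nerve_pair P \<alpha>))"
      and S: "S = border_class n P \<alpha> u" using P True by (rule border_cohomology_carrierE)
    have "border_cohomology_map n G P P (N2p_id P) S = S"
      unfolding S border_cohomology_map_class [OF P P N2p_id_in_hom [OF P] \<alpha> u]
      by (simp add: preimage_family_ident [OF \<alpha>] cohomology_map_ident [OF complex_pair_nerve [OF \<alpha>] u])
    then show ?thesis using True by simp
  qed (simp add: border_cohomology_map_def)
qed

text \<open>For the class of (\<alpha>, u) both sides have the index f^{-1}(g^{-1}(\<alpha>)), so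
  they agree already as representatives.\<close>

lemma border_cohomology_map_compose:
  assumes P: "P \<in> N2p_obj" and Q: "Q \<in> N2p_obj" and R: "R \<in> N2p_obj"
    and f: "f \<in> N2p_hom P Q" and g: "g \<in> N2p_hom Q R"
  shows "border_cohomology_map n G P R (N2p_comp P g f)
     = compose (carrier (border_cohomology n G R)) (border_cohomology_map n G P Q f) (border_cohomology_map n G Q R g)"
proof
  fix S
  show "border_cohomology_map n G P R (N2p_comp P g f) S
     = compose (carrier (border_cohomology n G R)) (border_cohomology_map n G P Q f) (border_cohomology_map n G Q R g) S"
  proof (cases "S \<in> carrier (border_cohomology n G R)")
    case True
    obtain \<alpha> u where \<alpha>: "\<alpha> \<in> border_covers R" and u: "u \<in> carrier (simplicial_cohomology G n (nerve_pair R \<alpha>))"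
      and S: "S = border_class n R \<alpha> u" using R True by (rule border_cohomology_carrierE)
    note b = preimage_family_border_cover [OF g \<alpha> Q]
    note c = preimage_family_border_cover [OF f b P]
    note ig = preimage_inclusion_simplicial_map [OF g \<alpha>]
    have gu: "simplicial_cohomology_map G n (nerve_pair Q (preimage_family Q g \<alpha>)) (nerve_pair R \<alpha>) (\<lambda>v. v) u
        \<in> carrier (simplicial_cohomology G n (nerve_pair Q (preimage_family Q g \<alpha>)))"
      by (rule hom_in_carrier [OF cohomology_map_hom [OF complex_pair_nerve [OF b] complex_pair_nerve [OF \<alpha>] ig] u])
    have "border_cohomology_map n G P R (N2p_comp P g f) S = border_cohomology_map n G P Q f (border_cohomology_map n G Q R g S)"
      unfolding S border_cohomology_map_class [OF P R N2p_comp_in_hom [OF f g P] \<alpha> u]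
        border_cohomology_map_class [OF Q R g \<alpha> u] border_cohomology_map_class [OF P Q f b gu]
        preimage_family_compose [OF f]
        cohomology_map_compose [OF complex_pair_nerve [OF c] complex_pair_nerve [OF b] complex_pair_nerve [OF \<alpha>]
          preimage_inclusion_simplicial_map [OF f b] ig u]
      by (rule refl)
    then show ?thesis using True by (simp add: compose_def)
  qed (simp add: border_cohomology_map_def compose_def)
qed

end

text \<open>Three type variables, since a composite passes through spaces whose points may have
  different types. Induced maps are extensional, so they are compared with the restricted identity
  and with \<open>compose\<close>.\<close>

theorem theorem1p5:
  fixes G :: "('g, 'm) monoid_scheme" and n :: nat
  assumes "comm_group G"
  shows
    "(\<forall>P \<in> (N2p_obj :: ('a topology \<times> 'a set) set).
        comm_group (border_homology n G P)) \<and>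
     (\<forall>P \<in> (N2p_obj :: ('a topology \<times> 'a set) set).
      \<forall>Q \<in> (N2p_obj :: ('b topology \<times> 'b set) set).
      \<forall>f \<in> N2p_hom P Q.
        border_homology_map n G P Q f \<in> hom (border_homology n G P) (border_homology n G Q)) \<and>
     (\<forall>P \<in> (N2p_obj :: ('a topology \<times> 'a set) set).
        border_homology_map n G P P (N2p_id P) = (\<lambda>x\<in>carrier (border_homology n G P). x)) \<and>
     (\<forall>P \<in> (N2p_obj :: ('a topology \<times> 'a set) set).
      \<forall>Q \<in> (N2p_obj :: ('b topology \<times> 'b set) set).
      \<forall>R \<in> (N2p_obj :: ('c topology \<times> 'c set) set).
      \<forall>f \<in> N2p_hom P Q. \<forall>g \<in> N2p_hom Q R.
        border_homology_map n G P R (N2p_comp P g f) =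
          compose (carrier (border_homology n G P))
            (border_homology_map n G Q R g) (border_homology_map n G P Q f)) \<and>
     (\<forall>P \<in> (N2p_obj :: ('a topology \<times> 'a set) set).
        comm_group (border_cohomology n G P)) \<and>
     (\<forall>P \<in> (N2p_obj :: ('a topology \<times> 'a set) set).
      \<forall>Q \<in> (N2p_obj :: ('b topology \<times> 'b set) set).
      \<forall>f \<in> N2p_hom P Q.
        border_cohomology_map n G P Q f
          \<in> hom (border_cohomology n G Q) (border_cohomology n G P)) \<and>
     (\<forall>P \<in> (N2p_obj :: ('a topology \<times> 'a set) set).
        border_cohomology_map n G P P (N2p_id P) =
          (\<lambda>S\<in>carrier (border_cohomology n G P). S)) \<and>
     (\<forall>P \<in> (N2p_obj :: ('a topology \<times> 'a set) set).
      \<forall>Q \<in> (N2p_obj :: ('b topology \<times> 'b set) set).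
      \<forall>R \<in> (N2p_obj :: ('c topology \<times> 'c set) set).
      \<forall>f \<in> N2p_hom P Q. \<forall>g \<in> N2p_hom Q R.
        border_cohomology_map n G P R (N2p_comp P g f) =
          compose (carrier (border_cohomology n G R))
            (border_cohomology_map n G P Q f) (border_cohomology_map n G Q R g))"
proof -
  interpret comm_group G by (rule assms)
  show ?thesis
    by (intro conjI ballI comm_group_border_homology border_homology_map_hom border_homology_map_ident
        border_homology_map_compose comm_group_border_cohomology border_cohomology_map_hom
        border_cohomology_map_ident border_cohomology_map_compose)
qed

end
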